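(* Let $(\mathcal{C},\mathcal{E})$ be an exact IT-context, which is weakly idempotent complete. Then the following statements hold true. (a) If $n:=\mathrm{id}_{\mathcal{E}}(\mathcal{P}(\mathcal{E}))$ is finite, then $\Phi_{\mathcal{E}}\mathrm{dim}(\Omega^n_{\mathcal{E}}(\mathcal{C}))=0=\Psi_{\mathcal{E}}\mathrm{dim}(\Omega^n_{\mathcal{E}}(\mathcal{C}))$. (b) $\mathrm{fpd}_{\mathcal{E}}(\mathcal{C})\leq\Phi_{\mathcal{E}}\mathrm{dim}(\mathcal{C})\leq\Psi_{\mathcal{E}}\mathrm{dim}(\mathcal{C})\leq\mathrm{id}_{\mathcal{E}}(\mathcal{P}(\mathcal{E}))$.
   Context: Exact categories: $(\mathcal{C},\mathcal{E})$ is an exact category in the sense of Quillen: $\mathcal{C}$ is additive and $\mathcal{E}$ is a class of kernel-cokernel pairs (short $\mathcal{E}$-exact sequences) $A'\rightarrowtail A\twoheadrightarrow A''$ satisfying the usual axioms; the second maps are the admissible epics. An object $P$ is $\mathcal{E}$-projective if $\mathrm{Hom}_{\mathcal{C}}(P,-)$ takes short $\mathcal{E}$-exact sequences to short exact sequences of abelian groups; $\mathcal{P}(\mathcal{E})$ is the class of these. Enough $\mathcal{E}$-projectives: every $C$ admits an admissible epic $P\twoheadrightarrow C$ with $P\in\mathcal{P}(\mathcal{E})$. $\mathrm{Ext}^n_{\mathcal{E}}(C,B)$ is the $n$-th cohomology of $\mathrm{Hom}_{\mathcal{C}}(P_\bullet(C),B)$, with $P_\bullet(C)$ an $\mathcal{E}$-projective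 resolution of $C$ (spliced from short $\mathcal{E}$-exact sequences). $\mathrm{pd}_{\mathcal{E}}(C)=\min\{n\in\mathbb{N}: \mathrm{Ext}^j_{\mathcal{E}}(C,Z)=0\ \forall j>n,\ \forall Z\in\mathcal{C}\}$ and $\mathrm{id}_{\mathcal{E}}(C)=\min\{n\in\mathbb{N}: \mathrm{Ext}^j_{\mathcal{E}}(Z,C)=0\ \forall j>n,\ \forall Z\in\mathcal{C}\}$ ($\infty$ if there is no such $n$). For a class $\mathcal{Y}$, $\mathrm{id}_{\mathcal{E}}(\mathcal{Y})=\sup_{Y\in\mathcal{Y}}\mathrm{id}_{\mathcal{E}}(Y)$ and $\mathrm{fpd}_{\mathcal{E}}(\mathcal{Y})=\sup\{\mathrm{pd}_{\mathcal{E}}(Y): Y\in\mathcal{Y},\ \mathrm{pd}_{\mathcal{E}}(Y)<\infty\}$. $\mathcal{C}$ is weakly idempotent complete if every split monomorphism in $\mathcal{C}$ has a cokernel. An exact IT-context is a skeletally small exact category $(\mathcal{C},\mathcal{E})$ with enough $\mathcal{E}$-projectives which is Krull-Schmidt (each object is a finite direct sum of objects with local endomorphism ring). Igusa-Todorov functions: the stable category $\underline{\mathcal{C}}$ has the objects of $\mathcal{C}$, and its morphisms are those of $\mathcal{C}$ modulo morphisms factoring through an object of $\mathcal{P}(\mathcal{E})$. An $\mathcal{E}$-syzygy $\Omega_{\mathcal{E}}(M)$ is an object $K$ in a short $\mathcal{E}$-exact sequence $K\rightarrowtail P\twoheadrightarrow M$ with $P\in\mathcal{P}(\mathcal{E})$;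 it is unique up to isomorphism in $\underline{\mathcal{C}}$ and $\Omega_{\mathcal{E}}$ is an additive endofunctor of $\underline{\mathcal{C}}$ with iterates $\Omega^n_{\mathcal{E}}$; $\Omega^n_{\mathcal{E}}(\mathcal{C})$ is the class of all $n$-th $\mathcal{E}$-syzygies of objects of $\mathcal{C}$. $K_{\mathcal{E}}(\mathcal{C})$ is the free abelian group on isoclasses $[M]$ of objects of $\mathcal{C}$ modulo $[N]-[S]-[T]$ when $N\cong S\oplus T$, and $[P]$ for $P\in\mathcal{P}(\mathcal{E})$; $\Omega_{\mathcal{E}}$ induces the endomorphism $[M]\mapsto[\Omega_{\mathcal{E}}(M)]$ of it. $\langle M\rangle$ is the subgroup generated by the classes of the indecomposable direct summands of $M$ in $\underline{\mathcal{C}}$. Then $\Phi_{\mathcal{E}}(M)=\min\{k\in\mathbb{N}:\ \Omega_{\mathcal{E}}$ restricts to an isomorphism $\Omega^m_{\mathcal{E}}(\langle M\rangle)\to\Omega^{m+1}_{\mathcal{E}}(\langle M\rangle)$ for all $m\ge k\}$, and $\Psi_{\mathcal{E}}(M)=\Phi_{\mathcal{E}}(M)+\mathrm{fpd}_{\mathcal{E}}(\mathrm{add}(\Omega_{\mathcal{E}}^{\Phi_{\mathcal{E}}(M)}(M)))$, where $\mathrm{add}(X)$ is the class of direct summands of finite direct sums of copies of $X$. For a class $\mathcal{Y}$, $\Phi_{\mathcal{E}}\mathrm{dim}(\mathcal{Y})$ and $\Psi_{\mathcal{E}}\mathrm{dim}(\mathcal{Y})$ are the suprema of $\Phi_{\mathcal{E}}$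 and $\Psi_{\mathcal{E}}$ over $\mathcal{Y}$. *)

theory Defs
  imports "HOL-Algebra.Ring" "HOL-Algebra.Exact_Sequence" "HOL-Algebra.Free_Abelian_Groups"
    "HOL-Library.Extended_Nat"
begin

text \<open>
  HOL-Algebra has no additive or exact categories, so they are set up here.  A category has a set
  of objects and a set of arrows with domain and codomain; composition is written in the usual
  order (first \<open>f\<close>, then \<open>g\<close>, is \<open>g \<cdot> f\<close>), and the operations are only constrained on
  composable, respectively parallel, arrows.

  Objects and arrows form sets of a HOL type, so every such category is small.
  This is how \<open>skeletally small\<close> is rendered: the isomorphism classes always form a set.
\<close>

record ('o, 'm) padd_cat =
  Obj :: "'o set"
  Arr :: "'m set"
  Dom :: "'m \<Rightarrow> 'o"
  Cod :: "'m \<Rightarrow> 'o"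
  Ide :: "'o \<Rightarrow> 'm"
  Comp :: "'m \<Rightarrow> 'm \<Rightarrow> 'm"  (infixl \<open>\<cdot>\<index>\<close> 70)
  Add :: "'m \<Rightarrow> 'm \<Rightarrow> 'm"
  Zero :: "'o \<Rightarrow> 'o \<Rightarrow> 'm"

text \<open>A pair \<open>(i, p)\<close> in \<open>Conf\<close> is a short exact sequence of the exact structure.\<close>

record ('o, 'm) exact_cat = "('o, 'm) padd_cat" +
  Conf :: "('m \<times> 'm) set"

definition Hom :: "('o, 'm, 'z) padd_cat_scheme \<Rightarrow> 'o \<Rightarrow> 'o \<Rightarrow> 'm set" where
  "Hom \<C> A B = {f \<in> Arr \<C>. Dom \<C> f = A \<and> Cod \<C> f = B}"

definition Hom_group :: "('o, 'm, 'z) padd_cat_scheme \<Rightarrow> 'o \<Rightarrow> 'o \<Rightarrow> 'm monoid" where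
  "Hom_group \<C> A B = \<lparr>carrier = Hom \<C> A B, mult = Add \<C>, one = Zero \<C> A B\<rparr>"

definition End_ring :: "('o, 'm, 'z) padd_cat_scheme \<Rightarrow> 'o \<Rightarrow> 'm ring" where
  "End_ring \<C> A = \<lparr>carrier = Hom \<C> A A, mult = Comp \<C>, one = Ide \<C> A,
                   ring.zero = Zero \<C> A A, ring.add = Add \<C>\<rparr>"


section \<open>Additive categories\<close>

locale preadditive_category =
  fixes \<C> :: "('o, 'm, 'z) padd_cat_scheme" (structure)
  assumes dom_obj: "f \<in> Arr \<C> \<Longrightarrow> Dom \<C> f \<in> Obj \<C>"
    and cod_obj: "f \<in> Arr \<C> \<Longrightarrow> Cod \<C> f \<in> Obj \<C>"
    and ide_hom: "A \<in> Obj \<C> \<Longrightarrow> Ide \<C> A \<in> Hom \<C> A A"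
    and comp_hom: "f \<in> Hom \<C> A B \<Longrightarrow> g \<in> Hom \<C> B D \<Longrightarrow> g \<cdot> f \<in> Hom \<C> A D"
    and comp_ide_right: "f \<in> Hom \<C> A B \<Longrightarrow> f \<cdot> Ide \<C> A = f"
    and comp_ide_left: "f \<in> Hom \<C> A B \<Longrightarrow> Ide \<C> B \<cdot> f = f"
    and comp_assoc: "f \<in> Hom \<C> A B \<Longrightarrow> g \<in> Hom \<C> B D \<Longrightarrow> h \<in> Hom \<C> D E \<Longrightarrow>
                       (h \<cdot> g) \<cdot> f = h \<cdot> (g \<cdot> f)"
    and hom_comm_group: "A \<in> Obj \<C> \<Longrightarrow> B \<in> Obj \<C> \<Longrightarrow> comm_group (Hom_group \<C> A B)"
    and comp_add_right: "f \<in> Hom \<C> A B \<Longrightarrow> f' \<in> Hom \<C> A B \<Longrightarrow> g \<in> Hom \<C> B D \<Longrightarrow>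
                       g \<cdot> Add \<C> f f' = Add \<C> (g \<cdot> f) (g \<cdot> f')"
    and comp_add_left: "f \<in> Hom \<C> A B \<Longrightarrow> g \<in> Hom \<C> B D \<Longrightarrow> g' \<in> Hom \<C> B D \<Longrightarrow>
                       Add \<C> g g' \<cdot> f = Add \<C> (g \<cdot> f) (g' \<cdot> f)"

text \<open>
  \<open>A\<close> is a direct sum (biproduct) of the objects in the list \<open>Bs\<close>.  For the empty list the
  condition reads \<open>0 = 1\<close> in \<open>End(A)\<close>, that is, \<open>A\<close> is a zero object.
\<close>

definition direct_sum :: "('o, 'm, 'z) padd_cat_scheme \<Rightarrow> 'o \<Rightarrow> 'o list \<Rightarrow> bool" where
  "direct_sum \<C> A Bs \<longleftrightarrow> A \<in> Obj \<C> \<and> set Bs \<subseteq> Obj \<C> \<and>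
     (\<exists>inj prj.
        (\<forall>k < length Bs. inj k \<in> Hom \<C> (Bs ! k) A \<and> prj k \<in> Hom \<C> A (Bs ! k)) \<and>
        (\<forall>k < length Bs. \<forall>l < length Bs.
           prj l \<cdot>\<^bsub>\<C>\<^esub> inj k = (if k = l then Ide \<C> (Bs ! k) else Zero \<C> (Bs ! k) (Bs ! l))) \<and>
        finprod (Hom_group \<C> A A) (\<lambda>k. inj k \<cdot>\<^bsub>\<C>\<^esub> prj k) {..<length Bs} = Ide \<C> A)"

definition zero_object :: "('o, 'm, 'z) padd_cat_scheme \<Rightarrow> 'o \<Rightarrow> bool" where
  "zero_object \<C> A \<longleftrightarrow> direct_sum \<C> A []"

definition direct_summand :: "('o, 'm, 'z) padd_cat_scheme \<Rightarrow> 'o \<Rightarrow> 'o \<Rightarrow> bool" where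
  "direct_summand \<C> N M \<longleftrightarrow> (\<exists>N'. direct_sum \<C> M [N, N'])"

definition indecomposable :: "('o, 'm, 'z) padd_cat_scheme \<Rightarrow> 'o \<Rightarrow> bool" where
  "indecomposable \<C> M \<longleftrightarrow> M \<in> Obj \<C> \<and> \<not> zero_object \<C> M \<and>
     (\<forall>S T. direct_sum \<C> M [S, T] \<longrightarrow> zero_object \<C> S \<or> zero_object \<C> T)"

definition add_class :: "('o, 'm, 'z) padd_cat_scheme \<Rightarrow> 'o \<Rightarrow> 'o set" where
  "add_class \<C> M = {N. \<exists>n S. direct_sum \<C> S (replicate n M) \<and> direct_summand \<C> N S}"

locale additive_category = preadditive_category +
  assumes ex_zero: "\<exists>Z. zero_object \<C> Z"
    and ex_biproduct: "A \<in> Obj \<C> \<Longrightarrow> B \<in> Obj \<C> \<Longrightarrow> \<exists>S. direct_sum \<C> S [A, B]"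

definition iso_arrow :: "('o, 'm, 'z) padd_cat_scheme \<Rightarrow> 'm \<Rightarrow> bool" where
  "iso_arrow \<C> f \<longleftrightarrow> f \<in> Arr \<C> \<and>
     (\<exists>g \<in> Hom \<C> (Cod \<C> f) (Dom \<C> f). g \<cdot>\<^bsub>\<C>\<^esub> f = Ide \<C> (Dom \<C> f) \<and> f \<cdot>\<^bsub>\<C>\<^esub> g = Ide \<C> (Cod \<C> f))"

definition iso_rel :: "('o, 'm, 'z) padd_cat_scheme \<Rightarrow> ('o \<times> 'o) set" where
  "iso_rel \<C> = {(A, B). A \<in> Obj \<C> \<and> B \<in> Obj \<C> \<and> (\<exists>f \<in> Hom \<C> A B. iso_arrow \<C> f)}"

definition is_kernel :: "('o, 'm, 'z) padd_cat_scheme \<Rightarrow> 'm \<Rightarrow> 'm \<Rightarrow> bool" where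
  "is_kernel \<C> i p \<longleftrightarrow> i \<in> Arr \<C> \<and> p \<in> Arr \<C> \<and> Cod \<C> i = Dom \<C> p \<and>
     p \<cdot>\<^bsub>\<C>\<^esub> i = Zero \<C> (Dom \<C> i) (Cod \<C> p) \<and>
     (\<forall>f \<in> Arr \<C>. Cod \<C> f = Dom \<C> p \<and> p \<cdot>\<^bsub>\<C>\<^esub> f = Zero \<C> (Dom \<C> f) (Cod \<C> p) \<longrightarrow>
        (\<exists>!g. g \<in> Hom \<C> (Dom \<C> f) (Dom \<C> i) \<and> i \<cdot>\<^bsub>\<C>\<^esub> g = f))"

definition is_cokernel :: "('o, 'm, 'z) padd_cat_scheme \<Rightarrow> 'm \<Rightarrow> 'm \<Rightarrow> bool" where
  "is_cokernel \<C> i p \<longleftrightarrow> i \<in> Arr \<C> \<and> p \<in> Arr \<C> \<and> Cod \<C> i = Dom \<C> p \<and>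
     p \<cdot>\<^bsub>\<C>\<^esub> i = Zero \<C> (Dom \<C> i) (Cod \<C> p) \<and>
     (\<forall>f \<in> Arr \<C>. Dom \<C> f = Cod \<C> i \<and> f \<cdot>\<^bsub>\<C>\<^esub> i = Zero \<C> (Dom \<C> i) (Cod \<C> f) \<longrightarrow>
        (\<exists>!g. g \<in> Hom \<C> (Cod \<C> p) (Cod \<C> f) \<and> g \<cdot>\<^bsub>\<C>\<^esub> p = f))"

definition split_mono :: "('o, 'm, 'z) padd_cat_scheme \<Rightarrow> 'm \<Rightarrow> bool" where
  "split_mono \<C> s \<longleftrightarrow> s \<in> Arr \<C> \<and> (\<exists>r \<in> Hom \<C> (Cod \<C> s) (Dom \<C> s). r \<cdot>\<^bsub>\<C>\<^esub> s = Ide \<C> (Dom \<C> s))"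

definition weakly_idempotent_complete :: "('o, 'm, 'z) padd_cat_scheme \<Rightarrow> bool" where
  "weakly_idempotent_complete \<C> \<longleftrightarrow> (\<forall>s. split_mono \<C> s \<longrightarrow> (\<exists>p. is_cokernel \<C> s p))"

text \<open>A (not necessarily commutative) ring is local if it is nonzero and its non-units are closed
  under addition.\<close>

definition local_ring :: "('a, 'b) ring_scheme \<Rightarrow> bool" where
  "local_ring R \<longleftrightarrow> ring R \<and> \<one>\<^bsub>R\<^esub> \<noteq> \<zero>\<^bsub>R\<^esub> \<and>
     (\<forall>x \<in> carrier R - Units R. \<forall>y \<in> carrier R - Units R. x \<oplus>\<^bsub>R\<^esub> y \<notin> Units R)"

definition krull_schmidt :: "('o, 'm, 'z) padd_cat_scheme \<Rightarrow> bool" where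
  "krull_schmidt \<C> \<longleftrightarrow>
     (\<forall>A \<in> Obj \<C>. \<exists>Bs. direct_sum \<C> A Bs \<and> (\<forall>B \<in> set Bs. local_ring (End_ring \<C> B)))"


section \<open>Exact categories\<close>

definition adm_monic :: "('o, 'm) exact_cat \<Rightarrow> 'm \<Rightarrow> bool" where
  "adm_monic \<C> i \<longleftrightarrow> (\<exists>p. (i, p) \<in> Conf \<C>)"

definition adm_epic :: "('o, 'm) exact_cat \<Rightarrow> 'm \<Rightarrow> bool" where
  "adm_epic \<C> p \<longleftrightarrow> (\<exists>i. (i, p) \<in> Conf \<C>)"

text \<open>\<open>is_pushout \<C> i f i' f'\<close>: the span \<open>i\<close>, \<open>f\<close> is completed to a pushout square
  \<open>f' \<cdot> i = i' \<cdot> f\<close>, so that \<open>i'\<close> is the pushout of \<open>i\<close> along \<open>f\<close>; dually for pullbacks.\<close>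

definition is_pushout :: "('o, 'm, 'z) padd_cat_scheme \<Rightarrow> 'm \<Rightarrow> 'm \<Rightarrow> 'm \<Rightarrow> 'm \<Rightarrow> bool" where
  "is_pushout \<C> i f i' f' \<longleftrightarrow>
     i \<in> Arr \<C> \<and> f \<in> Arr \<C> \<and> Dom \<C> i = Dom \<C> f \<and>
     i' \<in> Arr \<C> \<and> f' \<in> Arr \<C> \<and> Dom \<C> i' = Cod \<C> f \<and> Dom \<C> f' = Cod \<C> i \<and> Cod \<C> i' = Cod \<C> f' \<and>
     f' \<cdot>\<^bsub>\<C>\<^esub> i = i' \<cdot>\<^bsub>\<C>\<^esub> f \<and>
     (\<forall>u \<in> Arr \<C>. \<forall>v \<in> Arr \<C>.
        Dom \<C> u = Cod \<C> i \<and> Dom \<C> v = Cod \<C> f \<and> Cod \<C> u = Cod \<C> v \<and> u \<cdot>\<^bsub>\<C>\<^esub> i = v \<cdot>\<^bsub>\<C>\<^esub> f \<longrightarrow>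
        (\<exists>!w. w \<in> Hom \<C> (Cod \<C> i') (Cod \<C> u) \<and> w \<cdot>\<^bsub>\<C>\<^esub> f' = u \<and> w \<cdot>\<^bsub>\<C>\<^esub> i' = v))"

definition is_pullback :: "('o, 'm, 'z) padd_cat_scheme \<Rightarrow> 'm \<Rightarrow> 'm \<Rightarrow> 'm \<Rightarrow> 'm \<Rightarrow> bool" where
  "is_pullback \<C> p f p' f' \<longleftrightarrow>
     p \<in> Arr \<C> \<and> f \<in> Arr \<C> \<and> Cod \<C> p = Cod \<C> f \<and>
     p' \<in> Arr \<C> \<and> f' \<in> Arr \<C> \<and> Cod \<C> p' = Dom \<C> f \<and> Cod \<C> f' = Dom \<C> p \<and> Dom \<C> p' = Dom \<C> f' \<and>
     p \<cdot>\<^bsub>\<C>\<^esub> f' = f \<cdot>\<^bsub>\<C>\<^esub> p' \<and>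
     (\<forall>u \<in> Arr \<C>. \<forall>v \<in> Arr \<C>.
        Cod \<C> u = Dom \<C> p \<and> Cod \<C> v = Dom \<C> f \<and> Dom \<C> u = Dom \<C> v \<and> p \<cdot>\<^bsub>\<C>\<^esub> u = f \<cdot>\<^bsub>\<C>\<^esub> v \<longrightarrow>
        (\<exists>!w. w \<in> Hom \<C> (Dom \<C> u) (Dom \<C> p') \<and> f' \<cdot>\<^bsub>\<C>\<^esub> w = u \<and> p' \<cdot>\<^bsub>\<C>\<^esub> w = v))"

locale exact_category = additive_category \<C> for \<C> :: "('o, 'm) exact_cat" (structure) +
  assumes conf_ker_coker: "(i, p) \<in> Conf \<C> \<Longrightarrow> is_kernel \<C> i p \<and> is_cokernel \<C> i p"
    and conf_iso:
      "\<lbrakk> (i, p) \<in> Conf \<C>; iso_arrow \<C> a; iso_arrow \<C> b; iso_arrow \<C> c;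
         Dom \<C> a = Dom \<C> i; Dom \<C> b = Dom \<C> p; Dom \<C> c = Cod \<C> p;
         i' \<in> Hom \<C> (Cod \<C> a) (Cod \<C> b); p' \<in> Hom \<C> (Cod \<C> b) (Cod \<C> c);
         i' \<cdot> a = b \<cdot> i; p' \<cdot> b = c \<cdot> p \<rbrakk> \<Longrightarrow> (i', p') \<in> Conf \<C>"
    and ide_monic: "A \<in> Obj \<C> \<Longrightarrow> adm_monic \<C> (Ide \<C> A)"
    and ide_epic: "A \<in> Obj \<C> \<Longrightarrow> adm_epic \<C> (Ide \<C> A)"
    and comp_monic: "adm_monic \<C> i \<Longrightarrow> adm_monic \<C> j \<Longrightarrow> Cod \<C> i = Dom \<C> j \<Longrightarrow> adm_monic \<C> (j \<cdot> i)"
    and comp_epic: "adm_epic \<C> p \<Longrightarrow> adm_epic \<C> q \<Longrightarrow> Cod \<C> p = Dom \<C> q \<Longrightarrow> adm_epic \<C> (q \<cdot> p)"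
    and pushout_monic: "adm_monic \<C> i \<Longrightarrow> f \<in> Arr \<C> \<Longrightarrow> Dom \<C> f = Dom \<C> i \<Longrightarrow>
                          \<exists>i' f'. is_pushout \<C> i f i' f' \<and> adm_monic \<C> i'"
    and pullback_epic: "adm_epic \<C> p \<Longrightarrow> f \<in> Arr \<C> \<Longrightarrow> Cod \<C> f = Cod \<C> p \<Longrightarrow>
                          \<exists>p' f'. is_pullback \<C> p f p' f' \<and> adm_epic \<C> p'"

text \<open>In \<open>short_exact_sequence A B C f g\<close> the arrows run from \<open>C\<close> via \<open>B\<close> to \<open>A\<close>.\<close>

definition Proj :: "('o, 'm) exact_cat \<Rightarrow> 'o set" where
  "Proj \<C> = {P \<in> Obj \<C>. \<forall>(i, p) \<in> Conf \<C>.
     short_exact_sequence (Hom_group \<C> P (Cod \<C> p)) (Hom_group \<C> P (Cod \<C> i)) (Hom_group \<C> P (Dom \<C> i))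
       (\<lambda>f. p \<cdot>\<^bsub>\<C>\<^esub> f) (\<lambda>f. i \<cdot>\<^bsub>\<C>\<^esub> f)}"

definition enough_projectives :: "('o, 'm) exact_cat \<Rightarrow> bool" where
  "enough_projectives \<C> \<longleftrightarrow> (\<forall>A \<in> Obj \<C>. \<exists>p. adm_epic \<C> p \<and> Dom \<C> p \<in> Proj \<C> \<and> Cod \<C> p = A)"

definition exact_IT_context :: "('o, 'm) exact_cat \<Rightarrow> bool" where
  "exact_IT_context \<C> \<longleftrightarrow> exact_category \<C> \<and> enough_projectives \<C> \<and> krull_schmidt \<C>"


section \<open>Extension groups and homological dimensions\<close>

text \<open>
  A projective resolution of \<open>A\<close> is given by the sequence of short exact sequences from which it
  is spliced: \<open>R n\<close> is \<open>K\<^sub>n\<^sub>+\<^sub>1 \<rightarrow> P\<^sub>n \<rightarrow> K\<^sub>n\<close> with \<open>K\<^sub>0 = A\<close>.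
\<close>

definition proj_resolution :: "('o, 'm) exact_cat \<Rightarrow> 'o \<Rightarrow> (nat \<Rightarrow> 'm \<times> 'm) \<Rightarrow> bool" where
  "proj_resolution \<C> A R \<longleftrightarrow> Cod \<C> (snd (R 0)) = A \<and>
     (\<forall>n. R n \<in> Conf \<C> \<and> Dom \<C> (snd (R n)) \<in> Proj \<C> \<and> Cod \<C> (snd (R (Suc n))) = Dom \<C> (fst (R n)))"

definition res_obj :: "('o, 'm) exact_cat \<Rightarrow> (nat \<Rightarrow> 'm \<times> 'm) \<Rightarrow> nat \<Rightarrow> 'o" where
  "res_obj \<C> R n = Dom \<C> (snd (R n))"

text \<open>The differential from the term of degree \<open>Suc n\<close> to the term of degree \<open>n\<close>.\<close>

definition res_diff :: "('o, 'm) exact_cat \<Rightarrow> (nat \<Rightarrow> 'm \<times> 'm) \<Rightarrow> nat \<Rightarrow> 'm" where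
  "res_diff \<C> R n = fst (R n) \<cdot>\<^bsub>\<C>\<^esub> snd (R (Suc n))"

definition cocycles :: "('o, 'm) exact_cat \<Rightarrow> (nat \<Rightarrow> 'm \<times> 'm) \<Rightarrow> nat \<Rightarrow> 'o \<Rightarrow> 'm set" where
  "cocycles \<C> R n B = {f \<in> Hom \<C> (res_obj \<C> R n) B.
     f \<cdot>\<^bsub>\<C>\<^esub> res_diff \<C> R n = Zero \<C> (res_obj \<C> R (Suc n)) B}"

fun coboundaries :: "('o, 'm) exact_cat \<Rightarrow> (nat \<Rightarrow> 'm \<times> 'm) \<Rightarrow> nat \<Rightarrow> 'o \<Rightarrow> 'm set" where
  "coboundaries \<C> R 0 B = {Zero \<C> (res_obj \<C> R 0) B}"
| "coboundaries \<C> R (Suc n) B = (\<lambda>f. f \<cdot>\<^bsub>\<C>\<^esub> res_diff \<C> R n) ` Hom \<C> (res_obj \<C> R n) B"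

definition Ext_group :: "('o, 'm) exact_cat \<Rightarrow> nat \<Rightarrow> 'o \<Rightarrow> 'o \<Rightarrow> 'm set monoid" where
  "Ext_group \<C> n A B = (let R = (SOME R. proj_resolution \<C> A R) in
     (Hom_group \<C> (res_obj \<C> R n) B)\<lparr>carrier := cocycles \<C> R n B\<rparr> Mod coboundaries \<C> R n B)"

text \<open>The infimum of the empty set in \<open>enat\<close> is \<open>\<infinity>\<close>, and the supremum of the empty set is \<open>0\<close>.\<close>

definition proj_dim :: "('o, 'm) exact_cat \<Rightarrow> 'o \<Rightarrow> enat" where
  "proj_dim \<C> A = Inf {enat n | n. \<forall>j > n. \<forall>Z \<in> Obj \<C>. trivial_group (Ext_group \<C> j A Z)}"

definition inj_dim :: "('o, 'm) exact_cat \<Rightarrow> 'o \<Rightarrow> enat" where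
  "inj_dim \<C> A = Inf {enat n | n. \<forall>j > n. \<forall>Z \<in> Obj \<C>. trivial_group (Ext_group \<C> j Z A)}"

definition inj_dim_class :: "('o, 'm) exact_cat \<Rightarrow> 'o set \<Rightarrow> enat" where
  "inj_dim_class \<C> \<Y> = (SUP Y \<in> \<Y>. inj_dim \<C> Y)"

definition fin_proj_dim :: "('o, 'm) exact_cat \<Rightarrow> 'o set \<Rightarrow> enat" where
  "fin_proj_dim \<C> \<Y> = (SUP Y \<in> {Y \<in> \<Y>. proj_dim \<C> Y < \<infinity>}. proj_dim \<C> Y)"


section \<open>The stable category and syzygies\<close>

definition null_maps :: "('o, 'm) exact_cat \<Rightarrow> 'o \<Rightarrow> 'o \<Rightarrow> 'm set" where
  "null_maps \<C> A B = {v \<cdot>\<^bsub>\<C>\<^esub> u | u v P. P \<in> Proj \<C> \<and> u \<in> Hom \<C> A P \<and> v \<in> Hom \<C> P B}"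

text \<open>Stable morphisms are cosets; \<open>stable_rep\<close> chooses an arrow in a coset.\<close>

definition stable_class :: "('o, 'm) exact_cat \<Rightarrow> 'm \<Rightarrow> 'm set" where
  "stable_class \<C> f =
     null_maps \<C> (Dom \<C> f) (Cod \<C> f) #>\<^bsub>Hom_group \<C> (Dom \<C> f) (Cod \<C> f)\<^esub> f"

definition stable_rep :: "'m set \<Rightarrow> 'm" where
  "stable_rep F = (SOME f. f \<in> F)"

definition stable_cat :: "('o, 'm) exact_cat \<Rightarrow> ('o, 'm set) padd_cat" where
  "stable_cat \<C> =
     \<lparr>Obj = Obj \<C>,
      Arr = stable_class \<C> ` Arr \<C>,
      Dom = (\<lambda>F. Dom \<C> (stable_rep F)),
      Cod = (\<lambda>F. Cod \<C> (stable_rep F)),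
      Ide = (\<lambda>A. stable_class \<C> (Ide \<C> A)),
      Comp = (\<lambda>G F. stable_class \<C> (stable_rep G \<cdot>\<^bsub>\<C>\<^esub> stable_rep F)),
      Add = (\<lambda>F G. stable_class \<C> (Add \<C> (stable_rep F) (stable_rep G))),
      Zero = (\<lambda>A B. stable_class \<C> (Zero \<C> A B))\<rparr>"

definition syzygy :: "('o, 'm) exact_cat \<Rightarrow> 'o \<Rightarrow> 'o \<Rightarrow> bool" where
  "syzygy \<C> M K \<longleftrightarrow> (\<exists>(i, p) \<in> Conf \<C>. Dom \<C> i = K \<and> Dom \<C> p \<in> Proj \<C> \<and> Cod \<C> p = M)"

fun nth_syzygy :: "('o, 'm) exact_cat \<Rightarrow> nat \<Rightarrow> 'o \<Rightarrow> 'o \<Rightarrow> bool" where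
  "nth_syzygy \<C> 0 M K \<longleftrightarrow> M \<in> Obj \<C> \<and> K = M"
| "nth_syzygy \<C> (Suc n) M K \<longleftrightarrow> (\<exists>L. nth_syzygy \<C> n M L \<and> syzygy \<C> L K)"

definition Omega_class :: "('o, 'm) exact_cat \<Rightarrow> nat \<Rightarrow> 'o set" where
  "Omega_class \<C> n = {K. \<exists>M. nth_syzygy \<C> n M K}"

definition Omega_obj :: "('o, 'm) exact_cat \<Rightarrow> nat \<Rightarrow> 'o \<Rightarrow> 'o" where
  "Omega_obj \<C> n M = (SOME K. nth_syzygy \<C> n M K)"


section \<open>The Igusa-Todorov functions\<close>

definition isoclass :: "('o, 'm) exact_cat \<Rightarrow> 'o \<Rightarrow> 'o set" where
  "isoclass \<C> M = iso_rel \<C> `` {M}"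

definition iso_free_group :: "('o, 'm) exact_cat \<Rightarrow> ('o set \<Rightarrow>\<^sub>0 int) monoid" where
  "iso_free_group \<C> = free_Abelian_group (Obj \<C> // iso_rel \<C>)"

definition K_relations :: "('o, 'm) exact_cat \<Rightarrow> ('o set \<Rightarrow>\<^sub>0 int) set" where
  "K_relations \<C> = generate (iso_free_group \<C>)
     ({frag_of (isoclass \<C> N) - frag_of (isoclass \<C> S) - frag_of (isoclass \<C> T) | N S T.
         direct_sum \<C> N [S, T]} \<union>
      {frag_of (isoclass \<C> P) | P. P \<in> Proj \<C>})"

definition K_group :: "('o, 'm) exact_cat \<Rightarrow> ('o set \<Rightarrow>\<^sub>0 int) set monoid" where
  "K_group \<C> = iso_free_group \<C> Mod K_relations \<C>"

definition K_class :: "('o, 'm) exact_cat \<Rightarrow> 'o \<Rightarrow> ('o set \<Rightarrow>\<^sub>0 int) set" where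
  "K_class \<C> M = K_relations \<C> #>\<^bsub>iso_free_group \<C>\<^esub> frag_of (isoclass \<C> M)"

text \<open>The endomorphism of the group induced by taking syzygies; extensionality makes it unique.\<close>

definition K_Omega :: "('o, 'm) exact_cat \<Rightarrow> ('o set \<Rightarrow>\<^sub>0 int) set \<Rightarrow> ('o set \<Rightarrow>\<^sub>0 int) set" where
  "K_Omega \<C> = (THE h. h \<in> hom (K_group \<C>) (K_group \<C>) \<and> h \<in> extensional (carrier (K_group \<C>)) \<and>
     (\<forall>M K. syzygy \<C> M K \<longrightarrow> h (K_class \<C> M) = K_class \<C> K))"

definition K_span :: "('o, 'm) exact_cat \<Rightarrow> 'o \<Rightarrow> ('o set \<Rightarrow>\<^sub>0 int) set set" where
  "K_span \<C> M = generate (K_group \<C>)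
     {K_class \<C> N | N. indecomposable (stable_cat \<C>) N \<and> direct_summand (stable_cat \<C>) N M}"

definition K_Omega_span :: "('o, 'm) exact_cat \<Rightarrow> nat \<Rightarrow> 'o \<Rightarrow> ('o set \<Rightarrow>\<^sub>0 int) set monoid" where
  "K_Omega_span \<C> m M = (K_group \<C>)\<lparr>carrier := (K_Omega \<C> ^^ m) ` K_span \<C> M\<rparr>"

definition IT_Phi :: "('o, 'm) exact_cat \<Rightarrow> 'o \<Rightarrow> nat" where
  "IT_Phi \<C> M = (LEAST k. \<forall>m \<ge> k. K_Omega \<C> \<in> iso (K_Omega_span \<C> m M) (K_Omega_span \<C> (Suc m) M))"

definition IT_Psi :: "('o, 'm) exact_cat \<Rightarrow> 'o \<Rightarrow> enat" where
  "IT_Psi \<C> M = enat (IT_Phi \<C> M) + fin_proj_dim \<C> (add_class \<C> (Omega_obj \<C> (IT_Phi \<C> M) M))"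

definition Phi_dim :: "('o, 'm) exact_cat \<Rightarrow> 'o set \<Rightarrow> enat" where
  "Phi_dim \<C> \<Y> = (SUP Y \<in> \<Y>. enat (IT_Phi \<C> Y))"

definition Psi_dim :: "('o, 'm) exact_cat \<Rightarrow> 'o set \<Rightarrow> enat" where
  "Psi_dim \<C> \<Y> = (SUP Y \<in> \<Y>. IT_Psi \<C> Y)"

end

theory Submission
  imports "HOL-Library.Multiset" Defs
begin

text \<open>
  Write \<open>\<Omega>\<close> for the syzygy on the stable category and \<open>\<P>\<close> for the class of projectives.
  Everything rests on a dictionary between the three levels on which the theorem speaks.

  Between objects and the K-group: two objects have the same class in the K-group if and only if
  they are isomorphic in the stable category (\<open>K_class_eq_iff\<close>).  A relation in the K-group
  says that \<open>X \<oplus> Z\<close> and \<open>Y \<oplus> Z\<close> are stably isomorphic for some \<open>Z\<close>; a stable isomorphism is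
  an isomorphism up to projective summands (\<open>stable_iso_imp_iso_up_to_Proj\<close>, where weak
  idempotent completeness enters), and \<open>Z\<close>, a finite sum of objects with local endomorphism ring,
  can be cancelled (\<open>cancel_local\<close>).

  Between Ext and syzygies: \<open>Ext\<^sup>n\<^sup>+\<^sup>1(A, Z) = 0\<close> means that every arrow from \<open>\<Omega>\<^sup>n\<^sup>+\<^sup>1 A\<close> to \<open>Z\<close>
  extends to the projective term that contains \<open>\<Omega>\<^sup>n\<^sup>+\<^sup>1 A\<close>, a condition on \<open>\<Omega>\<^sup>n A\<close> that depends only on its stable
  isomorphism class (\<open>trivial_Ext_iff\<close>).  Hence \<open>pd A \<le> n\<close> says that \<open>\<Omega>\<^sup>n A\<close> is projective, and
  \<open>id \<P> \<le> n\<close> says that all \<open>n\<close>-th syzygies lie in the class \<open>perp\<close> of objects \<open>X\<close> with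
  \<open>Ext\<^sup>j(X, P) = 0\<close> for all \<open>j > 0\<close> and projective \<open>P\<close>.

  On \<open>perp\<close> two things happen.  There \<open>\<Omega>\<close> is fully faithful on the stable category, because
  arrows into projectives extend along the inclusion of a syzygy (\<open>lift_full\<close>, \<open>lift_faithful\<close>);
  so by the first dictionary it is injective on the span of classes from \<open>perp\<close>.  And an object of \<open>perp\<close>
  of finite projective dimension is projective: if \<open>\<Omega> X\<close> is projective then the
  conflation \<open>\<Omega> X \<rightarrow> P \<rightarrow> X\<close> splits (\<open>perp_Proj_if_nth_syzygy_Proj\<close>).

  If \<open>\<Omega>\<^sup>n M\<close> lies in \<open>perp\<close>, the first fact gives \<open>\<Phi>(M) \<le> n\<close>.  With \<open>k = \<Phi>(M)\<close>, an object \<open>N\<close>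
  of \<open>add (\<Omega>\<^sup>k M)\<close> has \<open>\<Omega>\<^sup>n\<^sup>-\<^sup>k N\<close> in \<open>perp\<close>, and if its projective dimension is finite the second fact
  bounds it by \<open>n - k\<close>; so \<open>\<Psi>(M) \<le> n\<close> (\<open>Psi_le\<close>).  Used with \<open>n = id \<P>\<close> for arbitrary \<open>M\<close> this is the last
  inequality of (b); used with \<open>0\<close> in place of \<open>n\<close> for \<open>M\<close> in \<open>\<Omega>\<^sup>n(\<C>)\<close> it is (a).

  For the first inequality of (b), let \<open>pd M = d\<close> be finite.  Then \<open>\<Omega>\<^sup>d\<close> kills the span of \<open>M\<close>, hence so does
  \<open>\<Omega>\<^sup>k\<close> with \<open>k = \<Phi>(M)\<close>, from which on \<open>\<Omega>\<close> is injective.  The class of \<open>M\<close> lies in its span, so the class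
  of \<open>\<Omega>\<^sup>k M\<close> vanishes; by the first dictionary \<open>\<Omega>\<^sup>k M\<close> is projective and \<open>pd M \<le> k\<close>
  (\<open>proj_dim_le_Phi\<close>).
\<close>

section \<open>Preadditive categories and binary direct sums\<close>

context preadditive_category begin

abbreviation plus (infixl \<open>\<boxplus>\<close> 65) where "f \<boxplus> g \<equiv> Add \<C> f g"
abbreviation Zr where "Zr A B \<equiv> Zero \<C> A B"
abbreviation Id where "Id A \<equiv> Ide \<C> A"
definition neg where "neg f = inv\<^bsub>Hom_group \<C> (Dom \<C> f) (Cod \<C> f)\<^esub> f"
abbreviation minus (infixl \<open>\<boxminus>\<close> 65) where "f \<boxminus> g \<equiv> f \<boxplus> neg g"

lemma HomD:
  assumes "f \<in> Hom \<C> A B"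
  shows "f \<in> Arr \<C>" "Dom \<C> f = A" "Cod \<C> f = B" "A \<in> Obj \<C>" "B \<in> Obj \<C>"
  using assms dom_obj cod_obj by (auto simp: Hom_def)

lemma HomI: "f \<in> Arr \<C> \<Longrightarrow> Dom \<C> f = A \<Longrightarrow> Cod \<C> f = B \<Longrightarrow> f \<in> Hom \<C> A B"
  by (simp add: Hom_def)

lemma arr_Hom: "f \<in> Arr \<C> \<Longrightarrow> f \<in> Hom \<C> (Dom \<C> f) (Cod \<C> f)"
  by (simp add: Hom_def)

lemma grp_sel [simp]: "carrier (Hom_group \<C> A B) = Hom \<C> A B" "monoid.mult (Hom_group \<C> A B) = Add \<C>"
   "one (Hom_group \<C> A B) = Zr A B"
  by (auto simp: Hom_group_def)

declare dom_obj [simp] cod_obj [simp]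

lemma ide_arr [simp]:
  assumes "A \<in> Obj \<C>"
  shows "Id A \<in> Arr \<C>" "Dom \<C> (Id A) = A" "Cod \<C> (Id A) = A"
  using HomD[OF ide_hom[OF assms]] by auto

lemma comp_arr [simp]:
  assumes "f \<in> Arr \<C>" "g \<in> Arr \<C>" "Cod \<C> f = Dom \<C> g"
  shows "g \<cdot> f \<in> Arr \<C>" "Dom \<C> (g \<cdot> f) = Dom \<C> f" "Cod \<C> (g \<cdot> f) = Cod \<C> g"
  using comp_hom[of f "Dom \<C> f" "Cod \<C> f" g "Cod \<C> g"] assms by (auto simp: Hom_def)

lemma add_arr [simp]:
  assumes "f \<in> Arr \<C>" "g \<in> Arr \<C>" "Dom \<C> f = Dom \<C> g" "Cod \<C> f = Cod \<C> g"
  shows "f \<boxplus> g \<in> Arr \<C>" "Dom \<C> (f \<boxplus> g) = Dom \<C> g" "Cod \<C> (f \<boxplus> g) = Cod \<C> g"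
proof -
  interpret G: comm_group "Hom_group \<C> (Dom \<C> f) (Cod \<C> f)"
    by (rule hom_comm_group) (use assms in auto)
  have "f \<boxplus> g \<in> Hom \<C> (Dom \<C> f) (Cod \<C> f)"
    using G.m_closed[of f g] assms by (simp add: Hom_def)
  then show "f \<boxplus> g \<in> Arr \<C>" "Dom \<C> (f \<boxplus> g) = Dom \<C> g" "Cod \<C> (f \<boxplus> g) = Cod \<C> g"
    using assms by (auto simp: Hom_def)
qed

lemma zero_arr [simp]:
  assumes "A \<in> Obj \<C>" "B \<in> Obj \<C>"
  shows "Zr A B \<in> Arr \<C>" "Dom \<C> (Zr A B) = A" "Cod \<C> (Zr A B) = B"
proof -
  interpret G: comm_group "Hom_group \<C> A B" by (rule hom_comm_group) (use assms in auto)
  show "Zr A B \<in> Arr \<C>" "Dom \<C> (Zr A B) = A" "Cod \<C> (Zr A B) = B"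
    using G.one_closed by (auto simp: Hom_def)
qed

lemma neg_arr [simp]:
  assumes "f \<in> Arr \<C>"
  shows "neg f \<in> Arr \<C>" "Dom \<C> (neg f) = Dom \<C> f" "Cod \<C> (neg f) = Cod \<C> f"
proof -
  interpret G: comm_group "Hom_group \<C> (Dom \<C> f) (Cod \<C> f)"
    by (rule hom_comm_group) (use assms in auto)
  show "neg f \<in> Arr \<C>" "Dom \<C> (neg f) = Dom \<C> f" "Cod \<C> (neg f) = Cod \<C> f"
    using G.inv_closed[of f] assms by (auto simp: Hom_def neg_def)
qed

lemma assoc [simp]:
  assumes "f \<in> Arr \<C>" "g \<in> Arr \<C>" "h \<in> Arr \<C>" "Cod \<C> f = Dom \<C> g" "Cod \<C> g = Dom \<C> h"
  shows "(h \<cdot> g) \<cdot> f = h \<cdot> (g \<cdot> f)"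
  using comp_assoc[of f "Dom \<C> f" "Cod \<C> f" g "Cod \<C> g" h "Cod \<C> h"] assms by (simp add: Hom_def)

lemma ide_simps [simp]:
  assumes "f \<in> Arr \<C>"
  shows "Dom \<C> f = A \<Longrightarrow> f \<cdot> Id A = f" "Cod \<C> f = B \<Longrightarrow> Id B \<cdot> f = f"
  using comp_ide_right comp_ide_left arr_Hom[OF assms] by auto

lemma add_ac:
  assumes "f \<in> Arr \<C>" "g \<in> Arr \<C>" "Dom \<C> f = Dom \<C> g" "Cod \<C> f = Cod \<C> g"
  shows "f \<boxplus> g = g \<boxplus> f"
    "h \<in> Arr \<C> \<Longrightarrow> Dom \<C> g = Dom \<C> h \<Longrightarrow> Cod \<C> g = Cod \<C> h \<Longrightarrow> (f \<boxplus> g) \<boxplus> h = f \<boxplus> (g \<boxplus> h)"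
    "h \<in> Arr \<C> \<Longrightarrow> Dom \<C> g = Dom \<C> h \<Longrightarrow> Cod \<C> g = Cod \<C> h \<Longrightarrow> f \<boxplus> (g \<boxplus> h) = g \<boxplus> (f \<boxplus> h)"
proof -
  interpret G: comm_group "Hom_group \<C> (Dom \<C> f) (Cod \<C> f)"
    by (rule hom_comm_group) (use assms in auto)
  show "f \<boxplus> g = g \<boxplus> f"
    using G.m_comm[of f g] assms by (simp add: Hom_def)
  assume h: "h \<in> Arr \<C>" "Dom \<C> g = Dom \<C> h" "Cod \<C> g = Cod \<C> h"
  show "(f \<boxplus> g) \<boxplus> h = f \<boxplus> (g \<boxplus> h)"
    using G.m_assoc[of f g h] assms h by (simp add: Hom_def)
  show "f \<boxplus> (g \<boxplus> h) = g \<boxplus> (f \<boxplus> h)"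
    using G.m_lcomm[of f g h] assms h by (simp add: Hom_def)
qed

lemma add_neg [simp]:
  assumes "f \<in> Arr \<C>"
  shows "f \<boxplus> neg f = Zr (Dom \<C> f) (Cod \<C> f)" "neg f \<boxplus> f = Zr (Dom \<C> f) (Cod \<C> f)"
    "Dom \<C> f = A \<Longrightarrow> Cod \<C> f = B \<Longrightarrow> f \<boxplus> Zr A B = f" "Dom \<C> f = A \<Longrightarrow> Cod \<C> f = B \<Longrightarrow> Zr A B \<boxplus> f = f"
    "neg (neg f) = f"
proof -
  interpret G: comm_group "Hom_group \<C> (Dom \<C> f) (Cod \<C> f)"
    by (rule hom_comm_group) (use assms in auto)
  have c: "f \<in> carrier (Hom_group \<C> (Dom \<C> f) (Cod \<C> f))" using assms by (simp add: Hom_def)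
  show "f \<boxplus> neg f = Zr (Dom \<C> f) (Cod \<C> f)" "neg f \<boxplus> f = Zr (Dom \<C> f) (Cod \<C> f)"
    using G.r_inv[OF c] G.l_inv[OF c] by (simp_all add: neg_def)
  show "Dom \<C> f = A \<Longrightarrow> Cod \<C> f = B \<Longrightarrow> f \<boxplus> Zr A B = f" "Dom \<C> f = A \<Longrightarrow> Cod \<C> f = B \<Longrightarrow> Zr A B \<boxplus> f = f"
    using G.r_one[OF c] G.l_one[OF c] by simp_all
  show "neg (neg f) = f"
    using G.inv_inv[OF c] unfolding neg_def[of "neg f"] neg_arr(2,3)[OF assms] unfolding neg_def by simp
qed

lemma add_neg2 [simp]:
  assumes "f \<in> Arr \<C>" "g \<in> Arr \<C>" "Dom \<C> f = Dom \<C> g" "Cod \<C> f = Cod \<C> g"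
  shows "f \<boxplus> (neg f \<boxplus> g) = g" "neg f \<boxplus> (f \<boxplus> g) = g"
    "(g \<boxplus> f) \<boxplus> neg f = g" "(g \<boxplus> neg f) \<boxplus> f = g"
    "neg (f \<boxplus> g) = neg f \<boxplus> neg g"
proof -
  show 1: "f \<boxplus> (neg f \<boxplus> g) = g" using assms by (simp add: add_ac(2)[symmetric])
  show "neg f \<boxplus> (f \<boxplus> g) = g" using assms by (simp add: add_ac(2)[symmetric])
  show "(g \<boxplus> f) \<boxplus> neg f = g" "(g \<boxplus> neg f) \<boxplus> f = g" using assms by (simp_all add: add_ac(2))
  interpret G: comm_group "Hom_group \<C> (Dom \<C> g) (Cod \<C> g)"
    by (rule hom_comm_group) (use assms in auto)
  show "neg (f \<boxplus> g) = neg f \<boxplus> neg g"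
    using G.inv_mult[of f g] assms by (simp add: neg_def Hom_def)
qed

lemma add_left_cancel:
  assumes "f \<boxplus> g = f \<boxplus> h" "f \<in> Hom \<C> A B" "g \<in> Hom \<C> A B" "h \<in> Hom \<C> A B" shows "g = h"
  using arg_cong[OF assms(1), of "\<lambda>x. neg f \<boxplus> x"] assms(2-) by (simp add: Hom_def)

lemma minus_eq_iff:
  assumes "f \<in> Hom \<C> A B" "g \<in> Hom \<C> A B" "h \<in> Hom \<C> A B"
  shows "f \<boxminus> g = h \<longleftrightarrow> f = g \<boxplus> h"
proof
  have "f \<boxminus> g \<boxplus> g = f" using assms by (simp add: Hom_def)
  moreover assume "f \<boxminus> g = h"
  ultimately show "f = g \<boxplus> h" using assms add_ac(1)[of g h] by (simp add: Hom_def)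
next
  assume "f = g \<boxplus> h"
  moreover have "(h \<boxplus> g) \<boxminus> g = h" using assms by (simp add: Hom_def)
  ultimately show "f \<boxminus> g = h" using assms add_ac(1)[of g h] by (simp add: Hom_def)
qed

lemma neg_unique: "f \<boxplus> g = Zr A B \<Longrightarrow> f \<in> Hom \<C> A B \<Longrightarrow> g \<in> Hom \<C> A B \<Longrightarrow> g = neg f"
  using add_left_cancel[of f g "neg f" A B] by (auto simp: Hom_def)

lemma distrib [simp]:
  assumes "f \<in> Arr \<C>" "g \<in> Arr \<C>" "Dom \<C> f = Dom \<C> g" "Cod \<C> f = Cod \<C> g" "h \<in> Arr \<C>"
  shows "Dom \<C> h = Cod \<C> g \<Longrightarrow> h \<cdot> (f \<boxplus> g) = h \<cdot> f \<boxplus> h \<cdot> g"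
    "Cod \<C> h = Dom \<C> g \<Longrightarrow> (f \<boxplus> g) \<cdot> h = f \<cdot> h \<boxplus> g \<cdot> h"
  using comp_add_right[of f "Dom \<C> f" "Cod \<C> f" g h "Cod \<C> h"]
    comp_add_left[of h "Dom \<C> h" "Cod \<C> h" f "Cod \<C> f" g] assms by (auto simp: Hom_def)

lemma comp_zero [simp]:
  assumes "f \<in> Arr \<C>" "A \<in> Obj \<C>"
  shows "Cod \<C> f = B \<Longrightarrow> Zr B A \<cdot> f = Zr (Dom \<C> f) A" "Dom \<C> f = B \<Longrightarrow> f \<cdot> Zr A B = Zr A (Cod \<C> f)"
proof -
  assume B: "Cod \<C> f = B"
  have "Zr B A \<cdot> f \<boxplus> Zr B A \<cdot> f = Zr B A \<cdot> f \<boxplus> Zr (Dom \<C> f) A"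
    using assms B by (subst distrib(2)[symmetric]) auto
  then show "Zr B A \<cdot> f = Zr (Dom \<C> f) A"
    by (rule add_left_cancel[where A="Dom \<C> f" and B=A]) (use assms B in \<open>auto simp: Hom_def\<close>)
next
  assume B: "Dom \<C> f = B"
  have "f \<cdot> Zr A B \<boxplus> f \<cdot> Zr A B = f \<cdot> Zr A B \<boxplus> Zr A (Cod \<C> f)"
    using assms B by (subst distrib(1)[symmetric]) auto
  then show "f \<cdot> Zr A B = Zr A (Cod \<C> f)"
    by (rule add_left_cancel[where A=A and B="Cod \<C> f"]) (use assms B in \<open>auto simp: Hom_def\<close>)
qed

lemma comp_neg [simp]:
  assumes "f \<in> Arr \<C>" "g \<in> Arr \<C>" "Cod \<C> f = Dom \<C> g"
  shows "g \<cdot> neg f = neg (g \<cdot> f)" "neg g \<cdot> f = neg (g \<cdot> f)"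
proof -
  have "g \<cdot> f \<boxplus> g \<cdot> neg f = Zr (Dom \<C> f) (Cod \<C> g)"
    using assms by (subst distrib(1)[symmetric]) auto
  then show "g \<cdot> neg f = neg (g \<cdot> f)"
    by (rule neg_unique) (use assms in \<open>auto simp: Hom_def\<close>)
  have "g \<cdot> f \<boxplus> neg g \<cdot> f = Zr (Dom \<C> f) (Cod \<C> g)"
    using assms by (subst distrib(2)[symmetric]) auto
  then show "neg g \<cdot> f = neg (g \<cdot> f)"
    by (rule neg_unique) (use assms in \<open>auto simp: Hom_def\<close>)
qed

lemma neg_zero [simp]: "A \<in> Obj \<C> \<Longrightarrow> B \<in> Obj \<C> \<Longrightarrow> neg (Zr A B) = Zr A B"
  using neg_unique[of "Zr A B" "Zr A B" A B] by (auto simp: Hom_def)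

text \<open>Composites are normalised to the right, so an equation \<open>g \<cdot> f = h\<close> has to be applied inside
  \<open>g \<cdot> (f \<cdot> x)\<close>.\<close>

lemma reassoc:
  assumes "g \<cdot> f = h" "f \<in> Arr \<C>" "g \<in> Arr \<C>" "Cod \<C> f = Dom \<C> g"
  shows "x \<in> Arr \<C> \<Longrightarrow> Cod \<C> x = Dom \<C> f \<Longrightarrow> g \<cdot> (f \<cdot> x) = h \<cdot> x"
  using assms assoc[of x f g] by simp

text \<open>A direct sum of two objects with its injections and projections named; \<open>direct_sum\<close>
  hides them under an existential quantifier and a finite product.\<close>

definition biprod where
  "biprod S A B i j p q \<longleftrightarrow> i \<in> Hom \<C> A S \<and> j \<in> Hom \<C> B S \<and> p \<in> Hom \<C> S A \<and> q \<in> Hom \<C> S B \<and>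
     p \<cdot> i = Id A \<and> q \<cdot> j = Id B \<and> q \<cdot> i = Zr A B \<and> p \<cdot> j = Zr B A \<and> i \<cdot> p \<boxplus> j \<cdot> q = Id S"

lemma biprodD:
  assumes "biprod S A B i j p q"
  shows "i \<in> Arr \<C>" "j \<in> Arr \<C>" "p \<in> Arr \<C>" "q \<in> Arr \<C>" "Dom \<C> i = A" "Dom \<C> j = B" "Dom \<C> p = S" "Dom \<C> q = S"
    "Cod \<C> i = S" "Cod \<C> j = S" "Cod \<C> p = A" "Cod \<C> q = B" "S \<in> Obj \<C>" "A \<in> Obj \<C>" "B \<in> Obj \<C>"
    "p \<cdot> i = Id A" "q \<cdot> j = Id B" "q \<cdot> i = Zr A B" "p \<cdot> j = Zr B A" "i \<cdot> p \<boxplus> j \<cdot> q = Id S"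
  using assms dom_obj cod_obj by (auto simp: biprod_def Hom_def)

lemma biprod_reassoc:
  assumes "biprod S A B i j p q" "x \<in> Arr \<C>"
  shows "Cod \<C> x = A \<Longrightarrow> p \<cdot> (i \<cdot> x) = x" "Cod \<C> x = B \<Longrightarrow> q \<cdot> (j \<cdot> x) = x"
    "Cod \<C> x = A \<Longrightarrow> q \<cdot> (i \<cdot> x) = Zr (Dom \<C> x) B" "Cod \<C> x = B \<Longrightarrow> p \<cdot> (j \<cdot> x) = Zr (Dom \<C> x) A"
  using assms(2)
    by (simp_all add: biprodD(1-15)[OF assms(1)] reassoc[OF biprodD(16)[OF assms(1)]] reassoc[OF biprodD(17)[OF assms(1)]]
      reassoc[OF biprodD(18)[OF assms(1)]] reassoc[OF biprodD(19)[OF assms(1)]])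

lemmas biprod_simps = biprodD biprod_reassoc

lemma biprod_decomp:
  assumes "biprod S A B i j p q" "f \<in> Hom \<C> S X"
  shows "f \<cdot> (i \<cdot> p) \<boxplus> f \<cdot> (j \<cdot> q) = f"
proof -
  note b = biprodD[OF assms(1)]
  have "f = f \<cdot> (i \<cdot> p \<boxplus> j \<cdot> q)" using b(20) assms(2) by (simp add: Hom_def)
  then show ?thesis using b(1-15) assms(2) by (simp add: Hom_def)
qed

lemma biprod_decomp':
  assumes "biprod S A B i j p q" "f \<in> Hom \<C> X S"
  shows "i \<cdot> (p \<cdot> f) \<boxplus> j \<cdot> (q \<cdot> f) = f"
proof -
  note b = biprodD[OF assms(1)]
  have "f = (i \<cdot> p \<boxplus> j \<cdot> q) \<cdot> f" using b(20) assms(2) by (simp add: Hom_def)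
  then show ?thesis using b(1-15) assms(2) by (simp add: Hom_def)
qed

lemma direct_sum2_iff: "direct_sum \<C> S [A, B] \<longleftrightarrow> (\<exists>i j p q. biprod S A B i j p q)"
proof
  assume L: "direct_sum \<C> S [A, B]"
  then obtain inj prj where S: "S \<in> Obj \<C>" "set [A, B] \<subseteq> Obj \<C>"
    and t: "\<forall>k < length [A, B]. inj k \<in> Hom \<C> ([A,B] ! k) S \<and> prj k \<in> Hom \<C> S ([A,B] ! k)"
    and o: "\<forall>k < length [A, B]. \<forall>l < length [A, B]. prj l \<cdot> inj k = (if k = l then Id ([A,B] ! k) else Zr ([A,B] ! k) ([A,B] ! l))"
    and e: "finprod (Hom_group \<C> S S) (\<lambda>k. inj k \<cdot> prj k) {..<length [A, B]} = Id S"
    unfolding direct_sum_def by blast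
  interpret G: comm_group "Hom_group \<C> S S" by (rule hom_comm_group) (use S in auto)
  have tt: "inj 0 \<in> Hom \<C> A S" "prj 0 \<in> Hom \<C> S A" "inj 1 \<in> Hom \<C> B S" "prj 1 \<in> Hom \<C> S B"
    using t[rule_format, of 0] t[rule_format, of 1] by auto
  have "{..<length [A, B]} = {0, 1::nat}" by auto
  then have "inj 0 \<cdot> prj 0 \<boxplus> inj 1 \<cdot> prj 1 = Id S"
    using e tt G.finprod_insert[of "{1}" 0 "\<lambda>k. inj k \<cdot> prj k"]
     G.finprod_insert[of "{}" 1 "\<lambda>k. inj k \<cdot> prj k"] by (simp add: Hom_def)
  then have "biprod S A B (inj 0) (inj 1) (prj 0) (prj 1)"
    using tt o[rule_format, of 0 0] o[rule_format, of 0 1] o[rule_format, of 1 0] o[rule_format, of 1 1] by (simp add: biprod_def)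
  then show "\<exists>i j p q. biprod S A B i j p q" by blast
next
  assume "\<exists>i j p q. biprod S A B i j p q"
  then obtain i j p q where b: "biprod S A B i j p q" by blast
  note bb = biprodD[OF b]
  define inj where "inj = (\<lambda>k::nat. if k = 0 then i else j)"
  define prj where "prj = (\<lambda>k::nat. if k = 0 then p else q)"
  interpret G: comm_group "Hom_group \<C> S S" by (rule hom_comm_group) (use bb in auto)
  have ll: "{..<length [A,B]} = {0, 1::nat}" by auto
  have c: "(\<lambda>k. inj k \<cdot> prj k) \<in> X \<rightarrow> Hom \<C> S S" for X
    using bb by (auto simp: inj_def prj_def Hom_def)
  have e: "finprod (Hom_group \<C> S S) (\<lambda>k. inj k \<cdot> prj k) {..<length [A,B]} = Id S"
    unfolding ll using c[of "{}"] c[of "{1}"] bb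
    by (simp add: Hom_def inj_def prj_def)
  show "direct_sum \<C> S [A, B]"
    unfolding direct_sum_def
    by (intro conjI exI[of _ inj] exI[of _ prj] e) (use bb in \<open>auto simp: inj_def prj_def Hom_def less_Suc_eq\<close>)
qed

lemma zero_object_iff: "zero_object \<C> Z \<longleftrightarrow> Z \<in> Obj \<C> \<and> Id Z = Zr Z Z"
proof (cases "Z \<in> Obj \<C>")
  case True
  interpret G: comm_group "Hom_group \<C> Z Z" by (rule hom_comm_group) (use True in auto)
  show ?thesis using True by (auto simp: zero_object_def direct_sum_def)
qed (auto simp: zero_object_def direct_sum_def)

definition isomorphic where "isomorphic A B \<longleftrightarrow> (\<exists>f g. f \<in> Hom \<C> A B \<and> g \<in> Hom \<C> B A \<and> g \<cdot> f = Id A \<and> f \<cdot> g = Id B)"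

lemma isoI: "f \<in> Hom \<C> A B \<Longrightarrow> g \<in> Hom \<C> B A \<Longrightarrow> g \<cdot> f = Id A \<Longrightarrow> f \<cdot> g = Id B \<Longrightarrow> isomorphic A B"
  unfolding isomorphic_def by blast

lemma iso_rel_iff: "(A, B) \<in> iso_rel \<C> \<longleftrightarrow> isomorphic A B"
  unfolding iso_rel_def iso_arrow_def isomorphic_def by (auto simp: Hom_def)

lemma iso_obj: "isomorphic A B \<Longrightarrow> A \<in> Obj \<C>" "isomorphic A B \<Longrightarrow> B \<in> Obj \<C>"
  unfolding isomorphic_def using HomD by auto

lemma iso_refl: "A \<in> Obj \<C> \<Longrightarrow> isomorphic A A"
  unfolding isomorphic_def by (intro exI[of _ "Id A"]) (auto simp: Hom_def)

lemma iso_sym: "isomorphic A B \<Longrightarrow> isomorphic B A" unfolding isomorphic_def by blast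

lemma iso_trans:
  assumes "isomorphic A B" "isomorphic B D" shows "isomorphic A D"
proof -
  obtain f g f' g' where fg: "f \<in> Hom \<C> A B" "g \<in> Hom \<C> B A" "g \<cdot> f = Id A" "f \<cdot> g = Id B"
    "f' \<in> Hom \<C> B D" "g' \<in> Hom \<C> D B" "g' \<cdot> f' = Id B" "f' \<cdot> g' = Id D"
    using assms unfolding isomorphic_def by blast
  then show ?thesis
    by (intro isoI[of "f' \<cdot> f" _ _ "g \<cdot> g'"]) (auto simp: Hom_def reassoc[OF fg(7)] reassoc[OF fg(4)])
qed

lemma biprod_comm: "biprod S A B i j p q \<Longrightarrow> biprod S B A j i q p"
  using add_ac(1)[of "i \<cdot> p" "j \<cdot> q"] by (auto simp: biprod_def Hom_def)

text \<open>The four arrows are those obtained by writing \<open>S = A \<oplus> (B \<oplus> D)\<close> and \<open>U = A \<oplus> B\<close>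
  and regrouping the three summands.\<close>

lemma biprod_assoc:
  assumes "biprod S A T i j p q" "biprod T B D i' j' p' q'" "biprod U A B u v r s"
  shows "biprod S U D (i \<cdot> r \<boxplus> j \<cdot> i' \<cdot> s) (j \<cdot> j') (u \<cdot> p \<boxplus> v \<cdot> (p' \<cdot> q)) (q' \<cdot> q)"
proof -
  note b = biprod_simps[OF assms(1)] biprod_simps[OF assms(2)] biprod_simps[OF assms(3)]
  have e1: "j \<cdot> (i' \<cdot> (p' \<cdot> q)) \<boxplus> j \<cdot> (j' \<cdot> (q' \<cdot> q)) = j \<cdot> q"
    using biprod_decomp'[OF assms(2), of q S] b by (subst distrib(1)[symmetric]) (simp_all add: Hom_def)
  show ?thesis
    unfolding biprod_def Hom_def using b e1
    by (auto simp: add_ac(2))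
qed

lemma biprod_iso:
  assumes "biprod S A B i j p q" "biprod S' A' B' i' j' p' q'" "isomorphic A A'" "isomorphic B B'"
  shows "isomorphic S S'"
proof -
  obtain f g f' g' where fg: "f \<in> Hom \<C> A A'" "g \<in> Hom \<C> A' A" "g \<cdot> f = Id A" "f \<cdot> g = Id A'"
    "f' \<in> Hom \<C> B B'" "g' \<in> Hom \<C> B' B" "g' \<cdot> f' = Id B" "f' \<cdot> g' = Id B'"
    using assms(3,4) unfolding isomorphic_def by blast
  note b = biprod_simps[OF assms(1)] biprod_simps[OF assms(2)]
  show ?thesis
    apply (rule isoI[of "i' \<cdot> f \<cdot> p \<boxplus> j' \<cdot> f' \<cdot> q" _ _ "i \<cdot> g \<cdot> p' \<boxplus> j \<cdot> g' \<cdot> q'"])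
    by (auto simp: b fg[unfolded Hom_def, simplified] Hom_def reassoc[OF fg(3)] reassoc[OF fg(4)] reassoc[OF fg(7)] reassoc[OF fg(8)])
qed

lemma biprod_transport:
  assumes "biprod S A B i j p q" "isomorphic S S'" "isomorphic A A'" "isomorphic B B'"
  shows "\<exists>i j p q. biprod S' A' B' i j p q"
proof -
  obtain f g f' g' where fg: "f \<in> Hom \<C> A A'" "g \<in> Hom \<C> A' A" "g \<cdot> f = Id A" "f \<cdot> g = Id A'"
    "f' \<in> Hom \<C> B B'" "g' \<in> Hom \<C> B' B" "g' \<cdot> f' = Id B" "f' \<cdot> g' = Id B'"
    using assms(3,4) unfolding isomorphic_def by blast
  obtain h k where hk: "h \<in> Hom \<C> S S'" "k \<in> Hom \<C> S' S" "k \<cdot> h = Id S" "h \<cdot> k = Id S'"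
    using assms(2) unfolding isomorphic_def by blast
  note b = biprod_simps[OF assms(1)] HomD(5)[OF fg(1)] HomD(5)[OF fg(5)] HomD(5)[OF hk(1)]
  have e1: "i \<cdot> (p \<cdot> k) \<boxplus> j \<cdot> (q \<cdot> k) = k"
    using biprod_decomp'[OF assms(1), of k S'] hk by simp
  have e2: "h \<cdot> (i \<cdot> (p \<cdot> k)) \<boxplus> h \<cdot> (j \<cdot> (q \<cdot> k)) = Id S'"
    using e1 hk b by (subst distrib(1)[symmetric]) (simp_all add: Hom_def)
  show ?thesis
    apply (rule exI[of _ "h \<cdot> i \<cdot> g"], rule exI[of _ "h \<cdot> j \<cdot> g'"], rule exI[of _ "f \<cdot> p \<cdot> k"], rule exI[of _ "f' \<cdot> q \<cdot> k"])
    unfolding biprod_def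
    by (auto simp: b fg[unfolded Hom_def, simplified] hk[unfolded Hom_def, simplified] e2 Hom_def reassoc[OF fg(3)] reassoc[OF fg(4)] reassoc[OF fg(7)] reassoc[OF fg(8)] reassoc[OF hk(3)])
qed

lemma biprod_zero:
  assumes "A \<in> Obj \<C>" "zero_object \<C> Z"
  shows "biprod A A Z (Id A) (Zr Z A) (Id A) (Zr A Z)"
  using assms unfolding biprod_def zero_object_iff by (auto simp: Hom_def)

end

section \<open>Cancellation of objects with local endomorphism ring\<close>

context preadditive_category begin

lemma direct_sumI: "biprod S A B i j p q \<Longrightarrow> direct_sum \<C> S [A, B]"
  using direct_sum2_iff by blast

lemma direct_sum_obj:
  assumes "direct_sum \<C> S Bs" shows "S \<in> Obj \<C>" "set Bs \<subseteq> Obj \<C>"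
  using assms by (auto simp: direct_sum_def)

lemma direct_sum_comm: "direct_sum \<C> S [A, B] \<Longrightarrow> direct_sum \<C> S [B, A]"
  unfolding direct_sum2_iff by (metis biprod_comm)

lemma direct_sum_assoc:
  "direct_sum \<C> S [A, T] \<Longrightarrow> direct_sum \<C> T [B, D] \<Longrightarrow> direct_sum \<C> U [A, B] \<Longrightarrow> direct_sum \<C> S [U, D]"
  unfolding direct_sum2_iff by (metis biprod_assoc)

lemma direct_sum_iso:
  "direct_sum \<C> S [A, B] \<Longrightarrow> direct_sum \<C> S' [A', B'] \<Longrightarrow> isomorphic A A' \<Longrightarrow> isomorphic B B' \<Longrightarrow> isomorphic S S'"
  unfolding direct_sum2_iff by (metis biprod_iso)

lemma direct_sum_transport:
  "direct_sum \<C> S [A, B] \<Longrightarrow> isomorphic S S' \<Longrightarrow> isomorphic A A' \<Longrightarrow> isomorphic B B' \<Longrightarrow> direct_sum \<C> S' [A', B']"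
  unfolding direct_sum2_iff by (metis biprod_transport)

lemma direct_sum_zero: "A \<in> Obj \<C> \<Longrightarrow> zero_object \<C> Z \<Longrightarrow> direct_sum \<C> A [A, Z]"
  unfolding direct_sum2_iff by (metis biprod_zero)

lemma zero_iso: "zero_object \<C> Z \<Longrightarrow> zero_object \<C> Z' \<Longrightarrow> isomorphic Z Z'"
  by (rule isoI[of "Zr Z Z'" _ _ "Zr Z' Z"]) (auto simp: zero_object_iff Hom_def)

lemma zero_iso_zero:
  assumes "zero_object \<C> Z" "isomorphic Z A" shows "zero_object \<C> A"
proof -
  obtain f g where fg: "f \<in> Hom \<C> Z A" "g \<in> Hom \<C> A Z" "g \<cdot> f = Id Z" "f \<cdot> g = Id A"
    using assms(2) unfolding isomorphic_def by blast
  have "f \<cdot> Id Z \<cdot> g = Id A" using fg by (simp add: Hom_def)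
  moreover have "f \<cdot> Zr Z Z \<cdot> g = Zr A A" using fg HomD(4,5)[OF fg(1)] by (simp add: Hom_def)
  ultimately show ?thesis using assms(1) HomD(4,5)[OF fg(1)] by (simp add: zero_object_iff)
qed

lemma direct_sum_zero_iso:
  assumes "direct_sum \<C> S [A, Z]" "zero_object \<C> Z" shows "isomorphic S A"
  by (rule direct_sum_iso[OF assms(1) direct_sum_zero[OF _ assms(2)]])
     (use direct_sum_obj[OF assms(1)] in \<open>auto intro: iso_refl\<close>)

lemma add_diff_add:
  assumes "f \<in> Arr \<C>" "g \<in> Arr \<C>" "h \<in> Arr \<C>" "Dom \<C> f = Dom \<C> g" "Cod \<C> f = Cod \<C> g"
    "Dom \<C> g = Dom \<C> h" "Cod \<C> g = Cod \<C> h"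
  shows "(f \<boxminus> h) \<boxplus> (g \<boxplus> h) = f \<boxplus> g"
  using assms add_ac(1)[of g h] by (simp add: add_ac(2))

lemma add_minus_cancel:
  assumes "f \<in> Arr \<C>" "g \<in> Arr \<C>" "Dom \<C> f = Dom \<C> g" "Cod \<C> f = Cod \<C> g"
  shows "f \<boxplus> (g \<boxminus> f) = g"
proof -
  have "f \<boxplus> (g \<boxminus> f) = (g \<boxminus> f) \<boxplus> f" by (rule add_ac(1)) (use assms in auto)
  then show ?thesis using assms by simp
qed

lemma local_unit_cases:
  assumes "local_ring (End_ring \<C> L)" "x \<in> Hom \<C> L L" "y \<in> Hom \<C> L L" "x \<boxplus> y \<in> Units (End_ring \<C> L)"
  shows "x \<in> Units (End_ring \<C> L) \<or> y \<in> Units (End_ring \<C> L)"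
  using assms unfolding local_ring_def by (auto simp: End_ring_def)

lemma End_unit_iff:
  "x \<in> Units (End_ring \<C> L) \<longleftrightarrow> x \<in> Hom \<C> L L \<and> (\<exists>y \<in> Hom \<C> L L. y \<cdot> x = Id L \<and> x \<cdot> y = Id L)"
  by (auto simp: Units_def End_ring_def)

lemma End_unit_neg:
  assumes "x \<in> Units (End_ring \<C> L)" shows "neg x \<in> Units (End_ring \<C> L)"
proof -
  obtain y where "y \<in> Hom \<C> L L" "y \<cdot> x = Id L" "x \<cdot> y = Id L" "x \<in> Hom \<C> L L"
    using assms by (auto simp: End_unit_iff)
  then show ?thesis unfolding End_unit_iff by (intro conjI bexI[of _ "neg y"]) (auto simp: Hom_def)
qed

text \<open>If \<open>d \<cdot> e = 1\<close> then \<open>e \<cdot> d\<close> is idempotent, and in a local ring one of two complementary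
  idempotents is a unit, hence equal to \<open>1\<close>; it cannot be \<open>1 - e \<cdot> d\<close>, since this kills \<open>e\<close>.\<close>

lemma local_right_inverse:
  assumes L: "local_ring (End_ring \<C> L)" and d: "d \<in> Hom \<C> L L" and e: "e \<in> Hom \<C> L L" and de: "d \<cdot> e = Id L"
  shows "d \<in> Units (End_ring \<C> L)"
proof -
  note t [simp] = HomD[OF d] HomD[OF e]
  have one: "Id L \<in> Units (End_ring \<C> L)"
    unfolding End_unit_iff by (auto intro!: bexI[of _ "Id L"] simp: Hom_def)
  have "e \<cdot> d \<boxplus> (Id L \<boxminus> e \<cdot> d) = Id L"
    by (simp add: add_minus_cancel)
  then have "e \<cdot> d \<in> Units (End_ring \<C> L) \<or> (Id L \<boxminus> e \<cdot> d) \<in> Units (End_ring \<C> L)"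
    using local_unit_cases[OF L, of "e \<cdot> d" "Id L \<boxminus> e \<cdot> d"] one by (simp add: Hom_def)
  then show ?thesis
  proof
    assume "e \<cdot> d \<in> Units (End_ring \<C> L)"
    then obtain y where y: "y \<in> Hom \<C> L L" "y \<cdot> (e \<cdot> d) = Id L" by (auto simp: End_unit_iff)
    have "(y \<cdot> (e \<cdot> d)) \<cdot> (e \<cdot> d) = y \<cdot> (e \<cdot> ((d \<cdot> e) \<cdot> d))" using HomD[OF y(1)] by simp
    also have "\<dots> = y \<cdot> (e \<cdot> d)" by (simp add: de)
    finally have "e \<cdot> d = Id L" unfolding y(2) by simp
    then show ?thesis unfolding End_unit_iff using d e de by blast
  next
    assume "Id L \<boxminus> e \<cdot> d \<in> Units (End_ring \<C> L)"
    then obtain y where y: "y \<in> Hom \<C> L L" "y \<cdot> (Id L \<boxminus> e \<cdot> d) = Id L" by (auto simp: End_unit_iff)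
    have "(Id L \<boxminus> e \<cdot> d) \<cdot> e = Zr L L" by (simp add: de)
    then have "y \<cdot> ((Id L \<boxminus> e \<cdot> d) \<cdot> e) = Zr L L" using HomD[OF y(1)] by simp
    then have "(y \<cdot> (Id L \<boxminus> e \<cdot> d)) \<cdot> e = Zr L L" using HomD[OF y(1)] by (subst assoc) auto
    then have "e = Zr L L" unfolding y(2) by simp
    then have "Id L = Zr L L" using de by simp
    then show ?thesis using L by (simp add: local_ring_def End_ring_def)
  qed
qed

text \<open>The identity of \<open>S\<close>, seen as an arrow from \<open>A \<oplus> L\<close> to \<open>B \<oplus> L\<close>, is a 2 by 2 matrix of arrows
  whose entry at \<open>(L, L)\<close> is \<open>s \<cdot> l\<close>.  When this entry is invertible, the isomorphism from \<open>A\<close> to \<open>B\<close> is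
  its Schur complement, whose inverse is the entry from \<open>B\<close> to \<open>A\<close> of the inverse matrix.\<close>

lemma schur_complement_iso:
  assumes 1: "biprod S A L i l p t" and 2: "biprod S B L j m q s"
    and u: "s \<cdot> l \<in> Units (End_ring \<C> L)"
  shows "isomorphic A B"
proof -
  obtain u where u: "u \<in> Hom \<C> L L" "u \<cdot> (s \<cdot> l) = Id L" "(s \<cdot> l) \<cdot> u = Id L"
    using u by (auto simp: End_unit_iff)
  note b [simp] = biprod_simps(1-15)[OF 1] biprod_simps(1-15)[OF 2] HomD(1-3)[OF u(1)]
  define e where "e = Id S \<boxminus> l \<cdot> (u \<cdot> s)"
  have e [simp]: "e \<in> Arr \<C>" "Dom \<C> e = S" "Cod \<C> e = S" by (simp_all add: e_def)
  have sl: "s \<cdot> (l \<cdot> (u \<cdot> s)) = s" using arg_cong[OF u(3), of "\<lambda>x. x \<cdot> s"] by simp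
  \<comment> \<open>\<open>e\<close> is the projection along the image of \<open>l\<close> onto the kernel of \<open>s\<close>\<close>
  have se: "s \<cdot> e = Zr S L" by (simp add: e_def sl)
  have el: "e \<cdot> l = Zr L S" using u(2) by (simp add: e_def)
  have 3: "j \<cdot> (q \<cdot> e) = e" using biprod_decomp'[OF 2, of e S] se by (simp add: Hom_def)
  have 4: "e \<cdot> (i \<cdot> p) = e" using biprod_decomp[OF 1, of e S] reassoc[OF el, of t] by (simp add: Hom_def)
  have 5: "p \<cdot> (e \<cdot> i) = Id A" by (simp add: e_def biprod_simps[OF 1])
  have 6: "q \<cdot> (e \<cdot> j) = Id B" by (simp add: e_def biprod_simps[OF 2])
  show ?thesis
  proof (rule isoI[of "q \<cdot> (e \<cdot> i)" _ _ "p \<cdot> j"])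
    have "(p \<cdot> j) \<cdot> (q \<cdot> (e \<cdot> i)) = p \<cdot> ((j \<cdot> (q \<cdot> e)) \<cdot> i)" by simp
    also have "\<dots> = Id A" unfolding 3 by (rule 5)
    finally show "(p \<cdot> j) \<cdot> (q \<cdot> (e \<cdot> i)) = Id A" .
    have "q \<cdot> (e \<cdot> i) \<cdot> (p \<cdot> j) = q \<cdot> ((e \<cdot> (i \<cdot> p)) \<cdot> j)" by simp
    also have "\<dots> = Id B" unfolding 4 by (rule 6)
    finally show "q \<cdot> (e \<cdot> i) \<cdot> (p \<cdot> j) = Id B" .
  qed (auto simp: Hom_def)
qed

text \<open>The entry at \<open>(L, L)\<close> of the matrix of the previous lemma can be made invertible by an automorphism
  of \<open>A \<oplus> L\<close> (this is the stable range argument of Evans).  The entry of the matrix multiplied with its inverse gives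
  \<open>c + d \<cdot> d' = 1\<close> in \<open>End L\<close>, where \<open>d = s \<cdot> l\<close> and \<open>c\<close> factors through \<open>A\<close>.  If \<open>d\<close> is not a
  unit, then \<open>c\<close> is, and so is \<open>d + c\<close>, which is the entry after replacing \<open>l\<close>
  by \<open>l + i \<cdot> p \<cdot> m\<close>.\<close>

lemma cancel_local:
  assumes 1: "biprod S A L i l p t" and 2: "biprod S B L j m q s" and L: "local_ring (End_ring \<C> L)"
  shows "isomorphic A B"
proof (cases "s \<cdot> l \<in> Units (End_ring \<C> L)")
  case True
  then show ?thesis using schur_complement_iso 1 2 by blast
next
  case False
  note b [simp] = biprod_simps(1-15)[OF 1] biprod_simps(1-15)[OF 2]
  define c where "c = s \<cdot> (i \<cdot> (p \<cdot> m))"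
  have c [simp]: "c \<in> Arr \<C>" "Dom \<C> c = L" "Cod \<C> c = L" by (simp_all add: c_def)
  have "s \<cdot> (i \<cdot> (p \<cdot> m) \<boxplus> l \<cdot> (t \<cdot> m)) = s \<cdot> m"
    using biprod_decomp'[OF 1, of m L] by (simp add: Hom_def)
  then have sum: "c \<boxplus> (s \<cdot> l) \<cdot> (t \<cdot> m) = Id L" by (simp add: biprodD(17)[OF 2] c_def)
  have one: "Id L \<in> Units (End_ring \<C> L)"
    unfolding End_unit_iff by (auto intro!: bexI[of _ "Id L"] simp: Hom_def)
  have "(s \<cdot> l) \<cdot> (t \<cdot> m) \<notin> Units (End_ring \<C> L)"
  proof
    assume "(s \<cdot> l) \<cdot> (t \<cdot> m) \<in> Units (End_ring \<C> L)"
    then obtain y where "y \<in> Hom \<C> L L" "((s \<cdot> l) \<cdot> (t \<cdot> m)) \<cdot> y = Id L" by (auto simp: End_unit_iff)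
    then have "s \<cdot> l \<in> Units (End_ring \<C> L)"
      using local_right_inverse[OF L, of "s \<cdot> l" "(t \<cdot> m) \<cdot> y"] by (simp add: Hom_def)
    with False show False by blast
  qed
  then have cu: "c \<in> Units (End_ring \<C> L)"
    using local_unit_cases[OF L, of c "(s \<cdot> l) \<cdot> (t \<cdot> m)"] sum one by (simp add: Hom_def)
  have "(s \<cdot> l \<boxplus> c) \<boxplus> neg (s \<cdot> l) = c" by (simp add: add_ac)
  then have "(s \<cdot> l \<boxplus> c) \<in> Units (End_ring \<C> L) \<or> neg (s \<cdot> l) \<in> Units (End_ring \<C> L)"
    using local_unit_cases[OF L, of "s \<cdot> l \<boxplus> c" "neg (s \<cdot> l)"] cu by (simp add: Hom_def)
  moreover have "neg (s \<cdot> l) \<notin> Units (End_ring \<C> L)"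
    using False End_unit_neg[of "neg (s \<cdot> l)" L] by auto
  ultimately have u: "(s \<cdot> (l \<boxplus> i \<cdot> (p \<cdot> m))) \<in> Units (End_ring \<C> L)" by (simp add: c_def)
  have "biprod S A L i (l \<boxplus> i \<cdot> (p \<cdot> m)) (p \<boxminus> (p \<cdot> m) \<cdot> t) t"
    unfolding biprod_def
    by (auto simp: Hom_def biprod_simps[OF 1] add_diff_add[of "i \<cdot> p" "l \<cdot> t" "i \<cdot> (p \<cdot> (m \<cdot> t))"])
  then show ?thesis using schur_complement_iso 2 u by blast
qed

lemma comp_finprod:
  assumes "\<And>k. k < (n::nat) \<Longrightarrow> f k \<in> Hom \<C> A B" "A \<in> Obj \<C>" "B \<in> Obj \<C>"
  shows "g \<in> Hom \<C> B D \<Longrightarrow> g \<cdot> finprod (Hom_group \<C> A B) f {..<n} = finprod (Hom_group \<C> A D) (\<lambda>k. g \<cdot> f k) {..<n}"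
    "g \<in> Hom \<C> D A \<Longrightarrow> finprod (Hom_group \<C> A B) f {..<n} \<cdot> g = finprod (Hom_group \<C> D B) (\<lambda>k. f k \<cdot> g) {..<n}"
proof -
  interpret G: comm_group "Hom_group \<C> A B" by (rule hom_comm_group) (use assms in auto)
  {
    assume g: "g \<in> Hom \<C> B D"
    interpret H: comm_group "Hom_group \<C> A D" by (rule hom_comm_group) (use assms HomD[OF g] in auto)
    show "g \<cdot> finprod (Hom_group \<C> A B) f {..<n} = finprod (Hom_group \<C> A D) (\<lambda>k. g \<cdot> f k) {..<n}"
      using assms(1)
    proof (induction n)
      case 0
      then show ?case using HomD[OF g] assms by simp
    next
      case (Suc n)
      have "finprod (Hom_group \<C> A B) f {..<n} \<in> Hom \<C> A B"
        using G.finprod_closed[of f "{..<n}"] Suc.prems by (auto simp: Pi_def)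
      moreover have "finprod (Hom_group \<C> A B) f {..<Suc n} = f n \<boxplus> finprod (Hom_group \<C> A B) f {..<n}"
        using G.finprod_insert[of "{..<n}" n f] Suc.prems by (simp add: lessThan_Suc Pi_def)
      moreover have "finprod (Hom_group \<C> A D) (\<lambda>k. g \<cdot> f k) {..<Suc n} = g \<cdot> f n \<boxplus> finprod (Hom_group \<C> A D) (\<lambda>k. g \<cdot> f k) {..<n}"
        using H.finprod_insert[of "{..<n}" n "\<lambda>k. g \<cdot> f k"] Suc.prems comp_hom[OF _ g] by (simp add: lessThan_Suc Pi_def)
      ultimately show ?case using Suc comp_add_right[OF Suc.prems[OF lessI] _ g] by simp
    qed
  }
  {
    assume g: "g \<in> Hom \<C> D A"
    interpret H: comm_group "Hom_group \<C> D B" by (rule hom_comm_group) (use assms HomD[OF g] in auto)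
    show "finprod (Hom_group \<C> A B) f {..<n} \<cdot> g = finprod (Hom_group \<C> D B) (\<lambda>k. f k \<cdot> g) {..<n}"
      using assms(1)
    proof (induction n)
      case 0
      then show ?case using HomD[OF g] assms by simp
    next
      case (Suc n)
      have "finprod (Hom_group \<C> A B) f {..<n} \<in> Hom \<C> A B"
        using G.finprod_closed[of f "{..<n}"] Suc.prems by (auto simp: Pi_def)
      moreover have "finprod (Hom_group \<C> A B) f {..<Suc n} = f n \<boxplus> finprod (Hom_group \<C> A B) f {..<n}"
        using G.finprod_insert[of "{..<n}" n f] Suc.prems by (simp add: lessThan_Suc Pi_def)
      moreover have "finprod (Hom_group \<C> D B) (\<lambda>k. f k \<cdot> g) {..<Suc n} = f n \<cdot> g \<boxplus> finprod (Hom_group \<C> D B) (\<lambda>k. f k \<cdot> g) {..<n}"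
        using H.finprod_insert[of "{..<n}" n "\<lambda>k. f k \<cdot> g"] Suc.prems comp_hom[OF g] by (simp add: lessThan_Suc Pi_def)
      ultimately show ?case using Suc comp_add_left[OF g Suc.prems[OF lessI]] by simp
    qed
  }
qed

text \<open>An iterated binary form of \<open>direct_sum\<close>, suited to induction over the list of summands.\<close>

inductive list_sum :: "'o list \<Rightarrow> 'o \<Rightarrow> bool" where
  Nil: "zero_object \<C> Z \<Longrightarrow> list_sum [] Z"
| Cons: "list_sum xs T \<Longrightarrow> direct_sum \<C> S [x, T] \<Longrightarrow> list_sum (x # xs) S"

lemma list_sum_obj: "list_sum xs S \<Longrightarrow> S \<in> Obj \<C>" "list_sum xs S \<Longrightarrow> set xs \<subseteq> Obj \<C>"
  by (induction rule: list_sum.induct) (auto simp: zero_object_iff dest: direct_sum_obj)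

lemma list_sum_iso: "list_sum xs S \<Longrightarrow> isomorphic S S' \<Longrightarrow> list_sum xs S'"
proof (induction xs S rule: list_sum.induct)
  case (Nil Z)
  then show ?case using zero_iso_zero list_sum.Nil by blast
next
  case (Cons xs T S x)
  then show ?case using direct_sum_transport[OF Cons.hyps(2) Cons.prems] direct_sum_obj[OF Cons.hyps(2)]
    by (auto intro!: list_sum.Cons iso_refl)
qed

lemma list_sum_NilD: "list_sum [] S \<Longrightarrow> zero_object \<C> S"
  by (auto elim: list_sum.cases)

end

context additive_category begin

lemma list_sum_remove1: "list_sum xs S \<Longrightarrow> x \<in> set xs \<Longrightarrow> \<exists>T. list_sum (remove1 x xs) T \<and> direct_sum \<C> S [x, T]"
proof (induction xs S rule: list_sum.induct)
  case (Cons xs T S y)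
  show ?case
  proof (cases "x = y")
    case True
    then show ?thesis using Cons by auto
  next
    case False
    then obtain T' where T': "list_sum (remove1 x xs) T'" "direct_sum \<C> T [x, T']" using Cons by auto
    obtain U where U: "direct_sum \<C> U [y, T']"
      using ex_biproduct[of y T'] list_sum_obj[OF T'(1)] direct_sum_obj[OF Cons.hyps(2)] by auto
    have "direct_sum \<C> S [U, x]"
      using direct_sum_assoc[OF Cons.hyps(2) direct_sum_comm[OF T'(2)] U] .
    then show ?thesis using False list_sum.Cons[OF T'(1) U] direct_sum_comm by auto
  qed
qed auto

text \<open>An iterated direct sum is determined by the multiset of isomorphism classes of its summands.
  The function \<open>K\<close> stands for the passage to isomorphism classes, of a kind at least as fine as that in the
  category at hand; for the stable category it will be instantiated with the isomorphism classes of the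
  original category.\<close>

lemma list_sum_unique:
  assumes "list_sum xs S" "list_sum ys T" "image_mset K (mset xs) = image_mset K (mset ys)"
    "\<And>x y. x \<in> set xs \<Longrightarrow> y \<in> set ys \<Longrightarrow> K x = K y \<Longrightarrow> isomorphic x y"
  shows "isomorphic S T"
  using assms(2,1,3,4)
proof (induction ys T arbitrary: xs S rule: list_sum.induct)
  case (Nil Z)
  have "xs = []" using Nil.prems(2) by simp
  then have "zero_object \<C> S" using list_sum_NilD[of S] Nil.prems(1) by blast
  then show ?case using zero_iso Nil.hyps by blast
next
  case (Cons ys T' T y)
  have "K y \<in># image_mset K (mset xs)" using Cons.prems(2) by simp
  then obtain x where x: "x \<in> set xs" "K x = K y" by auto
  obtain S' where S': "list_sum (remove1 x xs) S'" "direct_sum \<C> S [x, S']"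
    using list_sum_remove1[OF Cons.prems(1) x(1)] by blast
  have "image_mset K (mset (remove1 x xs)) = image_mset K (mset ys)"
    using Cons.prems(2) x by (simp add: image_mset_Diff)
  then have "isomorphic S' T'" using Cons.IH[OF S'(1)] Cons.prems(3) set_remove1_subset[of x xs] by auto
  then show ?case using direct_sum_iso[OF S'(2) Cons.hyps(2)] Cons.prems(3) x by auto
qed

lemma list_sum_append: "list_sum xs S \<Longrightarrow> list_sum ys T \<Longrightarrow> direct_sum \<C> U [S, T] \<Longrightarrow> list_sum (xs @ ys) U"
proof (induction xs S arbitrary: U rule: list_sum.induct)
  case (Nil Z)
  then show ?case using direct_sum_zero_iso[OF direct_sum_comm] list_sum_iso iso_sym by (metis append_Nil)
next
  case (Cons xs S' S x)
  obtain V where V: "direct_sum \<C> V [T, S']"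
    using ex_biproduct[of T S'] list_sum_obj Cons by blast
  have "direct_sum \<C> U [V, x]"
    using direct_sum_assoc[OF direct_sum_comm[OF Cons.prems(2)] direct_sum_comm[OF Cons.hyps(2)] V] .
  then show ?case using Cons.IH[OF Cons.prems(1) direct_sum_comm[OF V]] list_sum.Cons direct_sum_comm by auto
qed

text \<open>The sums of \<open>a\<^sub>k \<cdot> b\<^sub>k\<close> over final segments of the list are idempotents, and each is split by an iterated direct sum.
  Keeping the object \<open>S\<close> fixed while the list shrinks makes the induction work, since \<open>S\<close> itself
  is not a sum of the shorter list.\<close>

lemma orthogonal_family_list_sum:
  assumes "S \<in> Obj \<C>" "set xs \<subseteq> Obj \<C>"
    "\<And>k. k < length xs \<Longrightarrow> a k \<in> Hom \<C> (xs ! k) S \<and> b k \<in> Hom \<C> S (xs ! k)"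
    "\<And>k l. k < length xs \<Longrightarrow> l < length xs \<Longrightarrow>
        b l \<cdot> a k = (if k = l then Id (xs ! k) else Zr (xs ! k) (xs ! l))"
  shows "\<exists>T u v. list_sum xs T \<and> u \<in> Hom \<C> T S \<and> v \<in> Hom \<C> S T \<and> v \<cdot> u = Id T \<and>
           u \<cdot> v = finprod (Hom_group \<C> S S) (\<lambda>k. a k \<cdot> b k) {..<length xs}"
  using assms(2-)
proof (induction xs arbitrary: a b)
  case Nil
  interpret G: comm_group "Hom_group \<C> S S" by (rule hom_comm_group) (use assms in auto)
  obtain Z where Z: "zero_object \<C> Z" using ex_zero by blast
  then show ?case using assms(1)
    by (intro exI[of _ Z] exI[of _ "Zr Z S"] exI[of _ "Zr S Z"]) (auto simp: zero_object_iff Hom_def intro: list_sum.Nil)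
next
  case (Cons x xs)
  interpret G: comm_group "Hom_group \<C> S S" by (rule hom_comm_group) (use assms in auto)
  define a' b' where "a' = (\<lambda>k. a (Suc k))" and "b' = (\<lambda>k. b (Suc k))"
  let ?n = "length xs"
  have hom: "a' k \<in> Hom \<C> (xs ! k) S \<and> b' k \<in> Hom \<C> S (xs ! k)" if "k < ?n" for k
    using Cons.prems(2)[of "Suc k"] that by (simp add: a'_def b'_def)
  have orth: "b' l \<cdot> a' k = (if k = l then Id (xs ! k) else Zr (xs ! k) (xs ! l))" if "k < ?n" "l < ?n" for k l
    using Cons.prems(3)[of "Suc k" "Suc l"] that by (simp add: a'_def b'_def)
  obtain T u v where T: "list_sum xs T" "u \<in> Hom \<C> T S" "v \<in> Hom \<C> S T" "v \<cdot> u = Id T"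
    and uv: "u \<cdot> v = finprod (Hom_group \<C> S S) (\<lambda>k. a' k \<cdot> b' k) {..<?n}"
    using Cons.IH[of a' b'] hom orth Cons.prems(1) by auto
  have x: "x \<in> Obj \<C>" using Cons.prems by auto
  have h0: "a 0 \<in> Hom \<C> x S" "b 0 \<in> Hom \<C> S x" using Cons.prems(2)[of 0] by auto
  have ab: "b 0 \<cdot> a 0 = Id x" using Cons.prems(3)[of 0 0] by simp
  have t: "a' k \<cdot> b' k \<in> Hom \<C> S S" if "k < ?n" for k using hom[OF that] comp_hom by blast
  \<comment> \<open>the first summand is orthogonal to the idempotent \<open>u \<cdot> v\<close> of the remaining ones\<close>
  have z1: "b 0 \<cdot> (a' k \<cdot> b' k) = Zr S x" if "k < ?n" for k
  proof -
    have "b 0 \<cdot> a' k = Zr (xs ! k) x" using Cons.prems(3)[of "Suc k" 0] that by (simp add: a'_def)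
    then show ?thesis using reassoc[of "b 0" "a' k" _ "b' k"] hom[OF that] h0 HomD(4)[OF h0(1)] by (simp add: Hom_def)
  qed
  have z2: "(a' k \<cdot> b' k) \<cdot> a 0 = Zr x S" if "k < ?n" for k
  proof -
    have "b' k \<cdot> a 0 = Zr x (xs ! k)" using Cons.prems(3)[of 0 "Suc k"] that by (simp add: b'_def)
    then show ?thesis using hom[OF that] h0 HomD(4)[OF h0(1)] by (simp add: Hom_def)
  qed
  have bz: "b 0 \<cdot> (u \<cdot> v) = Zr S x"
  proof -
    interpret H: comm_group "Hom_group \<C> S x" by (rule hom_comm_group) (use assms x in auto)
    have "b 0 \<cdot> finprod (Hom_group \<C> S S) (\<lambda>k. a' k \<cdot> b' k) {..<?n} = finprod (Hom_group \<C> S x) (\<lambda>k. b 0 \<cdot> (a' k \<cdot> b' k)) {..<?n}"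
      by (rule comp_finprod(1)[OF _ assms(1) assms(1) h0(2)]) (rule t)
    then show ?thesis
      unfolding uv using H.finprod_one_eqI[of "{..<?n}" "\<lambda>k. b 0 \<cdot> (a' k \<cdot> b' k)"] z1 by simp
  qed
  have za: "(u \<cdot> v) \<cdot> a 0 = Zr x S"
  proof -
    interpret H: comm_group "Hom_group \<C> x S" by (rule hom_comm_group) (use assms x in auto)
    have "finprod (Hom_group \<C> S S) (\<lambda>k. a' k \<cdot> b' k) {..<?n} \<cdot> a 0 = finprod (Hom_group \<C> x S) (\<lambda>k. (a' k \<cdot> b' k) \<cdot> a 0) {..<?n}"
      by (rule comp_finprod(2)[OF _ assms(1) assms(1) h0(1)]) (rule t)
    then show ?thesis
      unfolding uv using H.finprod_one_eqI[of "{..<?n}" "\<lambda>k. (a' k \<cdot> b' k) \<cdot> a 0"] z2 by simp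
  qed
  note ty [simp] = HomD[OF T(2)] HomD[OF T(3)] HomD[OF h0(1)] HomD[OF h0(2)]
  have bu: "b 0 \<cdot> u = Zr T x"
    using arg_cong[OF bz, of "\<lambda>y. y \<cdot> u"] by (simp add: T(4))
  have va: "v \<cdot> a 0 = Zr x T"
    using arg_cong[OF za, of "\<lambda>y. v \<cdot> y"] by (simp add: reassoc[OF T(4)])
  obtain U where "direct_sum \<C> U [x, T]" using ex_biproduct[of x T] by auto
  then obtain i j p q where bp: "biprod U x T i j p q" unfolding direct_sum2_iff by blast
  note b = biprod_simps[OF bp]
  have "a 0 \<cdot> b 0 \<boxplus> u \<cdot> v = finprod (Hom_group \<C> S S) (\<lambda>k. a k \<cdot> b k) {..<Suc ?n}"
  proof -
    have "(\<lambda>k. a k \<cdot> b k) \<in> {..<Suc ?n} \<rightarrow> carrier (Hom_group \<C> S S)"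
    proof (rule Pi_I)
      fix k assume "k \<in> {..<Suc ?n}"
      then show "a k \<cdot> b k \<in> carrier (Hom_group \<C> S S)" using Cons.prems(2)[of k] comp_hom[of "b k" S "(x # xs) ! k" "a k" S] by simp
    qed
    moreover have "{..<Suc ?n} = insert 0 (Suc ` {..<?n})" by (rule lessThan_Suc_eq_insert_0)
    ultimately show ?thesis
      using G.finprod_insert[of "Suc ` {..<?n}" 0 "\<lambda>k. a k \<cdot> b k"] G.finprod_reindex[of "\<lambda>k. a k \<cdot> b k" Suc "{..<?n}"]
      by (auto simp: uv a'_def b'_def)
  qed
  then show ?case
    using list_sum.Cons[OF T(1) direct_sumI[OF bp]]
    by (intro exI[of _ U] exI[of _ "a 0 \<cdot> p \<boxplus> u \<cdot> q"] exI[of _ "i \<cdot> b 0 \<boxplus> j \<cdot> v"])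
       (auto simp: Hom_def b ab bu va T(4) reassoc[OF ab] reassoc[OF bu] reassoc[OF va] reassoc[OF T(4)])
qed

lemma direct_sum_list_sum:
  assumes "direct_sum \<C> S xs" shows "list_sum xs S"
proof -
  obtain a b where ab: "\<forall>k < length xs. a k \<in> Hom \<C> (xs ! k) S \<and> b k \<in> Hom \<C> S (xs ! k)"
    "\<forall>k < length xs. \<forall>l < length xs. b l \<cdot> a k = (if k = l then Id (xs ! k) else Zr (xs ! k) (xs ! l))"
    "finprod (Hom_group \<C> S S) (\<lambda>k. a k \<cdot> b k) {..<length xs} = Id S"
    using assms unfolding direct_sum_def by blast
  have "\<exists>T u v. list_sum xs T \<and> u \<in> Hom \<C> T S \<and> v \<in> Hom \<C> S T \<and> v \<cdot> u = Id T \<and>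
           u \<cdot> v = finprod (Hom_group \<C> S S) (\<lambda>k. a k \<cdot> b k) {..<length xs}"
    by (rule orthogonal_family_list_sum) (use ab direct_sum_obj[OF assms] in auto)
  then obtain T u v where T: "list_sum xs T" "u \<in> Hom \<C> T S" "v \<in> Hom \<C> S T" "v \<cdot> u = Id T" "u \<cdot> v = Id S"
    using ab(3) by auto
  then show ?thesis using list_sum_iso isoI by blast
qed

text \<open>Summands with local endomorphism ring are cancelled one at a time.\<close>

lemma cancel_list_sum:
  assumes "list_sum Ls Z" "\<And>L. L \<in> set Ls \<Longrightarrow> local_ring (End_ring \<C> L)"
    "direct_sum \<C> S [A, Z]" "direct_sum \<C> S [B, Z]"
  shows "isomorphic A B"
  using assms
proof (induction Ls Z arbitrary: S A B rule: list_sum.induct)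
  case (Nil Z)
  show ?case using iso_trans[OF iso_sym[OF direct_sum_zero_iso[OF Nil.prems(2) Nil.hyps]] direct_sum_zero_iso[OF Nil.prems(3) Nil.hyps]] .
next
  case (Cons Ls T Z L)
  have o: "A \<in> Obj \<C>" "B \<in> Obj \<C>" "L \<in> Obj \<C>"
    using direct_sum_obj(2)[OF Cons.prems(2)] direct_sum_obj(2)[OF Cons.prems(3)] direct_sum_obj(2)[OF Cons.hyps(2)] by auto
  obtain U V where U: "direct_sum \<C> U [A, L]" and V: "direct_sum \<C> V [B, L]"
    using ex_biproduct o by blast
  have "isomorphic U V"
    by (rule Cons.IH[OF _ direct_sum_assoc[OF Cons.prems(2) Cons.hyps(2) U] direct_sum_assoc[OF Cons.prems(3) Cons.hyps(2) V]])
      (use Cons.prems(1) in auto)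
  then have "direct_sum \<C> V [A, L]" using direct_sum_transport[OF U _ iso_refl iso_refl] o by simp
  then show ?case using V cancel_local Cons.prems(1) unfolding direct_sum2_iff by (meson list.set_intros(1))
qed

end

section \<open>Conflations, projectives and the stable category\<close>

context exact_category begin

lemma conf_arr:
  assumes "(i, p) \<in> Conf \<C>"
  shows "i \<in> Arr \<C>" "p \<in> Arr \<C>" "Cod \<C> i = Dom \<C> p" "p \<cdot> i = Zr (Dom \<C> i) (Cod \<C> p)"
  using conf_ker_coker[OF assms] by (auto simp: is_kernel_def)

lemma conf_lift:
  assumes "(i, p) \<in> Conf \<C>" "f \<in> Hom \<C> X (Dom \<C> p)" "p \<cdot> f = Zr X (Cod \<C> p)"
  shows "\<exists>g. g \<in> Hom \<C> X (Dom \<C> i) \<and> i \<cdot> g = f"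
  using conf_ker_coker[OF assms(1)] HomD[OF assms(2)] assms(3) unfolding is_kernel_def by metis

lemma conf_mono:
  assumes "(i, p) \<in> Conf \<C>" "f \<in> Hom \<C> X (Dom \<C> i)" "g \<in> Hom \<C> X (Dom \<C> i)" "i \<cdot> f = i \<cdot> g"
  shows "f = g"
proof -
  note [simp] = conf_arr[OF assms(1)] HomD(1-3)[OF assms(2)] HomD(1-3)[OF assms(3)]
  let ?h = "i \<cdot> f"
  have "?h \<in> Arr \<C> \<and> Cod \<C> ?h = Dom \<C> p \<and> p \<cdot> ?h = Zr (Dom \<C> ?h) (Cod \<C> p)"
    by (simp add: reassoc[OF conf_arr(4)[OF assms(1)]])
  then have "\<exists>!k. k \<in> Hom \<C> (Dom \<C> ?h) (Dom \<C> i) \<and> i \<cdot> k = ?h"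
    using conf_ker_coker[OF assms(1)] unfolding is_kernel_def by blast
  moreover have "Dom \<C> ?h = X" by simp
  ultimately show ?thesis using assms(2-4) by metis
qed

lemma conf_extend:
  assumes "(i, p) \<in> Conf \<C>" "f \<in> Hom \<C> (Dom \<C> p) X" "f \<cdot> i = Zr (Dom \<C> i) X"
  shows "\<exists>g. g \<in> Hom \<C> (Cod \<C> p) X \<and> g \<cdot> p = f"
  using conf_ker_coker[OF assms(1)] HomD[OF assms(2)] assms(3) unfolding is_cokernel_def by metis

lemma conf_epi:
  assumes "(i, p) \<in> Conf \<C>" "f \<in> Hom \<C> (Cod \<C> p) X" "g \<in> Hom \<C> (Cod \<C> p) X" "f \<cdot> p = g \<cdot> p"
  shows "f = g"
proof -
  note [simp] = conf_arr[OF assms(1)] HomD(1-3)[OF assms(2)] HomD(1-3)[OF assms(3)] HomD(5)[OF assms(2)]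
  let ?h = "f \<cdot> p"
  have "?h \<in> Arr \<C> \<and> Dom \<C> ?h = Cod \<C> i \<and> ?h \<cdot> i = Zr (Dom \<C> i) (Cod \<C> ?h)"
    by (simp)
  then have "\<exists>!k. k \<in> Hom \<C> (Cod \<C> p) (Cod \<C> ?h) \<and> k \<cdot> p = ?h"
    using conf_ker_coker[OF assms(1)] unfolding is_cokernel_def by blast
  moreover have "Cod \<C> ?h = X" by simp
  ultimately show ?thesis using assms(2-4) by metis
qed

lemma Proj_obj: "P \<in> Proj \<C> \<Longrightarrow> P \<in> Obj \<C>" by (simp add: Proj_def)

lemma Proj_lift:
  assumes "P \<in> Proj \<C>" "(i, p) \<in> Conf \<C>" "f \<in> Hom \<C> P (Cod \<C> p)"
  shows "\<exists>g. g \<in> Hom \<C> P (Dom \<C> p) \<and> p \<cdot> g = f"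
proof -
  have "(\<lambda>f. p \<cdot> f) \<in> epi (Hom_group \<C> P (Cod \<C> i)) (Hom_group \<C> P (Cod \<C> p))"
    using assms(1,2) short_exact_sequenceD unfolding Proj_def by blast
  then have "(\<lambda>f. p \<cdot> f) ` Hom \<C> P (Cod \<C> i) = Hom \<C> P (Cod \<C> p)" by (simp add: epi_def)
  then show ?thesis using assms(3) conf_arr(3)[OF assms(2)] by (metis (no_types, lifting) imageE)
qed

text \<open>Only surjectivity of \<open>Hom(P, p)\<close> is in question: the rest of the short exact sequence
  expresses that \<open>i\<close> is a kernel of \<open>p\<close>.\<close>

lemma ProjI:
  assumes P: "P \<in> Obj \<C>"
    and lift: "\<And>i p f. (i, p) \<in> Conf \<C> \<Longrightarrow> f \<in> Hom \<C> P (Cod \<C> p) \<Longrightarrow> \<exists>g. g \<in> Hom \<C> P (Dom \<C> p) \<and> p \<cdot> g = f"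
  shows "P \<in> Proj \<C>"
  unfolding Proj_def
proof (intro CollectI conjI P, clarify)
  fix i p assume ip: "(i, p) \<in> Conf \<C>"
  note c [simp] = conf_arr[OF ip]
  have grp: "group (Hom_group \<C> P X)" if "X \<in> Obj \<C>" for X
    using hom_comm_group[OF P that] by (simp add: comm_group_def)
  have 1: "(\<lambda>f. i \<cdot> f) \<in> hom (Hom_group \<C> P (Dom \<C> i)) (Hom_group \<C> P (Cod \<C> i))"
    by (auto simp: hom_def Hom_def)
  have 2: "(\<lambda>f. p \<cdot> f) \<in> hom (Hom_group \<C> P (Cod \<C> i)) (Hom_group \<C> P (Cod \<C> p))"
    by (auto simp: hom_def Hom_def)
  have inj: "inj_on (\<lambda>f. i \<cdot> f) (Hom \<C> P (Dom \<C> i))"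
    using conf_mono[OF ip] by (auto simp: inj_on_def)
  have sur: "(\<lambda>f. p \<cdot> f) ` Hom \<C> P (Cod \<C> i) = Hom \<C> P (Cod \<C> p)"
  proof
    show "(\<lambda>f. p \<cdot> f) ` Hom \<C> P (Cod \<C> i) \<subseteq> Hom \<C> P (Cod \<C> p)" by (auto simp: Hom_def)
    show "Hom \<C> P (Cod \<C> p) \<subseteq> (\<lambda>f. p \<cdot> f) ` Hom \<C> P (Cod \<C> i)"
      using lift[OF ip] by (force simp: image_iff c(3))
  qed
  have ker: "kernel (Hom_group \<C> P (Cod \<C> i)) (Hom_group \<C> P (Cod \<C> p)) (\<lambda>f. p \<cdot> f) = (\<lambda>f. i \<cdot> f) ` Hom \<C> P (Dom \<C> i)"
  proof
    show "kernel (Hom_group \<C> P (Cod \<C> i)) (Hom_group \<C> P (Cod \<C> p)) (\<lambda>f. p \<cdot> f) \<subseteq> (\<lambda>f. i \<cdot> f) ` Hom \<C> P (Dom \<C> i)"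
      using conf_lift[OF ip, of _ P] by (force simp: kernel_def image_iff c(3))
    show "(\<lambda>f. i \<cdot> f) ` Hom \<C> P (Dom \<C> i) \<subseteq> kernel (Hom_group \<C> P (Cod \<C> i)) (Hom_group \<C> P (Cod \<C> p)) (\<lambda>f. p \<cdot> f)"
      by (auto simp: kernel_def Hom_def reassoc[OF c(4)])
  qed
  show "short_exact_sequence (Hom_group \<C> P (Cod \<C> p)) (Hom_group \<C> P (Cod \<C> i)) (Hom_group \<C> P (Dom \<C> i))
         ((\<cdot>) p) ((\<cdot>) i)"
    unfolding short_exact_sequence_iff using 1 2 inj sur ker grp
    by (simp add: epi_def mon_def group_hom_def group_hom_axioms_def)
qed

lemma Proj_retract:
  assumes P: "P \<in> Proj \<C>" and ab: "a \<in> Hom \<C> X P" "b \<in> Hom \<C> P X" "b \<cdot> a = Id X"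
  shows "X \<in> Proj \<C>"
proof (rule ProjI)
  note [simp] = HomD[OF ab(1)] HomD[OF ab(2)]
  show "X \<in> Obj \<C>" by simp
  fix i p f assume ip: "(i, p) \<in> Conf \<C>" and f: "f \<in> Hom \<C> X (Cod \<C> p)"
  obtain g where g: "g \<in> Hom \<C> P (Dom \<C> p)" "p \<cdot> g = f \<cdot> b"
    using Proj_lift[OF P ip comp_hom[OF ab(2) f]] by blast
  then have "p \<cdot> (g \<cdot> a) = f"
    using conf_arr[OF ip] HomD[OF f] HomD[OF g(1)] reassoc[OF g(2)] ab(3) by simp
  then show "\<exists>g. g \<in> Hom \<C> X (Dom \<C> p) \<and> p \<cdot> g = f" using comp_hom[OF ab(1) g(1)] by blast
qed

lemma Proj_zero:
  assumes "zero_object \<C> Z" shows "Z \<in> Proj \<C>"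
proof (rule ProjI)
  have Z: "Z \<in> Obj \<C>" "Id Z = Zr Z Z" using assms by (auto simp: zero_object_iff)
  then show "Z \<in> Obj \<C>" by simp
  fix i p f assume ip: "(i, p) \<in> Conf \<C>" and f: "f \<in> Hom \<C> Z (Cod \<C> p)"
  have "f = f \<cdot> Id Z" using HomD[OF f] by simp
  also have "\<dots> = Zr Z (Cod \<C> p)" using Z HomD[OF f] by simp
  finally have "f = p \<cdot> Zr Z (Dom \<C> p)" using Z conf_arr[OF ip] by simp
  then show "\<exists>g. g \<in> Hom \<C> Z (Dom \<C> p) \<and> p \<cdot> g = f" using Z conf_arr[OF ip]
    by (intro exI[of _ "Zr Z (Dom \<C> p)"]) (simp add: Hom_def)
qed

lemma Proj_sum:
  assumes "direct_sum \<C> S [P, Q]" "P \<in> Proj \<C>" "Q \<in> Proj \<C>"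
  shows "S \<in> Proj \<C>"
proof -
  obtain i j p q where bp: "biprod S P Q i j p q" using assms(1) direct_sum2_iff by blast
  note b [simp] = biprod_simps[OF bp] and bd = biprod_decomp[OF bp]
  show ?thesis
  proof (rule ProjI)
    show "S \<in> Obj \<C>" by simp
    fix k d f assume kd: "(k, d) \<in> Conf \<C>" and f: "f \<in> Hom \<C> S (Cod \<C> d)"
    note [simp] = HomD[OF f] conf_arr[OF kd]
    obtain g where g: "g \<in> Hom \<C> P (Dom \<C> d)" "d \<cdot> g = f \<cdot> i"
      using Proj_lift[OF assms(2) kd, of "f \<cdot> i"] by (auto simp: Hom_def)
    obtain h where h: "h \<in> Hom \<C> Q (Dom \<C> d)" "d \<cdot> h = f \<cdot> j"
      using Proj_lift[OF assms(3) kd, of "f \<cdot> j"] by (auto simp: Hom_def)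
    note [simp] = HomD[OF g(1)] HomD[OF h(1)]
    have "d \<cdot> (g \<cdot> p \<boxplus> h \<cdot> q) = f"
      using bd[OF f] by (simp add: reassoc[OF g(2)] reassoc[OF h(2)])
    then show "\<exists>g. g \<in> Hom \<C> S (Dom \<C> d) \<and> d \<cdot> g = f"
      by (intro exI[of _ "g \<cdot> p \<boxplus> h \<cdot> q"]) (simp add: Hom_def)
  qed
qed

lemma null_hom: "n \<in> null_maps \<C> A B \<Longrightarrow> n \<in> Hom \<C> A B"
  unfolding null_maps_def using comp_hom by blast

lemma null_comp_left:
  assumes "n \<in> null_maps \<C> A B" "f \<in> Hom \<C> B D" shows "f \<cdot> n \<in> null_maps \<C> A D"
proof -
  obtain u v P where n: "n = v \<cdot> u" "P \<in> Proj \<C>" "u \<in> Hom \<C> A P" "v \<in> Hom \<C> P B"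
    using assms(1) unfolding null_maps_def by blast
  then have "f \<cdot> n = (f \<cdot> v) \<cdot> u" using assms(2) by (simp add: Hom_def)
  then show ?thesis unfolding null_maps_def using n comp_hom[OF n(4) assms(2)] by blast
qed

lemma null_comp_right:
  assumes "n \<in> null_maps \<C> B D" "f \<in> Hom \<C> A B" shows "n \<cdot> f \<in> null_maps \<C> A D"
proof -
  obtain u v P where n: "n = v \<cdot> u" "P \<in> Proj \<C>" "u \<in> Hom \<C> B P" "v \<in> Hom \<C> P D"
    using assms(1) unfolding null_maps_def by blast
  then have "n \<cdot> f = v \<cdot> (u \<cdot> f)" using assms(2) by (simp add: Hom_def)
  then show ?thesis unfolding null_maps_def using n comp_hom[OF assms(2) n(3)] by blast
qed

lemma null_through: "P \<in> Proj \<C> \<Longrightarrow> u \<in> Hom \<C> A P \<Longrightarrow> v \<in> Hom \<C> P B \<Longrightarrow> v \<cdot> u \<in> null_maps \<C> A B"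
  unfolding null_maps_def by blast

lemma null_to_Proj: "P \<in> Proj \<C> \<Longrightarrow> u \<in> Hom \<C> A P \<Longrightarrow> u \<in> null_maps \<C> A P"
  using null_through[of P u A "Id P" P] HomD[of u A P] by (simp add: ide_hom)

text \<open>Maps that factor through projectives \<open>P'\<close> and \<open>P\<close> have a sum that factors through \<open>P' \<oplus> P\<close>.\<close>

lemma null_add:
  assumes "m \<in> null_maps \<C> A B" "n \<in> null_maps \<C> A B" shows "m \<boxplus> n \<in> null_maps \<C> A B"
proof -
  obtain u v P where n: "n = v \<cdot> u" "P \<in> Proj \<C>" "u \<in> Hom \<C> A P" "v \<in> Hom \<C> P B"
    using assms(2) unfolding null_maps_def by blast
  obtain u' v' P' where m: "m = v' \<cdot> u'" "P' \<in> Proj \<C>" "u' \<in> Hom \<C> A P'" "v' \<in> Hom \<C> P' B"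
    using assms(1) unfolding null_maps_def by blast
  obtain S where S: "direct_sum \<C> S [P', P]" using ex_biproduct n m Proj_obj by blast
  then obtain i j p q where b: "biprod S P' P i j p q" using direct_sum2_iff by blast
  note b [simp] = biprod_simps[OF b]
  note [simp] = HomD[OF n(3)] HomD[OF n(4)] HomD[OF m(3)] HomD[OF m(4)]
  have "m \<boxplus> n = (v' \<cdot> p \<boxplus> v \<cdot> q) \<cdot> (i \<cdot> u' \<boxplus> j \<cdot> u)" by (simp add: m n)
  moreover have "S \<in> Proj \<C>" using Proj_sum S n m by blast
  ultimately show ?thesis using null_through[of S "i \<cdot> u' \<boxplus> j \<cdot> u" A "v' \<cdot> p \<boxplus> v \<cdot> q" B]
    by (simp add: Hom_def)
qed

lemma null_neg:
  assumes "n \<in> null_maps \<C> A B" shows "neg n \<in> null_maps \<C> A B"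
proof -
  note [simp] = HomD[OF null_hom[OF assms]]
  have "neg (Id B) \<cdot> n = neg n" by simp
  then show ?thesis using null_comp_left[OF assms, of "neg (Id B)" B] by (simp add: Hom_def)
qed

lemma null_zero:
  assumes "A \<in> Obj \<C>" "B \<in> Obj \<C>" shows "Zr A B \<in> null_maps \<C> A B"
proof -
  obtain Z where Z: "zero_object \<C> Z" using ex_zero by blast
  have "Zr Z B \<cdot> Zr A Z \<in> null_maps \<C> A B"
    by (rule null_through[OF Proj_zero[OF Z]]) (use assms Z in \<open>auto simp: Hom_def zero_object_iff\<close>)
  then show ?thesis using assms Z by (simp add: zero_object_iff)
qed

lemma null_subgroup:
  assumes "A \<in> Obj \<C>" "B \<in> Obj \<C>" shows "subgroup (null_maps \<C> A B) (Hom_group \<C> A B)"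
proof -
  interpret G: comm_group "Hom_group \<C> A B" by (rule hom_comm_group[OF assms])
  show ?thesis
  proof (rule G.subgroupI)
    show "null_maps \<C> A B \<subseteq> carrier (Hom_group \<C> A B)" using null_hom by auto
    show "null_maps \<C> A B \<noteq> {}" using null_zero[OF assms] by blast
    show "inv\<^bsub>Hom_group \<C> A B\<^esub> a \<in> null_maps \<C> A B" if "a \<in> null_maps \<C> A B" for a
      using null_neg[OF that] HomD[OF null_hom[OF that]] by (simp add: neg_def)
    show "a \<otimes>\<^bsub>Hom_group \<C> A B\<^esub> b \<in> null_maps \<C> A B" if "a \<in> null_maps \<C> A B" "b \<in> null_maps \<C> A B" for a b
      using null_add[OF that] by simp
  qed
qed

abbreviation cls where "cls f \<equiv> stable_class \<C> f"

lemma cls_Hom: "f \<in> Hom \<C> A B \<Longrightarrow> cls f = null_maps \<C> A B #>\<^bsub>Hom_group \<C> A B\<^esub> f"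
  by (auto simp: stable_class_def Hom_def)

lemma cls_subset:
  assumes "f \<in> Hom \<C> A B" shows "cls f \<subseteq> Hom \<C> A B"
proof -
  interpret G: comm_group "Hom_group \<C> A B" by (rule hom_comm_group) (use HomD[OF assms] in auto)
  show ?thesis using G.r_coset_subset_G[of "null_maps \<C> A B" f] null_hom assms by (auto simp: cls_Hom)
qed

lemma cls_self:
  assumes "f \<in> Hom \<C> A B" shows "f \<in> cls f"
proof -
  interpret G: comm_group "Hom_group \<C> A B" by (rule hom_comm_group) (use HomD[OF assms] in auto)
  show ?thesis unfolding cls_Hom[OF assms]
    by (rule G.rcos_self) (use assms HomD[OF assms] null_subgroup in auto)
qed

lemma cls_eq_iff:
  assumes f: "f \<in> Hom \<C> A B" and g: "g \<in> Hom \<C> A B"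
  shows "cls f = cls g \<longleftrightarrow> f \<boxminus> g \<in> null_maps \<C> A B"
proof -
  interpret G: comm_group "Hom_group \<C> A B" by (rule hom_comm_group) (use HomD[OF f] in auto)
  interpret N: subgroup "null_maps \<C> A B" "Hom_group \<C> A B" using null_subgroup HomD[OF f] by blast
  have "f \<in> cls g \<longleftrightarrow> f \<boxminus> g \<in> null_maps \<C> A B"
    using N.rcos_module[OF G.is_group, of g f] f g HomD[OF g] by (simp add: cls_Hom neg_def)
  moreover have "cls f = cls g \<longleftrightarrow> f \<in> cls g"
    using G.repr_independence[of f "null_maps \<C> A B" g] cls_self[OF f] f g N.subgroup_axioms by (auto simp: cls_Hom)
  ultimately show ?thesis by simp
qed

lemma cls_eqI:
  assumes "f = g \<boxplus> n" "g \<in> Hom \<C> A B" "n \<in> null_maps \<C> A B"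
  shows "cls f = cls g"
proof -
  have "f \<in> Hom \<C> A B" using assms null_hom[OF assms(3)] by (simp add: Hom_def)
  moreover have "f \<boxminus> g = n" using minus_eq_iff assms calculation null_hom by blast
  ultimately show ?thesis using cls_eq_iff assms by simp
qed

lemma cls_eqD:
  assumes "cls f = cls g" "f \<in> Hom \<C> A B" "g \<in> Hom \<C> A B"
  shows "\<exists>n \<in> null_maps \<C> A B. f = g \<boxplus> n"
  using assms cls_eq_iff minus_eq_iff[OF assms(2,3)] null_hom by (metis HomI)

lemma cls_zero_iff:
  assumes "f \<in> Hom \<C> A B" shows "cls f = cls (Zr A B) \<longleftrightarrow> f \<in> null_maps \<C> A B"
proof -
  note [simp] = HomD[OF assms]
  have "Zr A B \<in> Hom \<C> A B" by (simp add: Hom_def)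
  then show ?thesis using cls_eq_iff[OF assms, of "Zr A B"] by simp
qed

lemma cls_null: "n \<in> null_maps \<C> A B \<Longrightarrow> cls n = cls (Zr A B)"
  using cls_zero_iff null_hom by blast

lemma stable_rep:
  assumes "f \<in> Hom \<C> A B"
  shows "stable_rep (cls f) \<in> Hom \<C> A B" "cls (stable_rep (cls f)) = cls f"
proof -
  have "stable_rep (cls f) \<in> cls f" unfolding stable_rep_def using cls_self[OF assms] by (rule someI)
  then show 1: "stable_rep (cls f) \<in> Hom \<C> A B" using cls_subset[OF assms] by blast
  interpret G: comm_group "Hom_group \<C> A B" by (rule hom_comm_group) (use HomD[OF assms] in auto)
  have N: "subgroup (null_maps \<C> A B) (Hom_group \<C> A B)" using null_subgroup HomD[OF assms] by blast
  show "cls (stable_rep (cls f)) = cls f"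
    using \<open>stable_rep (cls f) \<in> cls f\<close> G.repr_independence[OF _ _ N, of "stable_rep (cls f)" f] assms 1
    by (simp add: cls_Hom)
qed

lemma cls_comp_cong:
  assumes "cls f = cls f'" "cls g = cls g'" "f \<in> Hom \<C> A B" "f' \<in> Hom \<C> A B" "g \<in> Hom \<C> B D" "g' \<in> Hom \<C> B D"
  shows "cls (g \<cdot> f) = cls (g' \<cdot> f')"
proof -
  obtain m where m: "m \<in> null_maps \<C> A B" "f = f' \<boxplus> m" using cls_eqD[OF assms(1,3,4)] by blast
  obtain n where n: "n \<in> null_maps \<C> B D" "g = g' \<boxplus> n" using cls_eqD[OF assms(2,5,6)] by blast
  have "g \<cdot> f = g \<cdot> f' \<boxplus> g \<cdot> m" unfolding m(2) using assms null_hom[OF m(1)] by (simp add: comp_add_right)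
  then have "cls (g \<cdot> f) = cls (g \<cdot> f')"
    by (rule cls_eqI[where A=A and B=D]) (use comp_hom assms null_comp_left[OF m(1)] in auto)
  moreover have "g \<cdot> f' = g' \<cdot> f' \<boxplus> n \<cdot> f'" unfolding n(2) using assms null_hom[OF n(1)] by (simp add: comp_add_left)
  then have "cls (g \<cdot> f') = cls (g' \<cdot> f')"
    by (rule cls_eqI[where A=A and B=D]) (use comp_hom assms null_comp_right[OF n(1)] in auto)
  ultimately show ?thesis by simp
qed

lemma add_hom: "f \<in> Hom \<C> A B \<Longrightarrow> g \<in> Hom \<C> A B \<Longrightarrow> f \<boxplus> g \<in> Hom \<C> A B"
  by (simp add: Hom_def)

lemma cls_add_cong:
  assumes "cls f = cls f'" "cls g = cls g'" "f \<in> Hom \<C> A B" "f' \<in> Hom \<C> A B" "g \<in> Hom \<C> A B" "g' \<in> Hom \<C> A B"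
  shows "cls (f \<boxplus> g) = cls (f' \<boxplus> g')"
proof -
  obtain m where m: "m \<in> null_maps \<C> A B" "f = f' \<boxplus> m" using cls_eqD[OF assms(1,3,4)] by blast
  obtain n where n: "n \<in> null_maps \<C> A B" "g = g' \<boxplus> n" using cls_eqD[OF assms(2,5,6)] by blast
  note [simp] = HomD[OF null_hom[OF m(1)]] HomD[OF null_hom[OF n(1)]] HomD[OF assms(4)] HomD[OF assms(6)]
  have "f \<boxplus> g = (f' \<boxplus> g') \<boxplus> (m \<boxplus> n)" unfolding m(2) n(2) using add_ac(3)[of m g' n]
    by (simp add: add_ac(2))
  then show ?thesis by (rule cls_eqI[where A=A and B=B]) (use add_hom assms null_add m n in auto)
qed

abbreviation "\<S> \<equiv> stable_cat \<C>"

lemma stable_sel [simp]: "Obj \<S> = Obj \<C>" "Arr \<S> = stable_class \<C> ` Arr \<C>"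
  "Ide \<S> A = cls (Id A)" "Zero \<S> A B = cls (Zr A B)"
  by (simp_all add: stable_cat_def)

lemma stable_Dom [simp]:
  assumes "f \<in> Arr \<C>" shows "Dom \<S> (cls f) = Dom \<C> f" "Cod \<S> (cls f) = Cod \<C> f"
  using HomD[OF stable_rep(1)[OF arr_Hom[OF assms]]] by (simp_all add: stable_cat_def)

lemma stable_Hom: "Hom \<S> A B = cls ` Hom \<C> A B"
  by (auto simp: Hom_def)

lemma stable_comp:
  assumes "f \<in> Hom \<C> A B" "g \<in> Hom \<C> B D" shows "Comp \<S> (cls g) (cls f) = cls (g \<cdot> f)"
  using cls_comp_cong[OF stable_rep(2)[OF assms(1)] stable_rep(2)[OF assms(2)] stable_rep(1)[OF assms(1)] assms(1) stable_rep(1)[OF assms(2)] assms(2)]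
  by (simp add: stable_cat_def)

lemma stable_add:
  assumes "f \<in> Hom \<C> A B" "g \<in> Hom \<C> A B" shows "Add \<S> (cls f) (cls g) = cls (f \<boxplus> g)"
  using cls_add_cong[OF stable_rep(2)[OF assms(1)] stable_rep(2)[OF assms(2)] stable_rep(1)[OF assms(1)] assms(1) stable_rep(1)[OF assms(2)] assms(2)]
  by (simp add: stable_cat_def)

lemma stable_comm_group:
  assumes AB: "A \<in> Obj \<C>" "B \<in> Obj \<C>"
  shows "comm_group (Hom_group \<S> A B)"
proof -
  interpret G: comm_group "Hom_group \<C> A B" by (rule hom_comm_group[OF AB])
  have s: "carrier (Hom_group \<S> A B) = cls ` Hom \<C> A B" "monoid.mult (Hom_group \<S> A B) = Add \<S>"
   "one (Hom_group \<S> A B) = cls (Zr A B)" by (auto simp: Hom_group_def stable_Hom)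
  have z: "Zr A B \<in> Hom \<C> A B" using AB by (simp add: Hom_def)
  show "comm_group (Hom_group \<S> A B)"
  proof (rule comm_groupI, unfold s)
    fix X Y assume "X \<in> cls ` Hom \<C> A B" "Y \<in> cls ` Hom \<C> A B"
    then obtain x y where xy: "x \<in> Hom \<C> A B" "X = cls x" "y \<in> Hom \<C> A B" "Y = cls y" by auto
    show "Add \<S> X Y \<in> cls ` Hom \<C> A B" using xy stable_add[OF xy(1,3)] add_hom[OF xy(1,3)] by simp
    show "Add \<S> X Y = Add \<S> Y X" using xy stable_add[OF xy(1,3)] stable_add[OF xy(3,1)] G.m_comm[of x y] by simp
    fix U assume "U \<in> cls ` Hom \<C> A B" then obtain u where u: "u \<in> Hom \<C> A B" "U = cls u" by auto
    show "Add \<S> (Add \<S> X Y) U = Add \<S> X (Add \<S> Y U)"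
      using xy u G.m_assoc[of x y u] add_hom[OF xy(1,3)] add_hom[OF xy(3) u(1)] by (simp add: stable_add)
  next
    show "cls (Zr A B) \<in> cls ` Hom \<C> A B" using z by simp
    fix X assume "X \<in> cls ` Hom \<C> A B"
    then obtain x where x: "x \<in> Hom \<C> A B" "X = cls x" by auto
    show "Add \<S> (cls (Zr A B)) X = X" using stable_add[OF z x(1)] x HomD[OF x(1)] by simp
    show "\<exists>Y \<in> cls ` Hom \<C> A B. Add \<S> Y X = cls (Zr A B)"
      using stable_add[of "neg x" A B x] x HomD[OF x(1)] by (intro bexI[of _ "cls (neg x)"]) (auto simp: Hom_def)
  qed
qed

text \<open>The operations of the stable category are defined by choosing representatives; they are independent of
  the choice (\<open>stable_comp\<close>, \<open>stable_add\<close>), so each axiom descends from \<open>\<C>\<close>.\<close>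

lemma stable_preadditive: "preadditive_category \<S>"
proof (rule preadditive_category.intro)
  fix F A B G D assume F: "F \<in> Hom \<S> A B" and G: "G \<in> Hom \<S> B D"
  then obtain f g where fg: "f \<in> Hom \<C> A B" "F = cls f" "g \<in> Hom \<C> B D" "G = cls g" by (auto simp: stable_Hom)
  show "Comp \<S> G F \<in> Hom \<S> A D" using fg comp_hom[OF fg(1,3)] by (simp add: stable_comp stable_Hom)
  {
    fix H E assume "H \<in> Hom \<S> D E"
    then obtain h where h: "h \<in> Hom \<C> D E" "H = cls h" by (auto simp: stable_Hom)
    show "Comp \<S> (Comp \<S> H G) F = Comp \<S> H (Comp \<S> G F)"
      using fg h comp_hom[OF fg(1,3)] comp_hom[OF fg(3) h(1)] comp_assoc[OF fg(1,3) h(1)] by (simp add: stable_comp)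
  }
  {
    fix F' assume "F' \<in> Hom \<S> A B"
    then obtain f' where f': "f' \<in> Hom \<C> A B" "F' = cls f'" by (auto simp: stable_Hom)
    show "Comp \<S> G (Add \<S> F F') = Add \<S> (Comp \<S> G F) (Comp \<S> G F')"
      using fg f' comp_hom[OF fg(1,3)] comp_hom[OF f'(1) fg(3)] add_hom[OF fg(1) f'(1)]
      by (simp add: stable_comp stable_add comp_add_right)
  }
  {
    fix G' assume "G' \<in> Hom \<S> B D"
    then obtain g' where g': "g' \<in> Hom \<C> B D" "G' = cls g'" by (auto simp: stable_Hom)
    show "Comp \<S> (Add \<S> G G') F = Add \<S> (Comp \<S> G F) (Comp \<S> G' F)"
      using fg g' comp_hom[OF fg(1,3)] comp_hom[OF fg(1) g'(1)] add_hom[OF fg(3) g'(1)]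
      by (simp add: stable_comp stable_add comp_add_left)
  }
next
  fix F A B assume F: "F \<in> Hom \<S> A B"
  then obtain f where fg: "f \<in> Hom \<C> A B" "F = cls f" by (auto simp: stable_Hom)
  note [simp] = HomD[OF fg(1)]
  show "Comp \<S> F (Ide \<S> A) = F" using stable_comp[of "Id A" A A f B] fg by (simp add: ide_hom)
  show "Comp \<S> (Ide \<S> B) F = F" using stable_comp[of f A B "Id B" B] fg by (simp add: ide_hom)
next
  fix A B assume "A \<in> Obj \<S>" "B \<in> Obj \<S>"
  then show "comm_group (Hom_group \<S> A B)" using stable_comm_group by simp
next
  fix F assume "F \<in> Arr \<S>"
  then show "Dom \<S> F \<in> Obj \<S>" "Cod \<S> F \<in> Obj \<S>" by auto
next
  fix A assume "A \<in> Obj \<S>"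
  then show "Ide \<S> A \<in> Hom \<S> A A" using ide_hom by (simp add: stable_Hom)
qed

end

sublocale exact_category \<subseteq> stable: preadditive_category "stable_cat \<C>"
  by (rule stable_preadditive)

context exact_category begin

lemma stable_biprod:
  assumes "biprod S A B i j p q" shows "stable.biprod S A B (cls i) (cls j) (cls p) (cls q)"
proof -
  note b = assms[unfolded biprod_def]
  have "Add \<S> (Comp \<S> (cls i) (cls p)) (Comp \<S> (cls j) (cls q)) = cls (Id S)"
    using b comp_hom[of p S A i S] comp_hom[of q S B j S] stable_comp[of p S A i S] stable_comp[of q S B j S]
      stable_add[of "i \<cdot> p" S S "j \<cdot> q"] by simp
  then show ?thesis using b stable_comp[of i A S p A] stable_comp[of j B S p A]
     stable_comp[of i A S q B] stable_comp[of j B S q B] unfolding stable.biprod_def by (simp add: stable_Hom)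
qed

lemma stable_direct_sum: "direct_sum \<C> S [A, B] \<Longrightarrow> direct_sum \<S> S [A, B]"
  unfolding direct_sum2_iff stable.direct_sum2_iff using stable_biprod by blast

text \<open>The identity of \<open>X\<close> is null if and only if \<open>X\<close> is a retract of a projective.\<close>

lemma stable_zero_iff: "zero_object \<S> X \<longleftrightarrow> X \<in> Proj \<C>"
proof
  assume "zero_object \<S> X"
  then have X: "X \<in> Obj \<C>" "cls (Id X) = cls (Zr X X)" by (auto simp: stable.zero_object_iff)
  then have "Id X \<in> null_maps \<C> X X" using cls_zero_iff[of "Id X" X X] ide_hom by simp
  then obtain u v P where "Id X = v \<cdot> u" "P \<in> Proj \<C>" "u \<in> Hom \<C> X P" "v \<in> Hom \<C> P X"
    unfolding null_maps_def by blast
  then show "X \<in> Proj \<C>" using Proj_retract by metis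
next
  assume X: "X \<in> Proj \<C>"
  then have "Id X \<in> null_maps \<C> X X" using null_to_Proj ide_hom Proj_obj by blast
  then show "zero_object \<S> X" using cls_null X Proj_obj by (simp add: stable.zero_object_iff)
qed

lemma stable_zero_obj: "zero_object \<C> Z \<Longrightarrow> zero_object \<S> Z"
  using Proj_zero stable_zero_iff by blast

lemma stable_additive: "additive_category \<S>"
proof unfold_locales
  show "\<exists>Z. zero_object \<S> Z" using ex_zero stable_zero_obj by blast
  show "\<exists>S. direct_sum \<S> S [A, B]" if "A \<in> Obj \<S>" "B \<in> Obj \<S>" for A B
    using ex_biproduct[of A B] that stable_direct_sum by auto
qed

end

sublocale exact_category \<subseteq> stable: additive_category "stable_cat \<C>"
  by (rule stable_additive)

context exact_category begin

lemma stable_isoI: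
  assumes "f \<in> Hom \<C> X Y" "g \<in> Hom \<C> Y X" "cls (g \<cdot> f) = cls (Id X)" "cls (f \<cdot> g) = cls (Id Y)"
  shows "stable.isomorphic X Y"
  by (rule stable.isoI[of "cls f" _ _ "cls g"]) (use assms in \<open>auto simp: stable_comp stable_Hom\<close>)

lemma stable_isoE:
  assumes "stable.isomorphic X Y"
  obtains f g where "f \<in> Hom \<C> X Y" "g \<in> Hom \<C> Y X" "cls (g \<cdot> f) = cls (Id X)" "cls (f \<cdot> g) = cls (Id Y)"
  using assms unfolding stable.isomorphic_def stable_Hom by (auto simp: stable_comp)

lemma iso_stable_iso:
  assumes "isomorphic X Y" shows "stable.isomorphic X Y"
  using assms stable_isoI unfolding isomorphic_def by metis

end

section \<open>Syzygies on the stable category\<close>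

context exact_category begin

text \<open>A morphism \<open>(h, g, f)\<close> from the conflation \<open>(i, p)\<close> to \<open>(i', p')\<close>.  When the middle terms are projective, \<open>h\<close> represents
  \<open>\<Omega> f\<close>, so this relation replaces the syzygy functor on arrows.\<close>

definition lift where
  "lift i p i' p' f g h \<longleftrightarrow> (i, p) \<in> Conf \<C> \<and> (i', p') \<in> Conf \<C> \<and> f \<in> Hom \<C> (Cod \<C> p) (Cod \<C> p') \<and>
     g \<in> Hom \<C> (Dom \<C> p) (Dom \<C> p') \<and> h \<in> Hom \<C> (Dom \<C> i) (Dom \<C> i') \<and> p' \<cdot> g = f \<cdot> p \<and> i' \<cdot> h = g \<cdot> i"

lemma liftD:
  assumes "lift i p i' p' f g h"
  shows "(i, p) \<in> Conf \<C>" "(i', p') \<in> Conf \<C>" "f \<in> Hom \<C> (Cod \<C> p) (Cod \<C> p')"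
     "g \<in> Hom \<C> (Dom \<C> p) (Dom \<C> p')" "h \<in> Hom \<C> (Dom \<C> i) (Dom \<C> i')" "p' \<cdot> g = f \<cdot> p" "i' \<cdot> h = g \<cdot> i"
  using assms by (auto simp: lift_def)

lemma lift_arr:
  assumes "lift i p i' p' f g h"
  shows "i \<in> Arr \<C>" "p \<in> Arr \<C>" "Cod \<C> i = Dom \<C> p" "p \<cdot> i = Zr (Dom \<C> i) (Cod \<C> p)"
    "i' \<in> Arr \<C>" "p' \<in> Arr \<C>" "Cod \<C> i' = Dom \<C> p'" "p' \<cdot> i' = Zr (Dom \<C> i') (Cod \<C> p')"
    "f \<in> Arr \<C>" "Dom \<C> f = Cod \<C> p" "Cod \<C> f = Cod \<C> p'"
    "g \<in> Arr \<C>" "Dom \<C> g = Dom \<C> p" "Cod \<C> g = Dom \<C> p'"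
    "h \<in> Arr \<C>" "Dom \<C> h = Dom \<C> i" "Cod \<C> h = Dom \<C> i'"
  using conf_arr liftD(1,2)[OF assms] liftD(3-5)[OF assms, THEN HomD(1)]
    liftD(3-5)[OF assms, THEN HomD(2)] liftD(3-5)[OF assms, THEN HomD(3)] by auto

lemma lift_ex:
  assumes c: "(i, p) \<in> Conf \<C>" and c': "(i', p') \<in> Conf \<C>" and P: "Dom \<C> p \<in> Proj \<C>" and f: "f \<in> Hom \<C> (Cod \<C> p) (Cod \<C> p')"
  shows "\<exists>g h. lift i p i' p' f g h"
proof -
  note [simp] = conf_arr[OF c] conf_arr[OF c'] HomD(1-3)[OF f]
  obtain g where g: "g \<in> Hom \<C> (Dom \<C> p) (Dom \<C> p')" "p' \<cdot> g = f \<cdot> p"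
    using Proj_lift[OF P c', of "f \<cdot> p"] by (auto simp: Hom_def)
  note [simp] = HomD(1-3)[OF g(1)]
  have "p' \<cdot> (g \<cdot> i) = Zr (Dom \<C> i) (Cod \<C> p')" by (simp add: reassoc[OF g(2)])
  then obtain h where "h \<in> Hom \<C> (Dom \<C> i) (Dom \<C> i')" "i' \<cdot> h = g \<cdot> i"
    using conf_lift[OF c', of "g \<cdot> i" "Dom \<C> i"] by (auto simp: Hom_def)
  then show ?thesis using c c' f g unfolding lift_def by blast
qed

lemma lift_comp:
  assumes 1: "lift i p i' p' f g h" and 2: "lift i' p' i'' p'' f' g' h'"
  shows "lift i p i'' p'' (f' \<cdot> f) (g' \<cdot> g) (h' \<cdot> h)"
proof -
  note [simp] = lift_arr[OF 1] lift_arr[OF 2]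
  show ?thesis
    using liftD(1)[OF 1] liftD(2)[OF 2]
    by (simp add: lift_def Hom_def reassoc[OF liftD(6)[OF 2]] reassoc[OF liftD(7)[OF 2]] liftD(6,7)[OF 1])
qed

lemma lift_add:
  assumes 1: "lift i p i' p' f g h" and 2: "lift i p i' p' f' g' h'"
  shows "lift i p i' p' (f \<boxplus> f') (g \<boxplus> g') (h \<boxplus> h')"
proof -
  note [simp] = lift_arr[OF 1] lift_arr[OF 2]
  show ?thesis
    using liftD(1,2)[OF 1] by (simp add: lift_def Hom_def liftD(6,7)[OF 1] liftD(6,7)[OF 2])
qed

lemma lift_neg:
  assumes 1: "lift i p i' p' f g h"
  shows "lift i p i' p' (neg f) (neg g) (neg h)"
proof -
  note [simp] = lift_arr[OF 1]
  show ?thesis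
    using liftD(1,2)[OF 1] by (simp add: lift_def Hom_def liftD(6,7)[OF 1])
qed

lemma lift_ide:
  assumes c: "(i, p) \<in> Conf \<C>" shows "lift i p i p (Id (Cod \<C> p)) (Id (Dom \<C> p)) (Id (Dom \<C> i))"
  using conf_arr[OF c] c by (simp add: lift_def Hom_def)

text \<open>If \<open>f\<close> factors through a projective, it factors through \<open>p'\<close>, say as \<open>p' \<cdot> w \<cdot> u\<close>, and the
  chain map \<open>(h, g, f)\<close> is null-homotopic: \<open>g - w \<cdot> u \<cdot> p\<close> lands in the kernel of \<open>p'\<close>, and the arrow \<open>s\<close> to
  that kernel is the homotopy.\<close>

lemma lift_null:
  assumes l: "lift i p i' p' f g h" and f: "f \<in> null_maps \<C> (Cod \<C> p) (Cod \<C> p')"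
  shows "\<exists>s \<in> Hom \<C> (Dom \<C> p) (Dom \<C> i'). h = s \<cdot> i"
proof -
  note [simp] = lift_arr[OF l]
  obtain u v Q where n: "f = v \<cdot> u" "Q \<in> Proj \<C>" "u \<in> Hom \<C> (Cod \<C> p) Q" "v \<in> Hom \<C> Q (Cod \<C> p')"
    using f unfolding null_maps_def by blast
  obtain w where w: "w \<in> Hom \<C> Q (Dom \<C> p')" "p' \<cdot> w = v" using Proj_lift[OF n(2) liftD(2)[OF l] n(4)] by blast
  note [simp] = HomD(1-3)[OF w(1)] HomD(1-3)[OF n(3)] HomD(1-3)[OF n(4)]
  have "p' \<cdot> (g \<boxminus> w \<cdot> (u \<cdot> p)) = Zr (Dom \<C> p) (Cod \<C> p')"
    by (simp add: liftD(6)[OF l] reassoc[OF w(2)] n(1))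
  then obtain s where s: "s \<in> Hom \<C> (Dom \<C> p) (Dom \<C> i')" "i' \<cdot> s = g \<boxminus> w \<cdot> (u \<cdot> p)"
    using conf_lift[OF liftD(2)[OF l], of "g \<boxminus> w \<cdot> (u \<cdot> p)" "Dom \<C> p"] by (auto simp: Hom_def)
  note [simp] = HomD(1-3)[OF s(1)]
  have "i' \<cdot> h = i' \<cdot> (s \<cdot> i)"
    using HomD(4)[OF liftD(5)[OF l]] HomD(5)[OF n(3)] by (simp add: reassoc[OF s(2)] liftD(7)[OF l])
  then have "h = s \<cdot> i" by (rule conf_mono[OF liftD(2)[OF l] liftD(5)[OF l], rotated]) (simp add: Hom_def)
  then show ?thesis using s by blast
qed

lemma lift_unique:
  assumes 1: "lift i p i' p' f g h" and 2: "lift i p i' p' f' g' h'" and e: "cls f = cls f'"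
  shows "\<exists>s \<in> Hom \<C> (Dom \<C> p) (Dom \<C> i'). h = h' \<boxplus> s \<cdot> i"
proof -
  have "f \<boxminus> f' \<in> null_maps \<C> (Cod \<C> p) (Cod \<C> p')"
    using e cls_eq_iff[OF liftD(3)[OF 1] liftD(3)[OF 2]] by simp
  then obtain s where s: "s \<in> Hom \<C> (Dom \<C> p) (Dom \<C> i')" "h \<boxminus> h' = s \<cdot> i"
    using lift_null[OF lift_add[OF 1 lift_neg[OF 2]]] by blast
  then have "h = h' \<boxplus> s \<cdot> i"
    using minus_eq_iff[OF liftD(5)[OF 1] liftD(5)[OF 2], of "s \<cdot> i"] lift_arr[OF 1] by (simp add: Hom_def)
  then show ?thesis using s by blast
qed

lemma lift_cls:
  assumes 1: "lift i p i' p' f g h" and 2: "lift i p i' p' f' g' h'" and e: "cls f = cls f'" and P: "Dom \<C> p \<in> Proj \<C>"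
  shows "cls h = cls h'"
proof -
  obtain s where s: "s \<in> Hom \<C> (Dom \<C> p) (Dom \<C> i')" "h = h' \<boxplus> s \<cdot> i" using lift_unique[OF 1 2 e] by blast
  have "i \<in> Hom \<C> (Dom \<C> i) (Dom \<C> p)" using lift_arr[OF 1] by (simp add: Hom_def)
  then have "s \<cdot> i \<in> null_maps \<C> (Dom \<C> i) (Dom \<C> i')" using null_through[OF P _ s(1)] by simp
  then show ?thesis using cls_eqI[OF s(2) liftD(5)[OF 2]] by simp
qed

text \<open>This says that \<open>S\<close> is a retract of \<open>A \<oplus> B\<close> in the stable category.  Projectivity, vanishing of Ext and membership in the
  perpendicular class all pass to such retracts, which covers direct sums, direct summands and stable
  isomorphism at once.\<close>

definition stable_retract where
  "stable_retract S A B \<longleftrightarrow> (\<exists>a p b q. a \<in> Hom \<C> A S \<and> p \<in> Hom \<C> S A \<and> b \<in> Hom \<C> B S \<and> q \<in> Hom \<C> S B \<and>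
      cls (a \<cdot> p \<boxplus> b \<cdot> q) = cls (Id S))"

lemma stable_retract_obj: assumes "stable_retract S A B" shows "S \<in> Obj \<C>" "A \<in> Obj \<C>" "B \<in> Obj \<C>"
  using assms HomD(4,5) unfolding stable_retract_def by blast+

lemma stable_retract_single:
  assumes "a \<in> Hom \<C> A S" "p \<in> Hom \<C> S A" "cls (a \<cdot> p) = cls (Id S)"
  shows "stable_retract S A A"
  unfolding stable_retract_def
  using assms HomD(4,5)[OF assms(1)] HomD(1-3)[OF assms(1)] HomD(1-3)[OF assms(2)]
  by (intro exI[of _ a] exI[of _ p] exI[of _ "Zr A S"] exI[of _ "Zr S A"]) (simp add: Hom_def)

lemma stable_retract_isomorphic: "stable.isomorphic X Y \<Longrightarrow> stable_retract X Y Y"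
  using stable_retract_single stable_isoE by metis

lemma stable_retract_direct_sum:
  assumes "direct_sum \<S> S [A, B]" shows "stable_retract S A B"
proof -
  obtain I J P Q where "stable.biprod S A B I J P Q" using assms stable.direct_sum2_iff by blast
  then have b: "I \<in> Hom \<S> A S" "J \<in> Hom \<S> B S" "P \<in> Hom \<S> S A" "Q \<in> Hom \<S> S B"
    "Add \<S> (Comp \<S> I P) (Comp \<S> J Q) = cls (Id S)" unfolding stable.biprod_def by auto
  then obtain i j p q where h: "i \<in> Hom \<C> A S" "j \<in> Hom \<C> B S" "p \<in> Hom \<C> S A" "q \<in> Hom \<C> S B"
    and c: "I = cls i" "J = cls j" "P = cls p" "Q = cls q" by (auto simp: stable_Hom)
  have "cls (i \<cdot> p \<boxplus> j \<cdot> q) = cls (Id S)"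
    using b(5) unfolding c stable_comp[OF h(3,1)] stable_comp[OF h(4,2)]
      stable_add[OF comp_hom[OF h(3,1)] comp_hom[OF h(4,2)]] .
  then show ?thesis using h unfolding stable_retract_def by blast
qed

lemma stable_retract_summand:
  assumes "direct_summand \<S> N M" shows "stable_retract N M M"
proof -
  obtain N' where "direct_sum \<S> M [N, N']" using assms unfolding direct_summand_def by blast
  then obtain I J P Q where "stable.biprod M N N' I J P Q" using stable.direct_sum2_iff by blast
  then have b: "I \<in> Hom \<S> N M" "P \<in> Hom \<S> M N" "Comp \<S> P I = cls (Id N)" unfolding stable.biprod_def by auto
  then obtain i p where "i \<in> Hom \<C> N M" "p \<in> Hom \<C> M N" "I = cls i" "P = cls p" by (auto simp: stable_Hom)
  then show ?thesis using b(3) stable_retract_single[of p M N i] stable_comp[of i N M p N] by simp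
qed

lemma stable_retract_Proj:
  assumes "stable_retract S A B" "A \<in> Proj \<C>" "B \<in> Proj \<C>" shows "S \<in> Proj \<C>"
proof -
  obtain a p b q where h: "a \<in> Hom \<C> A S" "p \<in> Hom \<C> S A" "b \<in> Hom \<C> B S" "q \<in> Hom \<C> S B"
    "cls (a \<cdot> p \<boxplus> b \<cdot> q) = cls (Id S)" using assms(1) unfolding stable_retract_def by blast
  have "a \<cdot> p \<boxplus> b \<cdot> q \<in> null_maps \<C> S S"
    using null_add null_through assms h by simp
  then have "cls (Id S) = cls (Zr S S)" using cls_null h(5) by simp
  then show ?thesis using stable_zero_iff[of S] stable.zero_object_iff[of S] stable_retract_obj(1)[OF assms(1)] by simp
qed

text \<open>The syzygy functor applied to a stable retraction, with the homotopy made explicit: the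
  identity of the syzygy is the lifted composite plus a map \<open>s \<cdot> i\<close> through the projective term.\<close>

lemma lift_stable_retract:
  assumes w: "stable_retract S A B"
    and c: "(i, p) \<in> Conf \<C>" "Dom \<C> p \<in> Proj \<C>" "Cod \<C> p = S"
    and cA: "(iA, pA) \<in> Conf \<C>" "Dom \<C> pA \<in> Proj \<C>" "Cod \<C> pA = A"
    and cB: "(iB, pB) \<in> Conf \<C>" "Dom \<C> pB \<in> Proj \<C>" "Cod \<C> pB = B"
  shows "\<exists>a r b q s r0 q0. a \<in> Hom \<C> (Dom \<C> iA) (Dom \<C> i) \<and> r \<in> Hom \<C> (Dom \<C> i) (Dom \<C> iA) \<and>
      b \<in> Hom \<C> (Dom \<C> iB) (Dom \<C> i) \<and> q \<in> Hom \<C> (Dom \<C> i) (Dom \<C> iB) \<and> s \<in> Hom \<C> (Dom \<C> p) (Dom \<C> i) \<and>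
      r0 \<in> Hom \<C> (Dom \<C> p) (Dom \<C> pA) \<and> q0 \<in> Hom \<C> (Dom \<C> p) (Dom \<C> pB) \<and>
      iA \<cdot> r = r0 \<cdot> i \<and> iB \<cdot> q = q0 \<cdot> i \<and>
      Id (Dom \<C> i) = (a \<cdot> r \<boxplus> b \<cdot> q) \<boxplus> s \<cdot> i"
proof -
  obtain a r b q where h: "a \<in> Hom \<C> A S" "r \<in> Hom \<C> S A" "b \<in> Hom \<C> B S" "q \<in> Hom \<C> S B"
    "cls (a \<cdot> r \<boxplus> b \<cdot> q) = cls (Id S)" using w unfolding stable_retract_def by blast
  obtain a0 a1 where a: "lift iA pA i p a a0 a1" using lift_ex[OF cA(1) c(1) cA(2)] h cA c by blast
  obtain b0 b1 where b: "lift iB pB i p b b0 b1" using lift_ex[OF cB(1) c(1) cB(2)] h cB c by blast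
  obtain r0 r1 where r: "lift i p iA pA r r0 r1" using lift_ex[OF c(1) cA(1) c(2)] h cA c by blast
  obtain q0 q1 where q: "lift i p iB pB q q0 q1" using lift_ex[OF c(1) cB(1) c(2)] h cB c by blast
  have "lift i p i p (a \<cdot> r \<boxplus> b \<cdot> q) (a0 \<cdot> r0 \<boxplus> b0 \<cdot> q0) (a1 \<cdot> r1 \<boxplus> b1 \<cdot> q1)"
    by (rule lift_add[OF lift_comp[OF r a] lift_comp[OF q b]])
  then obtain s where "s \<in> Hom \<C> (Dom \<C> p) (Dom \<C> i)" "Id (Dom \<C> i) = (a1 \<cdot> r1 \<boxplus> b1 \<cdot> q1) \<boxplus> s \<cdot> i"
    using lift_unique[OF lift_ide[OF c(1)]] h(5) c(3) by metis
  then show ?thesis using liftD[OF a] liftD[OF b] liftD[OF r] liftD[OF q] by metis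
qed

lemma syzygyE:
  assumes "syzygy \<C> M K"
  obtains i p where "(i, p) \<in> Conf \<C>" "Dom \<C> p \<in> Proj \<C>" "Cod \<C> p = M" "Dom \<C> i = K"
  using assms unfolding syzygy_def by blast

lemma syzygy_obj: assumes "syzygy \<C> M K" shows "M \<in> Obj \<C>" "K \<in> Obj \<C>"
  using syzygyE[OF assms] conf_arr by (metis cod_obj, metis dom_obj)

lemma syzygy_stable_retract:
  assumes w: "stable_retract S A B" and "syzygy \<C> S S'" "syzygy \<C> A A'" "syzygy \<C> B B'"
  shows "stable_retract S' A' B'"
proof -
  obtain i p where c: "(i, p) \<in> Conf \<C>" "Dom \<C> p \<in> Proj \<C>" "Cod \<C> p = S" "Dom \<C> i = S'" using assms syzygyE by metis
  obtain iA pA where cA: "(iA, pA) \<in> Conf \<C>" "Dom \<C> pA \<in> Proj \<C>" "Cod \<C> pA = A" "Dom \<C> iA = A'" using assms syzygyE by metis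
  obtain iB pB where cB: "(iB, pB) \<in> Conf \<C>" "Dom \<C> pB \<in> Proj \<C>" "Cod \<C> pB = B" "Dom \<C> iB = B'" using assms syzygyE by metis
  obtain a r b q s where h: "a \<in> Hom \<C> A' S'" "r \<in> Hom \<C> S' A'" "b \<in> Hom \<C> B' S'" "q \<in> Hom \<C> S' B'" "s \<in> Hom \<C> (Dom \<C> p) S'"
      and e: "Id S' = (a \<cdot> r \<boxplus> b \<cdot> q) \<boxplus> s \<cdot> i"
    using lift_stable_retract[OF w c(1-3) cA(1-3) cB(1-3)] c(4) cA(4) cB(4) by blast
  have "i \<in> Hom \<C> S' (Dom \<C> p)" using conf_arr[OF c(1)] c(4) by (simp add: Hom_def)
  then have "s \<cdot> i \<in> null_maps \<C> S' S'" using null_through[OF c(2) _ h(5)] by simp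
  moreover have "a \<cdot> r \<boxplus> b \<cdot> q \<in> Hom \<C> S' S'" using h comp_hom add_hom by blast
  ultimately have "cls (Id S') = cls (a \<cdot> r \<boxplus> b \<cdot> q)" using cls_eqI[OF e] by simp
  then show ?thesis unfolding stable_retract_def using h by metis
qed

text \<open>For a conflation with projective middle term, this is \<open>Ext\<^sup>1(Cod p, Z) = 0\<close>.\<close>

definition extends :: "'m \<Rightarrow> 'm \<Rightarrow> 'o \<Rightarrow> bool" where
  "extends i p Z \<longleftrightarrow> (\<forall>f \<in> Hom \<C> (Dom \<C> i) Z. \<exists>g \<in> Hom \<C> (Dom \<C> p) Z. g \<cdot> i = f)"

definition ext1_vanishes :: "'o \<Rightarrow> 'o \<Rightarrow> bool" where
  "ext1_vanishes X Z \<longleftrightarrow> (\<forall>i p. (i, p) \<in> Conf \<C> \<longrightarrow> Dom \<C> p \<in> Proj \<C> \<longrightarrow> Cod \<C> p = X \<longrightarrow> extends i p Z)"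

text \<open>An arrow \<open>f\<close> out of the syzygy of \<open>S\<close> is the sum of \<open>f \<cdot> a \<cdot> r\<close>, \<open>f \<cdot> b \<cdot> q\<close>
  and \<open>f \<cdot> s \<cdot> i\<close>.  The first two extend because their factors \<open>f \<cdot> a\<close> and \<open>f \<cdot> b\<close> extend to \<open>Dom pA\<close> and \<open>Dom pB\<close>, and
  the last one visibly extends.\<close>

lemma extends_stable_retract:
  assumes w: "stable_retract S A B"
    and c: "(i, p) \<in> Conf \<C>" "Dom \<C> p \<in> Proj \<C>" "Cod \<C> p = S"
    and cA: "(iA, pA) \<in> Conf \<C>" "Dom \<C> pA \<in> Proj \<C>" "Cod \<C> pA = A"
    and cB: "(iB, pB) \<in> Conf \<C>" "Dom \<C> pB \<in> Proj \<C>" "Cod \<C> pB = B"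
    and "extends iA pA Z" "extends iB pB Z"
  shows "extends i p Z"
  unfolding extends_def
proof
  fix f assume f: "f \<in> Hom \<C> (Dom \<C> i) Z"
  obtain a r b q s r0 q0 where h: "a \<in> Hom \<C> (Dom \<C> iA) (Dom \<C> i)" "r \<in> Hom \<C> (Dom \<C> i) (Dom \<C> iA)"
      "b \<in> Hom \<C> (Dom \<C> iB) (Dom \<C> i)" "q \<in> Hom \<C> (Dom \<C> i) (Dom \<C> iB)" "s \<in> Hom \<C> (Dom \<C> p) (Dom \<C> i)"
      "r0 \<in> Hom \<C> (Dom \<C> p) (Dom \<C> pA)" "q0 \<in> Hom \<C> (Dom \<C> p) (Dom \<C> pB)"
      and e: "iA \<cdot> r = r0 \<cdot> i" "iB \<cdot> q = q0 \<cdot> i"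
      and id: "Id (Dom \<C> i) = (a \<cdot> r \<boxplus> b \<cdot> q) \<boxplus> s \<cdot> i"
    using lift_stable_retract[OF w c cA cB] by blast
  obtain gA where gA: "gA \<in> Hom \<C> (Dom \<C> pA) Z" "gA \<cdot> iA = f \<cdot> a"
    using assms(11) comp_hom[OF h(1) f] unfolding extends_def by blast
  obtain gB where gB: "gB \<in> Hom \<C> (Dom \<C> pB) Z" "gB \<cdot> iB = f \<cdot> b"
    using assms(12) comp_hom[OF h(3) f] unfolding extends_def by blast
  note [simp] = HomD(1-3)[OF f] HomD(1-3)[OF h(1)] HomD(1-3)[OF h(2)] HomD(1-3)[OF h(3)] HomD(1-3)[OF h(4)]
    HomD(1-3)[OF h(5)] HomD(1-3)[OF h(6)] HomD(1-3)[OF h(7)] HomD(1-3)[OF gA(1)] HomD(1-3)[OF gB(1)]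
    conf_arr(1-3)[OF c(1)] conf_arr(1-3)[OF cA(1)] conf_arr(1-3)[OF cB(1)]
  have A: "gA \<cdot> (r0 \<cdot> i) = f \<cdot> (a \<cdot> r)" using reassoc[OF gA(2), of r] by (simp add: e)
  have B: "gB \<cdot> (q0 \<cdot> i) = f \<cdot> (b \<cdot> q)" using reassoc[OF gB(2), of q] by (simp add: e)
  have "f = f \<cdot> Id (Dom \<C> i)" by simp
  also have "\<dots> = (gA \<cdot> r0 \<boxplus> gB \<cdot> q0 \<boxplus> f \<cdot> s) \<cdot> i" unfolding id by (simp add: A B)
  finally show "\<exists>g \<in> Hom \<C> (Dom \<C> p) Z. g \<cdot> i = f"
    by (intro bexI[of _ "gA \<cdot> r0 \<boxplus> gB \<cdot> q0 \<boxplus> f \<cdot> s"]) (simp_all add: Hom_def)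
qed

lemma stable_retract_refl: "X \<in> Obj \<C> \<Longrightarrow> stable_retract X X X"
  using stable_retract_isomorphic stable.iso_refl by simp

lemma ext1_vanishes_iff:
  assumes c: "(i, p) \<in> Conf \<C>" "Dom \<C> p \<in> Proj \<C>"
  shows "ext1_vanishes (Cod \<C> p) Z \<longleftrightarrow> extends i p Z"
proof -
  have "stable_retract (Cod \<C> p) (Cod \<C> p) (Cod \<C> p)" using stable_retract_refl conf_arr[OF c(1)] by simp
  then show ?thesis using extends_stable_retract[of "Cod \<C> p" "Cod \<C> p" "Cod \<C> p" _ _ i p i p] c unfolding ext1_vanishes_def by metis
qed

text \<open>The identity of a projective object is null, so the homotopy of \<open>lift_null\<close> splits the conflation.\<close>

lemma Id_factors_Proj:
  assumes c: "(i, p) \<in> Conf \<C>" and X: "Cod \<C> p \<in> Proj \<C>"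
  shows "\<exists>s \<in> Hom \<C> (Dom \<C> p) (Dom \<C> i). s \<cdot> i = Id (Dom \<C> i)"
  using lift_null[OF lift_ide[OF c]] null_to_Proj[OF X ide_hom] Proj_obj[OF X] by metis

lemma syzygy_Proj:
  assumes "syzygy \<C> X K" "X \<in> Proj \<C>" shows "K \<in> Proj \<C>"
proof -
  obtain i p where c: "(i, p) \<in> Conf \<C>" "Dom \<C> p \<in> Proj \<C>" "Cod \<C> p = X" "Dom \<C> i = K" using assms syzygyE by metis
  obtain s where "s \<in> Hom \<C> (Dom \<C> p) K" "s \<cdot> i = Id K" using Id_factors_Proj[OF c(1)] c assms(2) by blast
  moreover have "i \<in> Hom \<C> K (Dom \<C> p)" using conf_arr[OF c(1)] c by (simp add: Hom_def)
  ultimately show ?thesis using Proj_retract[OF c(2)] by blast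
qed

lemma ext1_vanishes_Proj:
  assumes "X \<in> Proj \<C>" shows "ext1_vanishes X Z"
  unfolding ext1_vanishes_def extends_def
proof (intro allI impI ballI)
  fix i p f assume c: "(i, p) \<in> Conf \<C>" "Dom \<C> p \<in> Proj \<C>" "Cod \<C> p = X" and f: "f \<in> Hom \<C> (Dom \<C> i) Z"
  obtain s where s: "s \<in> Hom \<C> (Dom \<C> p) (Dom \<C> i)" "s \<cdot> i = Id (Dom \<C> i)" using Id_factors_Proj[OF c(1)] c assms by blast
  have "(f \<cdot> s) \<cdot> i = f" using HomD(1-3)[OF f] HomD(1-3)[OF s(1)] s(2) conf_arr[OF c(1)] by simp
  then show "\<exists>g \<in> Hom \<C> (Dom \<C> p) Z. g \<cdot> i = f" using comp_hom[OF s(1) f] by blast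
qed

text \<open>An extension \<open>r\<close> of the identity of \<open>Dom i\<close> splits \<open>i\<close>; then \<open>1 - i \<cdot> r\<close> factors through \<open>p\<close> and gives a section
  of \<open>p\<close>.\<close>

lemma Proj_if_extends:
  assumes c: "(i, p) \<in> Conf \<C>" "Dom \<C> p \<in> Proj \<C>" and e: "extends i p (Dom \<C> i)"
  shows "Cod \<C> p \<in> Proj \<C>"
proof -
  note [simp] = conf_arr[OF c(1)]
  obtain r where r: "r \<in> Hom \<C> (Dom \<C> p) (Dom \<C> i)" "r \<cdot> i = Id (Dom \<C> i)"
    using e ide_hom[of "Dom \<C> i"] unfolding extends_def by auto
  note [simp] = HomD(1-3)[OF r(1)]
  have "(Id (Dom \<C> p) \<boxminus> i \<cdot> r) \<cdot> i = Zr (Dom \<C> i) (Dom \<C> p)" by (simp add: r(2))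
  then obtain t where t: "t \<in> Hom \<C> (Cod \<C> p) (Dom \<C> p)" "t \<cdot> p = Id (Dom \<C> p) \<boxminus> i \<cdot> r"
    using conf_extend[OF c(1), of "Id (Dom \<C> p) \<boxminus> i \<cdot> r" "Dom \<C> p"] by (auto simp: Hom_def)
  note [simp] = HomD(1-3)[OF t(1)]
  have "(p \<cdot> t) \<cdot> p = Id (Cod \<C> p) \<cdot> p"
    using reassoc[OF conf_arr(4)[OF c(1)], of r] by (simp add: t(2))
  then have "p \<cdot> t = Id (Cod \<C> p)"
    by (rule conf_epi[OF c(1), rotated 2]) (simp_all add: Hom_def)
  then show ?thesis using Proj_retract[OF c(2) t(1), of p] by (simp add: Hom_def)
qed

lemma syzygy_stable_iso:
  assumes "stable.isomorphic X Y" "syzygy \<C> X X'" "syzygy \<C> Y Y'" shows "stable.isomorphic X' Y'"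
proof -
  obtain i p where c: "(i, p) \<in> Conf \<C>" "Dom \<C> p \<in> Proj \<C>" "Cod \<C> p = X" "Dom \<C> i = X'" using assms syzygyE by metis
  obtain i' p' where c': "(i', p') \<in> Conf \<C>" "Dom \<C> p' \<in> Proj \<C>" "Cod \<C> p' = Y" "Dom \<C> i' = Y'" using assms syzygyE by metis
  obtain f g where fg: "f \<in> Hom \<C> X Y" "g \<in> Hom \<C> Y X" "cls (g \<cdot> f) = cls (Id X)" "cls (f \<cdot> g) = cls (Id Y)"
    using assms(1) stable_isoE by metis
  obtain f0 f1 where f: "lift i p i' p' f f0 f1" using lift_ex[OF c(1) c'(1) c(2)] fg c c' by blast
  obtain g0 g1 where g: "lift i' p' i p g g0 g1" using lift_ex[OF c'(1) c(1) c'(2)] fg c c' by blast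
  show ?thesis
    using stable_isoI[of f1 X' Y' g1] lift_cls[OF lift_comp[OF f g] lift_ide[OF c(1)] _ c(2)]
      lift_cls[OF lift_comp[OF g f] lift_ide[OF c'(1)] _ c'(2)] liftD(5)[OF f] liftD(5)[OF g] fg c c' by metis
qed

text \<open>Being additive, the syzygy functor carries the equations of a stable direct sum to those of a stable
  direct sum.\<close>

lemma syzygy_direct_sum:
  assumes "direct_sum \<S> S [A, B]" "syzygy \<C> S S'" "syzygy \<C> A A'" "syzygy \<C> B B'"
  shows "direct_sum \<S> S' [A', B']"
proof -
  obtain i p where c: "(i, p) \<in> Conf \<C>" "Dom \<C> p \<in> Proj \<C>" "Cod \<C> p = S" "Dom \<C> i = S'" using assms syzygyE by metis
  obtain iA pA where cA: "(iA, pA) \<in> Conf \<C>" "Dom \<C> pA \<in> Proj \<C>" "Cod \<C> pA = A" "Dom \<C> iA = A'" using assms syzygyE by metis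
  obtain iB pB where cB: "(iB, pB) \<in> Conf \<C>" "Dom \<C> pB \<in> Proj \<C>" "Cod \<C> pB = B" "Dom \<C> iB = B'" using assms syzygyE by metis
  obtain I J P Q where "stable.biprod S A B I J P Q" using assms(1) stable.direct_sum2_iff by blast
  then have SH: "I \<in> Hom \<S> A S" "J \<in> Hom \<S> B S" "P \<in> Hom \<S> S A" "Q \<in> Hom \<S> S B"
    and Se: "Comp \<S> P I = cls (Id A)" "Comp \<S> Q J = cls (Id B)" "Comp \<S> Q I = cls (Zr A B)" "Comp \<S> P J = cls (Zr B A)"
    "Add \<S> (Comp \<S> I P) (Comp \<S> J Q) = cls (Id S)" unfolding stable.biprod_def by auto
  from SH obtain a b r q where h: "a \<in> Hom \<C> A S" "b \<in> Hom \<C> B S" "r \<in> Hom \<C> S A" "q \<in> Hom \<C> S B"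
    and k: "I = cls a" "J = cls b" "P = cls r" "Q = cls q" by (auto simp: stable_Hom)
  have e: "cls (r \<cdot> a) = cls (Id A)" "cls (q \<cdot> b) = cls (Id B)" "cls (q \<cdot> a) = cls (Zr A B)" "cls (r \<cdot> b) = cls (Zr B A)"
    "cls (a \<cdot> r \<boxplus> b \<cdot> q) = cls (Id S)"
    using Se unfolding k stable_comp[OF h(1,3)] stable_comp[OF h(2,4)] stable_comp[OF h(1,4)] stable_comp[OF h(2,3)]
      stable_comp[OF h(3,1)] stable_comp[OF h(4,2)] stable_add[OF comp_hom[OF h(3,1)] comp_hom[OF h(4,2)]] by auto
  obtain a0 a1 where a: "lift iA pA i p a a0 a1" using lift_ex[OF cA(1) c(1) cA(2)] h cA c by blast
  obtain b0 b1 where b: "lift iB pB i p b b0 b1" using lift_ex[OF cB(1) c(1) cB(2)] h cB c by blast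
  obtain r0 r1 where r: "lift i p iA pA r r0 r1" using lift_ex[OF c(1) cA(1) c(2)] h cA c by blast
  obtain q0 q1 where q: "lift i p iB pB q q0 q1" using lift_ex[OF c(1) cB(1) c(2)] h cB c by blast
  have lz: "lift j r j' r' (Zr (Cod \<C> r) (Cod \<C> r')) (Zr (Dom \<C> r) (Dom \<C> r')) (Zr (Dom \<C> j) (Dom \<C> j'))"
    if "(j, r) \<in> Conf \<C>" "(j', r') \<in> Conf \<C>" for j r j' r'
    using that conf_arr[OF that(1)] conf_arr[OF that(2)] by (simp add: lift_def Hom_def)
  have h1: "a1 \<in> Hom \<C> A' S'" "b1 \<in> Hom \<C> B' S'" "r1 \<in> Hom \<C> S' A'" "q1 \<in> Hom \<C> S' B'"
    using liftD(5)[OF a] liftD(5)[OF b] liftD(5)[OF r] liftD(5)[OF q] c cA cB by auto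
  have e1: "cls (r1 \<cdot> a1) = cls (Id A')" "cls (q1 \<cdot> b1) = cls (Id B')" "cls (q1 \<cdot> a1) = cls (Zr A' B')" "cls (r1 \<cdot> b1) = cls (Zr B' A')"
    "cls (a1 \<cdot> r1 \<boxplus> b1 \<cdot> q1) = cls (Id S')"
    using lift_cls[OF lift_comp[OF a r] lift_ide[OF cA(1)] _ cA(2)] lift_cls[OF lift_comp[OF b q] lift_ide[OF cB(1)] _ cB(2)]
      lift_cls[OF lift_comp[OF a q] lz[OF cA(1) cB(1)] _ cA(2)] lift_cls[OF lift_comp[OF b r] lz[OF cB(1) cA(1)] _ cB(2)]
      lift_cls[OF lift_add[OF lift_comp[OF r a] lift_comp[OF q b]] lift_ide[OF c(1)] _ c(2)] e c cA cB by auto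
  have "stable.biprod S' A' B' (cls a1) (cls b1) (cls r1) (cls q1)"
    unfolding stable.biprod_def stable_comp[OF h1(1,3)] stable_comp[OF h1(2,4)] stable_comp[OF h1(1,4)] stable_comp[OF h1(2,3)]
      stable_comp[OF h1(3,1)] stable_comp[OF h1(4,2)] stable_add[OF comp_hom[OF h1(3,1)] comp_hom[OF h1(4,2)]]
    using e1 h1 by (simp add: stable_Hom)
  then show ?thesis by (rule stable.direct_sumI)
qed

text \<open>Given \<open>h\<close> on syzygies, \<open>i' \<cdot> h\<close> maps to the projective \<open>Dom p'\<close> and so extends along \<open>i\<close>; the
  arrow \<open>f\<close> is then induced on cokernels.\<close>

lemma lift_full:
  assumes c: "(i, p) \<in> Conf \<C>" and c': "(i', p') \<in> Conf \<C>" and e: "extends i p (Dom \<C> p')"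
    and h: "h \<in> Hom \<C> (Dom \<C> i) (Dom \<C> i')"
  shows "\<exists>f g. lift i p i' p' f g h"
proof -
  note [simp] = conf_arr[OF c] conf_arr[OF c'] HomD(1-3)[OF h]
  have "i' \<cdot> h \<in> Hom \<C> (Dom \<C> i) (Dom \<C> p')" by (simp add: Hom_def)
  then obtain g where g: "g \<in> Hom \<C> (Dom \<C> p) (Dom \<C> p')" "g \<cdot> i = i' \<cdot> h"
    using e unfolding extends_def by blast
  note [simp] = HomD(1-3)[OF g(1)]
  have "(p' \<cdot> g) \<cdot> i = Zr (Dom \<C> i) (Cod \<C> p')"
    by (simp add: g(2) reassoc[OF conf_arr(4)[OF c']])
  then obtain f where "f \<in> Hom \<C> (Cod \<C> p) (Cod \<C> p')" "f \<cdot> p = p' \<cdot> g"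
    using conf_extend[OF c, of "p' \<cdot> g" "Cod \<C> p'"] by (auto simp: Hom_def)
  then have "lift i p i' p' f g h" using c c' g h by (simp add: lift_def)
  then show ?thesis by blast
qed

text \<open>If \<open>h\<close> factors through a projective \<open>Q\<close>, its first factor extends along \<open>i\<close>; subtracting the resulting map from \<open>g\<close>
  leaves a map that vanishes on \<open>i\<close>, and this shows that \<open>f\<close> factors through \<open>p'\<close>.\<close>

lemma lift_faithful:
  assumes l: "lift i p i' p' f g h" and h: "h \<in> null_maps \<C> (Dom \<C> i) (Dom \<C> i')"
    and e: "\<And>Q. Q \<in> Proj \<C> \<Longrightarrow> extends i p Q" and P': "Dom \<C> p' \<in> Proj \<C>"
  shows "f \<in> null_maps \<C> (Cod \<C> p) (Cod \<C> p')"
proof -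
  note [simp] = lift_arr[OF l]
  obtain u v Q where n: "h = v \<cdot> u" "Q \<in> Proj \<C>" "u \<in> Hom \<C> (Dom \<C> i) Q" "v \<in> Hom \<C> Q (Dom \<C> i')"
    using h unfolding null_maps_def by blast
  obtain w where w: "w \<in> Hom \<C> (Dom \<C> p) Q" "w \<cdot> i = u" using e[OF n(2)] n(3) unfolding extends_def by blast
  note [simp] = HomD(1-3)[OF n(3)] HomD(1-3)[OF n(4)] HomD(1-3)[OF w(1)]
  have "(g \<boxminus> i' \<cdot> (v \<cdot> w)) \<cdot> i = Zr (Dom \<C> i) (Dom \<C> p')"
    using liftD(7)[OF l, symmetric] by (simp add: w(2) n(1))
  then obtain t where t: "t \<in> Hom \<C> (Cod \<C> p) (Dom \<C> p')" "t \<cdot> p = g \<boxminus> i' \<cdot> (v \<cdot> w)"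
    using conf_extend[OF liftD(1)[OF l], of "g \<boxminus> i' \<cdot> (v \<cdot> w)" "Dom \<C> p'"] by (auto simp: Hom_def)
  note [simp] = HomD(1-3)[OF t(1)]
  have "f \<cdot> p = (p' \<cdot> t) \<cdot> p"
    by (simp add: t(2) reassoc[OF lift_arr(8)[OF l]] liftD(6)[OF l])
  then have "f = p' \<cdot> t" by (rule conf_epi[OF liftD(1)[OF l] liftD(3)[OF l], rotated]) (simp add: Hom_def)
  then show ?thesis using null_through[OF P' t(1), of p'] by (simp add: Hom_def)
qed

text \<open>Full faithfulness on the class of objects with \<open>Ext\<^sup>1(-, P) = 0\<close> for projective \<open>P\<close> gives reflection of
  isomorphisms.\<close>

lemma syzygy_reflects_iso:
  assumes "syzygy \<C> X X'" "syzygy \<C> Y Y'" "stable.isomorphic X' Y'"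
    and X: "\<And>P. P \<in> Proj \<C> \<Longrightarrow> ext1_vanishes X P" and Y: "\<And>P. P \<in> Proj \<C> \<Longrightarrow> ext1_vanishes Y P"
  shows "stable.isomorphic X Y"
proof -
  obtain i p where c: "(i, p) \<in> Conf \<C>" "Dom \<C> p \<in> Proj \<C>" "Cod \<C> p = X" "Dom \<C> i = X'" using assms syzygyE by metis
  obtain i' p' where c': "(i', p') \<in> Conf \<C>" "Dom \<C> p' \<in> Proj \<C>" "Cod \<C> p' = Y" "Dom \<C> i' = Y'" using assms syzygyE by metis
  have e: "extends i p Q" "extends i' p' Q" if "Q \<in> Proj \<C>" for Q
    using X[OF that] Y[OF that] c c' unfolding ext1_vanishes_def by auto
  obtain h k where hk: "h \<in> Hom \<C> X' Y'" "k \<in> Hom \<C> Y' X'" "cls (k \<cdot> h) = cls (Id X')" "cls (h \<cdot> k) = cls (Id Y')"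
    using assms(3) stable_isoE by metis
  obtain f f0 where f: "lift i p i' p' f f0 h" using lift_full[OF c(1) c'(1) e(1)[OF c'(2)]] hk c c' by blast
  obtain g g0 where g: "lift i' p' i p g g0 k" using lift_full[OF c'(1) c(1) e(2)[OF c(2)]] hk c c' by blast
  note fg = liftD(3)[OF f] liftD(3)[OF g]
  have "cls (g \<cdot> f) = cls (Id X)"
  proof -
    have "k \<cdot> h \<boxminus> Id X' \<in> null_maps \<C> (Dom \<C> i) (Dom \<C> i)"
      using hk(3) cls_eq_iff[OF comp_hom[OF hk(1,2)] ide_hom] HomD(4)[OF hk(1)] c by simp
    then have "g \<cdot> f \<boxminus> Id X \<in> null_maps \<C> X X"
      using lift_faithful[OF lift_add[OF lift_comp[OF f g] lift_neg[OF lift_ide[OF c(1)]]] _ e(1) c(2)] c by simp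
    then show ?thesis using cls_eq_iff[OF comp_hom[OF fg] ide_hom] HomD(4)[OF fg(1)] c by simp
  qed
  moreover have "cls (f \<cdot> g) = cls (Id Y)"
  proof -
    have "h \<cdot> k \<boxminus> Id Y' \<in> null_maps \<C> (Dom \<C> i') (Dom \<C> i')"
      using hk(4) cls_eq_iff[OF comp_hom[OF hk(2,1)] ide_hom] HomD(4)[OF hk(2)] c' by simp
    then have "f \<cdot> g \<boxminus> Id Y \<in> null_maps \<C> Y Y"
      using lift_faithful[OF lift_add[OF lift_comp[OF g f] lift_neg[OF lift_ide[OF c'(1)]]] _ e(2) c'(2)] c' by simp
    then show ?thesis using cls_eq_iff[OF comp_hom[OF fg(2,1)] ide_hom] HomD(4)[OF fg(2)] c' by simp
  qed
  ultimately show ?thesis using stable_isoI[of f X Y g] fg c c' by simp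
qed

end

section \<open>Iterated syzygies and the perpendicular class\<close>

text \<open>The groups of cocycles to which this is applied may be infinite, so the argument compares cosets, not orders.\<close>

lemma (in normal) trivial_FactGroup_iff: "trivial_group (G Mod H) \<longleftrightarrow> carrier G \<subseteq> H"
proof
  assume "trivial_group (G Mod H)"
  then have eq: "carrier (G Mod H) = {H}" by (simp add: trivial_group_def)
  show "carrier G \<subseteq> H"
  proof
    fix x assume x: "x \<in> carrier G"
    then have "H #> x \<in> carrier (G Mod H)" by (auto simp: carrier_FactGroup)
    then have "H #> x = H" using eq by simp
    then show "x \<in> H" using rcos_self[OF x subgroup_axioms] by simp
  qed
next
  assume sub: "carrier G \<subseteq> H"
  have "H #> x = H" if "x \<in> carrier G" for x
    using coset_join2[OF that subgroup_axioms] sub that by blast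
  then have "carrier (G Mod H) = {H}" by (auto simp: carrier_FactGroup intro!: image_eqI[of _ _ \<one>])
  then show "trivial_group (G Mod H)" using factorgroup_is_group by (simp add: trivial_group_def)
qed

locale exact_category_enough_projectives = exact_category \<C> for \<C> :: "('o, 'm) exact_cat" (structure) +
  assumes enough: "enough_projectives \<C>"
begin

lemma syzygy_ex: "M \<in> Obj \<C> \<Longrightarrow> \<exists>K. syzygy \<C> M K"
  using enough unfolding enough_projectives_def adm_epic_def syzygy_def by blast

lemma nth_syzygy_obj: "nth_syzygy \<C> n M K \<Longrightarrow> M \<in> Obj \<C> \<and> K \<in> Obj \<C>"
  by (induction n arbitrary: K) (auto dest: syzygy_obj)

lemma nth_syzygy_ex: "M \<in> Obj \<C> \<Longrightarrow> \<exists>K. nth_syzygy \<C> n M K"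
proof (induction n)
  case (Suc n)
  then obtain L where L: "nth_syzygy \<C> n M L" by blast
  then show ?case using syzygy_ex[of L] nth_syzygy_obj by auto
next
  case 0
  then have "nth_syzygy \<C> 0 M M" by simp
  then show ?case by blast
qed

lemma nth_syzygy_add:
  "nth_syzygy \<C> (m + n) M K \<longleftrightarrow> (\<exists>L. nth_syzygy \<C> m M L \<and> nth_syzygy \<C> n L K)"
proof (induction n arbitrary: K)
  case 0
  then show ?case using nth_syzygy_obj by auto
next
  case (Suc n)
  then show ?case by auto
qed

lemma nth_syzygy_stable_retract:
  assumes "stable_retract S A B" "nth_syzygy \<C> n S S'" "nth_syzygy \<C> n A A'" "nth_syzygy \<C> n B B'"
  shows "stable_retract S' A' B'"
  using assms(2-)
proof (induction n arbitrary: S' A' B')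
  case 0
  then show ?case using assms(1) by simp
next
  case (Suc n)
  obtain S1 A1 B1 where 1: "nth_syzygy \<C> n S S1" "nth_syzygy \<C> n A A1" "nth_syzygy \<C> n B B1"
      "syzygy \<C> S1 S'" "syzygy \<C> A1 A'" "syzygy \<C> B1 B'" using Suc.prems by auto
  show ?case by (rule syzygy_stable_retract[OF Suc.IH[OF 1(1-3)] 1(4-6)])
qed

lemma nth_syzygy_stable_iso:
  assumes "stable.isomorphic X Y" "nth_syzygy \<C> n X X'" "nth_syzygy \<C> n Y Y'"
  shows "stable.isomorphic X' Y'"
  using assms(2-)
proof (induction n arbitrary: X' Y')
  case 0
  then show ?case using assms(1) by simp
next
  case (Suc n)
  obtain X1 Y1 where 1: "nth_syzygy \<C> n X X1" "nth_syzygy \<C> n Y Y1"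
      "syzygy \<C> X1 X'" "syzygy \<C> Y1 Y'" using Suc.prems by auto
  show ?case by (rule syzygy_stable_iso[OF Suc.IH[OF 1(1,2)] 1(3,4)])
qed

lemma nth_syzygy_unique:
  assumes "nth_syzygy \<C> n M K" "nth_syzygy \<C> n M K'" shows "stable.isomorphic K K'"
  using nth_syzygy_stable_iso[OF _ assms] stable.iso_refl nth_syzygy_obj[OF assms(1)] by simp

lemma nth_syzygy_Proj: "nth_syzygy \<C> n M K \<Longrightarrow> M \<in> Proj \<C> \<Longrightarrow> K \<in> Proj \<C>"
proof (induction n arbitrary: K)
  case (Suc n)
  then obtain L where "nth_syzygy \<C> n M L" "syzygy \<C> L K" by auto
  then show ?case using syzygy_Proj Suc by blast
qed simp

lemma nth_syzygy_Proj_mono: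
  assumes "nth_syzygy \<C> m M L" "L \<in> Proj \<C>" "m \<le> n" "nth_syzygy \<C> n M K"
  shows "K \<in> Proj \<C>"
proof -
  obtain L' where L': "nth_syzygy \<C> m M L'" "nth_syzygy \<C> (n - m) L' K"
    using nth_syzygy_add[of m "n - m" M K] assms by auto
  have "L' \<in> Proj \<C>" using stable_retract_Proj[OF stable_retract_isomorphic[OF nth_syzygy_unique[OF L'(1) assms(1)]]] assms(2) by blast
  then show ?thesis using nth_syzygy_Proj L' by blast
qed

lemma ext1_vanishes_stable_retract:
  assumes w: "stable_retract S A B" and "ext1_vanishes A Z" "ext1_vanishes B Z" shows "ext1_vanishes S Z"
proof -
  obtain iA pA where cA: "(iA, pA) \<in> Conf \<C>" "Dom \<C> pA \<in> Proj \<C>" "Cod \<C> pA = A"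
    using syzygy_ex[OF stable_retract_obj(2)[OF w]] syzygyE by metis
  obtain iB pB where cB: "(iB, pB) \<in> Conf \<C>" "Dom \<C> pB \<in> Proj \<C>" "Cod \<C> pB = B"
    using syzygy_ex[OF stable_retract_obj(3)[OF w]] syzygyE by metis
  show ?thesis
    using extends_stable_retract[OF w _ _ _ cA cB] assms(2,3) cA cB unfolding ext1_vanishes_def by blast
qed

lemma ext1_vanishes_stable_iso: "stable.isomorphic X Y \<Longrightarrow> ext1_vanishes X Z \<Longrightarrow> ext1_vanishes Y Z"
  using ext1_vanishes_stable_retract stable_retract_isomorphic stable.iso_sym by blast

lemma Proj_iff_ext1_vanishes:
  assumes "syzygy \<C> X K" shows "X \<in> Proj \<C> \<longleftrightarrow> ext1_vanishes X K"
  using ext1_vanishes_Proj Proj_if_extends assms unfolding ext1_vanishes_def syzygy_def by blast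

text \<open>Since \<open>Ext\<^sup>j\<^sup>+\<^sup>1(X, P) = Ext\<^sup>1(\<Omega>\<^sup>j X, P)\<close>, these are the objects without higher extensions by
  projectives.  Quantifying over all syzygies makes the class closed under \<open>\<Omega>\<close>.\<close>

definition perp :: "'o \<Rightarrow> bool" where
  "perp X \<longleftrightarrow> X \<in> Obj \<C> \<and> (\<forall>j K P. nth_syzygy \<C> j X K \<longrightarrow> P \<in> Proj \<C> \<longrightarrow> ext1_vanishes K P)"

lemma perp_nth_syzygy: "perp X \<Longrightarrow> nth_syzygy \<C> j X K \<Longrightarrow> perp K"
  unfolding perp_def using nth_syzygy_add nth_syzygy_obj by blast

lemma perp_ext1:
  assumes "perp X" "P \<in> Proj \<C>" shows "ext1_vanishes X P"
proof -
  have "nth_syzygy \<C> 0 X X" using assms(1) by (simp add: perp_def)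
  then show ?thesis using assms unfolding perp_def by blast
qed

lemma perp_stable_retract:
  assumes w: "stable_retract S A B" and A: "perp A" and B: "perp B" shows "perp S"
  unfolding perp_def
proof (intro conjI allI impI)
  show "S \<in> Obj \<C>" using stable_retract_obj[OF w] by simp
  fix j K P assume K: "nth_syzygy \<C> j S K" and P: "P \<in> Proj \<C>"
  obtain A' B' where AB: "nth_syzygy \<C> j A A'" "nth_syzygy \<C> j B B'"
    using nth_syzygy_ex stable_retract_obj[OF w] by blast
  then show "ext1_vanishes K P"
    using ext1_vanishes_stable_retract[OF nth_syzygy_stable_retract[OF w K AB]] A B P unfolding perp_def by blast
qed

lemma perp_Proj: "X \<in> Proj \<C> \<Longrightarrow> perp X"
  unfolding perp_def using nth_syzygy_Proj ext1_vanishes_Proj Proj_obj by blast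

text \<open>A projective syzygy \<open>K\<close> of \<open>L\<close> satisfies \<open>Ext\<^sup>1(L, K) = 0\<close>, so the conflation \<open>K \<rightarrow> P \<rightarrow> L\<close> splits and \<open>L\<close>
  is projective; this walks from \<open>\<Omega>\<^sup>n X\<close> back to \<open>X\<close>.\<close>

lemma perp_Proj_if_nth_syzygy_Proj:
  assumes "perp X" "nth_syzygy \<C> n X K" "K \<in> Proj \<C>" shows "X \<in> Proj \<C>"
  using assms(2,3)
proof (induction n arbitrary: K)
  case 0
  then show ?case by simp
next
  case (Suc n)
  then obtain L where L: "nth_syzygy \<C> n X L" "syzygy \<C> L K" by auto
  have "ext1_vanishes L K" using perp_ext1 perp_nth_syzygy assms(1) L(1) Suc.prems(2) by blast
  then show ?case using Suc.IH[OF L(1)] Proj_iff_ext1_vanishes[OF L(2)] by blast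
qed

section \<open>Projective and injective dimension\<close>

lemma proj_resolution_ex:
  assumes "A \<in> Obj \<C>" shows "\<exists>R. proj_resolution \<C> A R"
proof -
  \<comment> \<open>one step of the resolution: a chosen conflation with projective middle term that ends in \<open>X\<close>\<close>
  define nxt where "nxt X = (SOME c. c \<in> Conf \<C> \<and> Dom \<C> (snd c) \<in> Proj \<C> \<and> Cod \<C> (snd c) = X)" for X
  have nxt: "nxt X \<in> Conf \<C> \<and> Dom \<C> (snd (nxt X)) \<in> Proj \<C> \<and> Cod \<C> (snd (nxt X)) = X" if X: "X \<in> Obj \<C>" for X
  proof -
    obtain i p where "(i, p) \<in> Conf \<C>" "Dom \<C> p \<in> Proj \<C>" "Cod \<C> p = X" using syzygy_ex[OF X] syzygyE by metis
    then have "(i, p) \<in> Conf \<C> \<and> Dom \<C> (snd (i, p)) \<in> Proj \<C> \<and> Cod \<C> (snd (i, p)) = X" by simp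
    then show ?thesis unfolding nxt_def by (rule someI)
  qed
  define R where "R = rec_nat (nxt A) (\<lambda>_ c. nxt (Dom \<C> (fst c)))"
  have R: "R 0 = nxt A" "R (Suc n) = nxt (Dom \<C> (fst (R n)))" for n by (simp_all add: R_def)
  have c: "R n \<in> Conf \<C> \<and> Dom \<C> (snd (R n)) \<in> Proj \<C>" for n
  proof (induction n)
    case 0
    then show ?case using nxt[OF assms] R by simp
  next
    case (Suc n)
    then have "Dom \<C> (fst (R n)) \<in> Obj \<C>" using conf_arr(1)[of "fst (R n)" "snd (R n)"] by simp
    then show ?case using nxt R by simp
  qed
  then have "Dom \<C> (fst (R n)) \<in> Obj \<C>" for n using conf_arr(1)[of "fst (R n)" "snd (R n)"] by simp
  then have "proj_resolution \<C> A R" unfolding proj_resolution_def using c nxt R assms by simp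
  then show ?thesis by blast
qed

lemma resolution_syzygy:
  assumes "proj_resolution \<C> A R" shows "nth_syzygy \<C> n A (Cod \<C> (snd (R n)))"
proof (induction n)
  case 0
  have "(fst (R 0), snd (R 0)) \<in> Conf \<C>" "Cod \<C> (snd (R 0)) = A" using assms by (auto simp: proj_resolution_def)
  then show ?case using conf_arr(2)[of "fst (R 0)" "snd (R 0)"] by auto
next
  case (Suc n)
  have "syzygy \<C> (Cod \<C> (snd (R n))) (Cod \<C> (snd (R (Suc n))))"
    using assms unfolding syzygy_def case_prod_beta proj_resolution_def by (intro bexI[of _ "R n"]) auto
  then show ?case using Suc by auto
qed

text \<open>The differential is \<open>i \<cdot> q\<close> with \<open>q\<close> epic.  A cocycle is an arrow of the form \<open>h \<cdot> q\<close> with \<open>h\<close>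
  on the syzygy, and it is a coboundary exactly when \<open>h\<close> extends along \<open>i\<close>.\<close>

lemma resolution_cocycles_eq_coboundaries_iff:
  assumes R: "proj_resolution \<C> A R"
  shows "cocycles \<C> R (Suc n) Z \<subseteq> coboundaries \<C> R (Suc n) Z \<longleftrightarrow> extends (fst (R n)) (snd (R n)) Z"
proof -
  obtain i p where 0: "R n = (i, p)" by force
  obtain j q where 1: "R (Suc n) = (j, q)" by force
  obtain k r where 2: "R (Suc (Suc n)) = (k, r)" by force
  have c: "(i, p) \<in> Conf \<C>" "(j, q) \<in> Conf \<C>" "(k, r) \<in> Conf \<C>" and e: "Cod \<C> q = Dom \<C> i" "Cod \<C> r = Dom \<C> j"
    using R 0 1 2 unfolding proj_resolution_def by (metis, metis, metis, metis fst_conv snd_conv, metis fst_conv snd_conv)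
  note [simp] = conf_arr[OF c(1)] conf_arr[OF c(2)] conf_arr[OF c(3)] e
  have coc: "f \<in> cocycles \<C> R (Suc n) Z \<longleftrightarrow> (\<exists>h \<in> Hom \<C> (Dom \<C> i) Z. f = h \<cdot> q)" for f
  proof
    assume "f \<in> cocycles \<C> R (Suc n) Z"
    then have f: "f \<in> Hom \<C> (Dom \<C> q) Z" "f \<cdot> (j \<cdot> r) = Zr (Dom \<C> r) Z"
      by (auto simp: cocycles_def res_obj_def res_diff_def 1 2)
    note [simp] = HomD[OF f(1)]
    have "(f \<cdot> j) \<cdot> r = Zr (Dom \<C> j) Z \<cdot> r" using f(2) by simp
    then have "f \<cdot> j = Zr (Dom \<C> j) Z" by (rule conf_epi[OF c(3), rotated 2]) (simp_all add: Hom_def)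
    then show "\<exists>h \<in> Hom \<C> (Dom \<C> i) Z. f = h \<cdot> q" using conf_extend[OF c(2) f(1)] by auto
  next
    assume "\<exists>h \<in> Hom \<C> (Dom \<C> i) Z. f = h \<cdot> q"
    then obtain h where h: "h \<in> Hom \<C> (Dom \<C> i) Z" "f = h \<cdot> q" by blast
    note [simp] = HomD[OF h(1)]
    show "f \<in> cocycles \<C> R (Suc n) Z"
      by (simp add: h(2) cocycles_def res_obj_def res_diff_def 1 2 Hom_def reassoc[OF conf_arr(4)[OF c(2)]])
  qed
  have cob: "f \<in> coboundaries \<C> R (Suc n) Z \<longleftrightarrow> (\<exists>g \<in> Hom \<C> (Dom \<C> p) Z. f = (g \<cdot> i) \<cdot> q)" for f
  proof -
    have "(g \<cdot> i) \<cdot> q = g \<cdot> (i \<cdot> q)" if "g \<in> Hom \<C> (Dom \<C> p) Z" for g using HomD[OF that] by simp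
    then show ?thesis by (auto simp: res_obj_def res_diff_def 0 1 image_iff)
  qed
  have inj: "h = h'" if "h \<cdot> q = h' \<cdot> q" "h \<in> Hom \<C> (Dom \<C> i) Z" "h' \<in> Hom \<C> (Dom \<C> i) Z" for h h'
    using conf_epi[OF c(2), of h Z h'] that by simp
  have hi: "g \<cdot> i \<in> Hom \<C> (Dom \<C> i) Z" if "g \<in> Hom \<C> (Dom \<C> p) Z" for g
    using comp_hom[OF _ that, of i] by (simp add: Hom_def)
  show ?thesis
    unfolding 0 fst_conv snd_conv extends_def
  proof
    assume L: "cocycles \<C> R (Suc n) Z \<subseteq> coboundaries \<C> R (Suc n) Z"
    show "\<forall>f \<in> Hom \<C> (Dom \<C> i) Z. \<exists>g \<in> Hom \<C> (Dom \<C> p) Z. g \<cdot> i = f"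
    proof
      fix f assume f: "f \<in> Hom \<C> (Dom \<C> i) Z"
      then have "f \<cdot> q \<in> coboundaries \<C> R (Suc n) Z" using L coc by blast
      then obtain g where "g \<in> Hom \<C> (Dom \<C> p) Z" "f \<cdot> q = (g \<cdot> i) \<cdot> q" using cob by blast
      then show "\<exists>g \<in> Hom \<C> (Dom \<C> p) Z. g \<cdot> i = f" using inj f hi by metis
    qed
  next
    assume "\<forall>f \<in> Hom \<C> (Dom \<C> i) Z. \<exists>g \<in> Hom \<C> (Dom \<C> p) Z. g \<cdot> i = f"
    then show "cocycles \<C> R (Suc n) Z \<subseteq> coboundaries \<C> R (Suc n) Z" using coc cob by (metis subsetI)
  qed
qed

lemma coboundaries_subset_cocycles:
  assumes R: "proj_resolution \<C> A R" and Z: "Z \<in> Obj \<C>"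
  shows "coboundaries \<C> R (Suc n) Z \<subseteq> cocycles \<C> R (Suc n) Z"
proof -
  obtain i p where 0: "R n = (i, p)" by force
  obtain j q where 1: "R (Suc n) = (j, q)" by force
  obtain k r where 2: "R (Suc (Suc n)) = (k, r)" by force
  have c: "(i, p) \<in> Conf \<C>" "(j, q) \<in> Conf \<C>" "(k, r) \<in> Conf \<C>" and e: "Cod \<C> q = Dom \<C> i" "Cod \<C> r = Dom \<C> j"
    using R 0 1 2 unfolding proj_resolution_def by (metis, metis, metis, metis fst_conv snd_conv, metis fst_conv snd_conv)
  note [simp] = conf_arr[OF c(1)] conf_arr[OF c(2)] conf_arr[OF c(3)] e Z
  have "g \<cdot> (i \<cdot> q) \<in> cocycles \<C> R (Suc n) Z" if "g \<in> Hom \<C> (Dom \<C> p) Z" for g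
    using HomD[OF that]
    by (simp add: cocycles_def res_obj_def res_diff_def 1 2 Hom_def reassoc[OF conf_arr(4)[OF c(2)]])
  then show ?thesis by (auto simp: res_obj_def res_diff_def 0 1)
qed

text \<open>Dimension shifting, and independence of the resolution chosen in \<open>Ext_group\<close>: both sides depend
  on the stable isomorphism class of an \<open>n\<close>-th syzygy only.\<close>

lemma trivial_Ext_iff:
  assumes A: "A \<in> Obj \<C>" and Z: "Z \<in> Obj \<C>" and K: "nth_syzygy \<C> n A K"
  shows "trivial_group (Ext_group \<C> (Suc n) A Z) \<longleftrightarrow> ext1_vanishes K Z"
proof -
  define R where "R = (SOME R. proj_resolution \<C> A R)"
  have R: "proj_resolution \<C> A R" unfolding R_def using proj_resolution_ex[OF A] by (rule someI_ex)
  have d: "(fst (R m), snd (R m)) \<in> Conf \<C>" "Dom \<C> (snd (R m)) \<in> Proj \<C>" "Cod \<C> (snd (R (Suc m))) = Dom \<C> (fst (R m))" for m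
    using R by (auto simp: proj_resolution_def)
  let ?G = "Hom_group \<C> (res_obj \<C> R (Suc n)) Z"
  let ?c = "cocycles \<C> R (Suc n) Z" and ?b = "coboundaries \<C> R (Suc n) Z"
  let ?d = "res_diff \<C> R (Suc n)" and ?d' = "res_diff \<C> R n"
  have ob: "res_obj \<C> R m \<in> Obj \<C>" for m using conf_arr(2)[OF d(1)[of m]] by (simp add: res_obj_def)
  have df: "res_diff \<C> R m \<in> Hom \<C> (res_obj \<C> R (Suc m)) (res_obj \<C> R m)" for m
    using conf_arr[OF d(1)[of m]] conf_arr[OF d(1)[of "Suc m"]] d(3)[of m] by (simp add: res_obj_def res_diff_def Hom_def)
  interpret G: comm_group ?G by (rule hom_comm_group[OF ob Z])
  note dd = HomD[OF df[of "Suc n"]] HomD[OF df[of n]]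
  have csub: "subgroup ?c ?G"
  proof (rule G.subgroupI)
    show "?c \<subseteq> carrier ?G" by (auto simp: cocycles_def)
    have "Zr (res_obj \<C> R (Suc n)) Z \<in> ?c" using ob Z dd by (simp add: cocycles_def Hom_def)
    then show "?c \<noteq> {}" by blast
    fix a assume a: "a \<in> ?c"
    then have "inv\<^bsub>?G\<^esub> a = neg a" using neg_def HomD(2,3) by (auto simp: cocycles_def)
    then show "inv\<^bsub>?G\<^esub> a \<in> ?c" using a dd ob Z by (auto simp: cocycles_def Hom_def)
    fix b assume b: "b \<in> ?c"
    show "a \<otimes>\<^bsub>?G\<^esub> b \<in> ?c" using a b dd ob Z by (auto simp: cocycles_def Hom_def)
  qed
  have bsub: "subgroup ?b ?G"
  proof (rule G.subgroupI)
    show "?b \<subseteq> carrier ?G" using dd by (auto simp: Hom_def)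
    have "Zr (res_obj \<C> R n) Z \<in> Hom \<C> (res_obj \<C> R n) Z" using ob Z by (simp add: Hom_def)
    then show "?b \<noteq> {}" by auto
    fix a assume "a \<in> ?b"
    then obtain x where x: "x \<in> Hom \<C> (res_obj \<C> R n) Z" "a = x \<cdot> ?d'" by auto
    have "inv\<^bsub>?G\<^esub> a = neg a" using neg_def HomD[OF x(1)] x dd by simp
    also have "\<dots> = neg x \<cdot> ?d'" using HomD[OF x(1)] x dd by simp
    finally show "inv\<^bsub>?G\<^esub> a \<in> ?b" using HomD[OF x(1)] by (auto simp: Hom_def)
    fix b assume "b \<in> ?b"
    then obtain y where y: "y \<in> Hom \<C> (res_obj \<C> R n) Z" "b = y \<cdot> ?d'" by auto
    have "a \<otimes>\<^bsub>?G\<^esub> b = (x \<boxplus> y) \<cdot> ?d'" using HomD[OF x(1)] HomD[OF y(1)] x y dd by simp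
    then show "a \<otimes>\<^bsub>?G\<^esub> b \<in> ?b" using add_hom[OF x(1) y(1)] by auto
  qed
  have bc: "?b \<subseteq> ?c" by (rule coboundaries_subset_cocycles[OF R Z])
  let ?C = "?G\<lparr>carrier := ?c\<rparr>"
  interpret N: normal ?b ?C
    by (rule G.normal_restrict_supergroup[OF csub G.subgroup_imp_normal[OF bsub] bc])
  have "trivial_group (Ext_group \<C> (Suc n) A Z) \<longleftrightarrow> trivial_group (?C Mod ?b)"
    by (simp add: Ext_group_def R_def[symmetric] Let_def)
  also have "\<dots> \<longleftrightarrow> ?c \<subseteq> ?b" using N.trivial_FactGroup_iff by simp
  also have "\<dots> \<longleftrightarrow> ext1_vanishes (Cod \<C> (snd (R n))) Z"
    using resolution_cocycles_eq_coboundaries_iff[OF R] ext1_vanishes_iff[OF d(1,2)] by blast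
  also have "\<dots> \<longleftrightarrow> ext1_vanishes K Z"
    using ext1_vanishes_stable_iso nth_syzygy_unique[OF K resolution_syzygy[OF R]] stable.iso_sym by blast
  finally show ?thesis .
qed

text \<open>Both dimensions are infima of upward closed sets of numbers.\<close>

lemma Inf_enat_le_iff:
  fixes Q :: "nat \<Rightarrow> bool"
  assumes mono: "\<And>m n. Q m \<Longrightarrow> m \<le> n \<Longrightarrow> Q n"
  shows "Inf {enat n | n. Q n} \<le> enat n \<longleftrightarrow> Q n"
proof
  assume L: "Inf {enat n | n. Q n} \<le> enat n"
  have "{enat n | n. Q n} \<noteq> {}"
  proof
    assume "{enat n | n. Q n} = {}"
    then have "Inf {enat n | n. Q n} = \<infinity>" by (simp only: Inf_enat_def simp_thms if_True)
    then show False using L by simp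
  qed
  then obtain x where "x \<in> {enat n | n. Q n}" by blast
  then have "Inf {enat n | n. Q n} \<in> {enat n | n. Q n}" by (rule wellorder_InfI)
  then obtain m where "Inf {enat n | n. Q n} = enat m" "Q m" by blast
  then show "Q n" using L mono by simp
qed (auto intro: Inf_lower)

text \<open>If \<open>Ext\<^sup>n\<^sup>+\<^sup>1(M, -)\<close> vanishes on the syzygy of \<open>K\<close>, the conflation that ends in \<open>K\<close> splits.
  Conversely the syzygies of a projective are projective.\<close>

lemma proj_dim_le_iff:
  assumes M: "M \<in> Obj \<C>" and K: "nth_syzygy \<C> n M K"
  shows "proj_dim \<C> M \<le> enat n \<longleftrightarrow> K \<in> Proj \<C>"
proof -
  let ?Q = "\<lambda>n. \<forall>j > n. \<forall>Z \<in> Obj \<C>. trivial_group (Ext_group \<C> j M Z)"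
  have "proj_dim \<C> M \<le> enat n \<longleftrightarrow> ?Q n"
    unfolding proj_dim_def by (rule Inf_enat_le_iff) auto
  also have "\<dots> \<longleftrightarrow> K \<in> Proj \<C>"
  proof
    assume L: "?Q n"
    obtain L where "syzygy \<C> K L" using syzygy_ex nth_syzygy_obj[OF K] by blast
    moreover have "ext1_vanishes K L"
      using L trivial_Ext_iff[OF M _ K] syzygy_obj(2)[OF calculation] by blast
    ultimately show "K \<in> Proj \<C>" using Proj_iff_ext1_vanishes by blast
  next
    assume KP: "K \<in> Proj \<C>"
    show "?Q n"
    proof (intro allI impI ballI)
      fix j Z assume "n < j" and Z: "Z \<in> Obj \<C>"
      then obtain m where m: "j = Suc m" "n \<le> m" by (cases j) auto
      obtain L where L: "nth_syzygy \<C> m M L" using nth_syzygy_ex[OF M] by blast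
      have "L \<in> Proj \<C>" using nth_syzygy_Proj_mono[OF K KP m(2) L] .
      then show "trivial_group (Ext_group \<C> j M Z)" using trivial_Ext_iff[OF M Z L] ext1_vanishes_Proj m by simp
    qed
  qed
  finally show ?thesis .
qed

lemma inj_dim_le_iff:
  assumes P: "P \<in> Obj \<C>"
  shows "inj_dim \<C> P \<le> enat n \<longleftrightarrow> (\<forall>j \<ge> n. \<forall>M K. nth_syzygy \<C> j M K \<longrightarrow> ext1_vanishes K P)"
proof -
  let ?Q = "\<lambda>n. \<forall>j > n. \<forall>Z \<in> Obj \<C>. trivial_group (Ext_group \<C> j Z P)"
  have "inj_dim \<C> P \<le> enat n \<longleftrightarrow> ?Q n"
    unfolding inj_dim_def by (rule Inf_enat_le_iff) auto
  also have "\<dots> \<longleftrightarrow> (\<forall>j \<ge> n. \<forall>M K. nth_syzygy \<C> j M K \<longrightarrow> ext1_vanishes K P)"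
  proof
    assume L: "?Q n"
    show "\<forall>j \<ge> n. \<forall>M K. nth_syzygy \<C> j M K \<longrightarrow> ext1_vanishes K P"
    proof (intro allI impI)
      fix j M K assume "n \<le> j" and K: "nth_syzygy \<C> j M K"
      have M: "M \<in> Obj \<C>" using nth_syzygy_obj[OF K] by blast
      then have "trivial_group (Ext_group \<C> (Suc j) M P)" using L \<open>n \<le> j\<close> by simp
      then show "ext1_vanishes K P" using trivial_Ext_iff[OF M P K] by simp
    qed
  next
    assume R: "\<forall>j \<ge> n. \<forall>M K. nth_syzygy \<C> j M K \<longrightarrow> ext1_vanishes K P"
    show "?Q n"
    proof (intro allI impI ballI)
      fix j Z assume "n < j" and Z: "Z \<in> Obj \<C>"
      then obtain m where m: "j = Suc m" "n \<le> m" by (cases j) auto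
      obtain L where L: "nth_syzygy \<C> m Z L" using nth_syzygy_ex[OF Z] by blast
      then show "trivial_group (Ext_group \<C> j Z P)" using trivial_Ext_iff[OF Z P L] R m by simp
    qed
  qed
  finally show ?thesis .
qed

lemma perp_Omega_class:
  assumes "inj_dim_class \<C> (Proj \<C>) \<le> enat n" "nth_syzygy \<C> n M K" shows "perp K"
  unfolding perp_def
proof (intro conjI allI impI)
  show "K \<in> Obj \<C>" using nth_syzygy_obj assms by blast
  fix j L P assume L: "nth_syzygy \<C> j K L" and P: "P \<in> Proj \<C>"
  have "inj_dim \<C> P \<le> enat n"
    using assms(1) SUP_upper[OF P, of "inj_dim \<C>"] unfolding inj_dim_class_def by (rule order_trans[rotated])
  moreover have "nth_syzygy \<C> (n + j) M L" using nth_syzygy_add assms(2) L by blast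
  ultimately show "ext1_vanishes L P" using inj_dim_le_iff[OF Proj_obj[OF P], of n] le_add1[of n j] by blast
qed

end

section \<open>Krull-Schmidt exact categories\<close>

locale IT_context = exact_category_enough_projectives \<C> for \<C> :: "('o, 'm) exact_cat" (structure) +
  assumes wic: "weakly_idempotent_complete \<C>"
    and ks: "krull_schmidt \<C>"
begin

text \<open>The cokernel \<open>p\<close> of the split monomorphism \<open>s\<close> is the second projection; the second injection is induced by
  \<open>1 - s \<cdot> r\<close>, which kills \<open>s\<close>.\<close>

lemma retract_complement:
  assumes s: "s \<in> Hom \<C> A M" and r: "r \<in> Hom \<C> M A" and rs: "r \<cdot> s = Id A"
  shows "\<exists>B j p. biprod M A B s j r p"
proof -
  note [simp] = HomD[OF s] HomD[OF r] rs
  have "split_mono \<C> s" unfolding split_mono_def by (intro conjI bexI[of _ r]) (simp_all add: r)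
  then obtain p where p: "is_cokernel \<C> s p" using wic unfolding weakly_idempotent_complete_def by blast
  then have [simp]: "p \<in> Arr \<C>" "Dom \<C> p = M" and ps: "p \<cdot> s = Zr A (Cod \<C> p)" by (auto simp: is_cokernel_def)
  have ex: "\<exists>!g. g \<in> Hom \<C> (Cod \<C> p) (Cod \<C> f) \<and> g \<cdot> p = f"
    if "f \<in> Arr \<C>" "Dom \<C> f = M" "f \<cdot> s = Zr A (Cod \<C> f)" for f
    using p that unfolding is_cokernel_def by simp
  have "\<exists>!g. g \<in> Hom \<C> (Cod \<C> p) (Cod \<C> (Id M \<boxminus> s \<cdot> r)) \<and> g \<cdot> p = Id M \<boxminus> s \<cdot> r"
    by (rule ex) simp_all
  then obtain j where j: "j \<in> Hom \<C> (Cod \<C> p) M" "j \<cdot> p = Id M \<boxminus> s \<cdot> r" by auto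
  note [simp] = HomD(1-3)[OF j(1)]
  have uni: "g = h" if "g \<cdot> p = h \<cdot> p" "g \<in> Hom \<C> (Cod \<C> p) X" "h \<in> Hom \<C> (Cod \<C> p) X" for g h X
  proof -
    note [simp] = HomD[OF that(2)]
    have "\<exists>!k. k \<in> Hom \<C> (Cod \<C> p) (Cod \<C> (g \<cdot> p)) \<and> k \<cdot> p = g \<cdot> p"
      by (rule ex) (simp_all add: ps)
    moreover have "Cod \<C> (g \<cdot> p) = X" by simp
    ultimately show ?thesis using that by metis
  qed
  have "p \<cdot> j = Id (Cod \<C> p)"
    by (rule uni[where X="Cod \<C> p"]) (simp_all add: Hom_def j(2) reassoc[OF ps])
  moreover have "r \<cdot> j = Zr (Cod \<C> p) A"
    by (rule uni[where X=A]) (simp_all add: Hom_def j(2) reassoc[OF rs])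
  ultimately have "biprod M A (Cod \<C> p) s j r p"
    using s r by (simp add: biprod_def Hom_def ps j(2) add_minus_cancel)
  then show ?thesis by blast
qed

lemma retract_direct_summand:
  assumes "s \<in> Hom \<C> A M" "r \<in> Hom \<C> M A" "r \<cdot> s = Id A"
  shows "direct_summand \<S> A M"
  using retract_complement[OF assms] direct_sumI stable_direct_sum unfolding direct_summand_def by blast

text \<open>Let \<open>f\<close> and \<open>g\<close> be stably inverse and \<open>1 = f \<cdot> g + v \<cdot> u\<close> on \<open>Y\<close>, with \<open>v \<cdot> u\<close> through \<open>P\<close>.  Then \<open>(f, v)\<close> from \<open>X \<oplus> P\<close>
  to \<open>Y\<close> is split epic, so \<open>X \<oplus> P \<cong> Y \<oplus> K\<close>.  Its component from \<open>X\<close> to \<open>Y\<close> is the stable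
  isomorphism \<open>f\<close>, so \<open>K\<close> is stably zero, that is, projective.\<close>

lemma stable_iso_imp_iso_up_to_Proj:
  assumes "stable.isomorphic X Y"
  shows "\<exists>T P Q. P \<in> Proj \<C> \<and> Q \<in> Proj \<C> \<and> direct_sum \<C> T [X, P] \<and> direct_sum \<C> T [Y, Q]"
proof -
  obtain f g where f: "f \<in> Hom \<C> X Y" and g: "g \<in> Hom \<C> Y X" and gf: "cls (g \<cdot> f) = cls (Id X)" and fg: "cls (f \<cdot> g) = cls (Id Y)"
    using assms stable_isoE by metis
  note [simp] = HomD[OF f] HomD[OF g]
  obtain n where n: "n \<in> null_maps \<C> Y Y" "Id Y = f \<cdot> g \<boxplus> n"
    using cls_eqD[of "Id Y" "f \<cdot> g" Y Y] fg by (auto simp: Hom_def)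
  obtain u v P where P: "P \<in> Proj \<C>" and u: "u \<in> Hom \<C> Y P" and v: "v \<in> Hom \<C> P Y" and nvu: "n = v \<cdot> u"
    using n(1) unfolding null_maps_def by blast
  note [simp] = HomD[OF u] HomD[OF v]
  obtain T where T: "direct_sum \<C> T [X, P]" using ex_biproduct[of X P] by auto
  then obtain i1 i2 p1 p2 where b: "biprod T X P i1 i2 p1 p2" using direct_sum2_iff by blast
  note b1 [simp] = biprod_simps[OF b]
  define e where "e = f \<cdot> p1 \<boxplus> v \<cdot> p2"
  define s where "s = i1 \<cdot> g \<boxplus> i2 \<cdot> u"
  have e: "e \<in> Hom \<C> T Y" and s: "s \<in> Hom \<C> Y T" by (simp_all add: e_def s_def Hom_def)
  have es: "e \<cdot> s = Id Y" using n(2) nvu by (simp add: e_def s_def)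
  obtain K j q where K: "biprod T Y K s j e q" using retract_complement[OF s e es] by blast
  note b2 [simp] = biprod_simps(1-15)[OF K]
  have "e \<cdot> j = Zr K Y" using biprodD(19)[OF K] .
  then have "f \<cdot> (p1 \<cdot> j) \<boxplus> v \<cdot> (p2 \<cdot> j) = Zr K Y" by (simp add: e_def)
  then have "f \<cdot> (p1 \<cdot> j) = neg (v \<cdot> (p2 \<cdot> j))"
    using neg_unique[of "v \<cdot> (p2 \<cdot> j)" "f \<cdot> (p1 \<cdot> j)" K Y] add_ac(1)[of "f \<cdot> (p1 \<cdot> j)" "v \<cdot> (p2 \<cdot> j)"] by (simp add: Hom_def)
  then have fn: "f \<cdot> (p1 \<cdot> j) \<in> null_maps \<C> K Y"
    using null_neg[OF null_through[OF P _ v, of "p2 \<cdot> j" K]] by (simp add: Hom_def)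
  obtain m where m: "m \<in> null_maps \<C> X X" "Id X = g \<cdot> f \<boxplus> m"
    using cls_eqD[of "Id X" "g \<cdot> f" X X] gf by (auto simp: Hom_def)
  note [simp] = HomD[OF null_hom[OF m(1)]]
  have pj: "p1 \<cdot> j \<in> Hom \<C> K X" by (simp add: Hom_def)
  have "p1 \<cdot> j = Id X \<cdot> (p1 \<cdot> j)" by simp
  also have "\<dots> = g \<cdot> (f \<cdot> (p1 \<cdot> j)) \<boxplus> m \<cdot> (p1 \<cdot> j)" unfolding m(2) by simp
  finally have "p1 \<cdot> j \<in> null_maps \<C> K X"
    using null_add[OF null_comp_left[OF fn g] null_comp_right[OF m(1) pj]] by simp
  then have "i1 \<cdot> (p1 \<cdot> j) \<in> null_maps \<C> K T"
    by (rule null_comp_left) (simp add: Hom_def)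
  moreover have "i2 \<cdot> (p2 \<cdot> j) \<in> null_maps \<C> K T"
    by (rule null_through[OF P]) (simp_all add: Hom_def)
  ultimately have "j \<in> null_maps \<C> K T"
    using null_add biprod_decomp'[OF b, of j K] by (metis b2(2,6,10) HomI)
  then have "q \<cdot> j \<in> null_maps \<C> K K"
    by (rule null_comp_left) (simp add: Hom_def)
  then have "Id K \<in> null_maps \<C> K K" using biprodD(17)[OF K] by simp
  then have "K \<in> Proj \<C>"
    using cls_null stable_zero_iff[of K] by (simp add: stable.zero_object_iff)
  then show ?thesis using T P direct_sumI[OF K] by blast
qed

text \<open>A stable decomposition writes the identity of \<open>L\<close> as \<open>a \<cdot> r + b \<cdot> q\<close> up to a null map.  By locality
  one of \<open>a \<cdot> r\<close> and \<open>b \<cdot> q + n\<close> is invertible, and the projection of \<open>L\<close> to the other summand,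
  being null after composition with a unit, is null.\<close>

lemma local_indecomposable_stable:
  assumes L: "local_ring (End_ring \<C> L)" and Lo: "L \<in> Obj \<C>" and LP: "L \<notin> Proj \<C>"
  shows "indecomposable \<S> L"
  unfolding indecomposable_def
proof (intro conjI allI impI)
  show "L \<in> Obj \<S>" using Lo by simp
  show "\<not> zero_object \<S> L" using LP stable_zero_iff by simp
  fix S T assume "direct_sum \<S> L [S, T]"
  then obtain I J P Q where "stable.biprod L S T I J P Q" using stable.direct_sum2_iff by blast
  then have SH: "I \<in> Hom \<S> S L" "J \<in> Hom \<S> T L" "P \<in> Hom \<S> L S" "Q \<in> Hom \<S> L T"
    and Se: "Comp \<S> P I = cls (Id S)" "Comp \<S> Q J = cls (Id T)" "Comp \<S> Q I = cls (Zr S T)" "Comp \<S> P J = cls (Zr T S)"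
    "Add \<S> (Comp \<S> I P) (Comp \<S> J Q) = cls (Id L)" unfolding stable.biprod_def by auto
  from SH obtain a b r q where h: "a \<in> Hom \<C> S L" "b \<in> Hom \<C> T L" "r \<in> Hom \<C> L S" "q \<in> Hom \<C> L T"
    and k: "I = cls a" "J = cls b" "P = cls r" "Q = cls q" by (auto simp: stable_Hom)
  have e: "cls (r \<cdot> a) = cls (Id S)" "cls (q \<cdot> b) = cls (Id T)" "cls (q \<cdot> a) = cls (Zr S T)" "cls (r \<cdot> b) = cls (Zr T S)"
    "cls (a \<cdot> r \<boxplus> b \<cdot> q) = cls (Id L)"
    using Se unfolding k stable_comp[OF h(1,3)] stable_comp[OF h(2,4)] stable_comp[OF h(1,4)] stable_comp[OF h(2,3)]
      stable_comp[OF h(3,1)] stable_comp[OF h(4,2)] stable_add[OF comp_hom[OF h(3,1)] comp_hom[OF h(4,2)]] by auto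
  note [simp] = HomD[OF h(1)] HomD[OF h(2)] HomD[OF h(3)] HomD[OF h(4)]
  have nl: "q \<cdot> a \<in> null_maps \<C> S T" "r \<cdot> b \<in> null_maps \<C> T S"
    using e(3,4) cls_zero_iff comp_hom[OF h(1,4)] comp_hom[OF h(2,3)] by auto
  \<comment> \<open>a stable retract of \<open>L\<close> with null projection is projective\<close>
  have proj: "X \<in> Proj \<C>" if "t \<in> null_maps \<C> L X" "c \<in> Hom \<C> X L" "cls (t \<cdot> c) = cls (Id X)" for t c X
  proof -
    have "cls (Id X) = cls (Zr X X)" using cls_null[OF null_comp_right[OF that(1,2)]] that(3) by simp
    then show ?thesis using stable_zero_iff[of X] HomD[OF that(2)] by (simp add: stable.zero_object_iff)
  qed
  have cancel: "t \<in> null_maps \<C> L X" if tx: "t \<cdot> x \<in> null_maps \<C> L X" and t: "t \<in> Hom \<C> L X" and x: "x \<in> Units (End_ring \<C> L)" for t x X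
  proof -
    obtain y where y: "y \<in> Hom \<C> L L" "x \<cdot> y = Id L" "x \<in> Hom \<C> L L" using x by (auto simp: End_unit_iff)
    have "(t \<cdot> x) \<cdot> y = t" using y t by (simp add: Hom_def)
    then show ?thesis using null_comp_right[OF tx y(1)] by simp
  qed
  obtain n where n: "n \<in> null_maps \<C> L L" "Id L = (a \<cdot> r \<boxplus> b \<cdot> q) \<boxplus> n"
    using cls_eqD[of "Id L" "a \<cdot> r \<boxplus> b \<cdot> q" L L] e(5) by (auto simp: Hom_def)
  note [simp] = HomD[OF null_hom[OF n(1)]]
  have "Id L \<in> Units (End_ring \<C> L)" unfolding End_unit_iff by (auto intro!: bexI[of _ "Id L"] simp: Hom_def)
  then have "a \<cdot> r \<boxplus> (b \<cdot> q \<boxplus> n) \<in> Units (End_ring \<C> L)" using n(2) by (simp add: add_ac(2))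
  then have "a \<cdot> r \<in> Units (End_ring \<C> L) \<or> b \<cdot> q \<boxplus> n \<in> Units (End_ring \<C> L)"
    by (rule local_unit_cases[OF L, rotated 2]) (simp_all add: Hom_def)
  then show "zero_object \<S> S \<or> zero_object \<S> T"
  proof
    assume u: "a \<cdot> r \<in> Units (End_ring \<C> L)"
    have "q \<cdot> (a \<cdot> r) \<in> null_maps \<C> L T" using null_comp_right[OF nl(1) h(3)] by simp
    then have "q \<in> null_maps \<C> L T" using cancel[OF _ h(4) u] by blast
    then show ?thesis using proj[OF _ h(2) e(2)] stable_zero_iff by simp
  next
    assume u: "b \<cdot> q \<boxplus> n \<in> Units (End_ring \<C> L)"
    have "r \<cdot> (b \<cdot> q \<boxplus> n) \<in> null_maps \<C> L S"
      using null_add[OF null_comp_right[OF nl(2) h(4)] null_comp_left[OF n(1) h(3)]] by simp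
    then have "r \<in> null_maps \<C> L S" using cancel[OF _ h(3) u] by blast
    then show ?thesis using proj[OF _ h(1) e(1)] stable_zero_iff by simp
  qed
qed

text \<open>Adding projectives to both sides lifts the stable isomorphism of \<open>X \<oplus> Z\<close> and \<open>Y \<oplus> Z\<close> to
  \<open>\<C>\<close>, where \<open>Z\<close> can be cancelled.\<close>

lemma stable_cancel:
  assumes X: "direct_sum \<S> S [X, Z]" and Y: "direct_sum \<S> S [Y, Z]" shows "stable.isomorphic X Y"
proof -
  have o: "X \<in> Obj \<C>" "Y \<in> Obj \<C>" "Z \<in> Obj \<C>"
    using stable.direct_sum_obj(2)[OF X] stable.direct_sum_obj(2)[OF Y] by auto
  obtain Ls where Ls: "direct_sum \<C> Z Ls" "\<forall>L \<in> set Ls. local_ring (End_ring \<C> L)"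
    using ks o(3) unfolding krull_schmidt_def by blast
  obtain U where U: "direct_sum \<C> U [X, Z]" using ex_biproduct o by blast
  obtain V where V: "direct_sum \<C> V [Y, Z]" using ex_biproduct o by blast
  have r: "stable.isomorphic A A" if "A \<in> Obj \<C>" for A using that stable.iso_refl by simp
  have "stable.isomorphic U S" using stable.direct_sum_iso[OF stable_direct_sum[OF U] X] r o by blast
  moreover have "stable.isomorphic S V" using stable.direct_sum_iso[OF Y stable_direct_sum[OF V]] r o by blast
  ultimately have "stable.isomorphic U V" by (rule stable.iso_trans)
  then obtain W P Q where W: "P \<in> Proj \<C>" "Q \<in> Proj \<C>" "direct_sum \<C> W [U, P]" "direct_sum \<C> W [V, Q]"
    using stable_iso_imp_iso_up_to_Proj by blast
  obtain X' where X': "direct_sum \<C> X' [P, X]" using ex_biproduct o W Proj_obj by blast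
  obtain Y' where Y': "direct_sum \<C> Y' [Q, Y]" using ex_biproduct o W Proj_obj by blast
  have "isomorphic X' Y'"
    by (rule cancel_list_sum[OF direct_sum_list_sum[OF Ls(1)] _ direct_sum_assoc[OF direct_sum_comm[OF W(3)] U X']
      direct_sum_assoc[OF direct_sum_comm[OF W(4)] V Y']]) (use Ls in blast)
  then have 1: "stable.isomorphic X' Y'" by (rule iso_stable_iso)
  have 2: "stable.isomorphic X' X"
    using stable.direct_sum_zero_iso[OF stable_direct_sum[OF direct_sum_comm[OF X']]] W(1) stable_zero_iff by blast
  have 3: "stable.isomorphic Y' Y"
    using stable.direct_sum_zero_iso[OF stable_direct_sum[OF direct_sum_comm[OF Y']]] W(2) stable_zero_iff by blast
  show ?thesis using stable.iso_trans[OF stable.iso_trans[OF stable.iso_sym[OF 2] 1] 3] .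
qed

section \<open>Equality of classes in the K-group\<close>

abbreviation "KG \<equiv> K_group \<C>"
abbreviation "FG \<equiv> iso_free_group \<C>"
abbreviation kc where "kc M \<equiv> K_class \<C> M"
abbreviation ic where "ic M \<equiv> isoclass \<C> M"

lemma iso_equiv: "equiv (Obj \<C>) (iso_rel \<C>)"
proof (rule equivI)
  show "refl_on (Obj \<C>) (iso_rel \<C>)" by (auto simp: refl_on_def iso_rel_iff iso_refl iso_obj)
  show "sym (iso_rel \<C>)" by (auto simp: sym_def iso_rel_iff iso_sym)
  show "trans (iso_rel \<C>)" unfolding trans_def iso_rel_iff using iso_trans by blast
  show "iso_rel \<C> \<subseteq> Obj \<C> \<times> Obj \<C>" by (auto simp: iso_rel_iff iso_obj)
qed

lemma ic_eq_iff: "X \<in> Obj \<C> \<Longrightarrow> Y \<in> Obj \<C> \<Longrightarrow> ic X = ic Y \<longleftrightarrow> isomorphic X Y"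
  unfolding isoclass_def using eq_equiv_class_iff[OF iso_equiv] by (simp add: iso_rel_iff)

lemma ic_in: "X \<in> Obj \<C> \<Longrightarrow> ic X \<in> Obj \<C> // iso_rel \<C>"
  unfolding isoclass_def by (rule quotientI)

lemma FG_simps [simp]: "monoid.mult FG = (+)" "one FG = 0" "x \<in> carrier FG \<longleftrightarrow> Poly_Mapping.keys x \<subseteq> Obj \<C> // iso_rel \<C>"
  "Poly_Mapping.keys x \<subseteq> Obj \<C> // iso_rel \<C> \<Longrightarrow> inv\<^bsub>FG\<^esub> x = - x"
  by (auto simp: iso_free_group_def free_Abelian_group_def fun_eq_iff inv_free_Abelian_group[unfolded free_Abelian_group_def])

lemma FG_comm_group: "comm_group FG"
  unfolding iso_free_group_def by (rule abelian_free_Abelian_group)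

sublocale FG: comm_group FG by (rule FG_comm_group)

definition K_gens where "K_gens =
     {frag_of (isoclass \<C> N) - frag_of (isoclass \<C> S) - frag_of (isoclass \<C> T) | N S T. direct_sum \<C> N [S, T]} \<union>
      {frag_of (isoclass \<C> P) | P. P \<in> Proj \<C>}"

lemma K_relations_eq: "K_relations \<C> = generate FG K_gens"
  by (simp add: K_relations_def K_gens_def)

lemma frag_in [simp]: "M \<in> Obj \<C> \<Longrightarrow> frag_of (ic M) \<in> carrier FG"
  by (simp add: ic_in)

lemma FG_minus:
  assumes "x \<in> carrier FG" "y \<in> carrier FG" shows "x - y \<in> carrier FG"
proof -
  have "x \<otimes>\<^bsub>FG\<^esub> inv\<^bsub>FG\<^esub> y \<in> carrier FG" using assms by blast
  then show ?thesis using assms by simp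
qed

lemma K_gens_subset: "K_gens \<subseteq> carrier FG"
proof
  fix x assume "x \<in> K_gens"
  then consider N S T where "direct_sum \<C> N [S, T]" "x = frag_of (ic N) - frag_of (ic S) - frag_of (ic T)"
    | P where "P \<in> Proj \<C>" "x = frag_of (ic P)" unfolding K_gens_def by blast
  then show "x \<in> carrier FG"
  proof cases
    case 1
    have "N \<in> Obj \<C>" "S \<in> Obj \<C>" "T \<in> Obj \<C>" using direct_sum_obj[OF 1(1)] by auto
    then show ?thesis unfolding 1(2) by (intro FG_minus frag_in)
  next
    case 2
    show ?thesis unfolding 2(2) by (rule frag_in[OF Proj_obj[OF 2(1)]])
  qed
qed

lemma K_relations_subgroup: "subgroup (K_relations \<C>) FG"
  unfolding K_relations_eq by (rule FG.generate_is_subgroup[OF K_gens_subset])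

lemma K_relations_normal: "K_relations \<C> \<lhd> FG"
  by (rule FG.subgroup_imp_normal[OF K_relations_subgroup])

lemma KG_comm_group: "comm_group KG"
  unfolding K_group_def by (rule FG.abelian_FactGroup[OF K_relations_subgroup])

sublocale KG: comm_group KG by (rule KG_comm_group)

definition coset where "coset x = K_relations \<C> #>\<^bsub>FG\<^esub> x"

lemma coset_hom: "coset \<in> hom FG KG"
  unfolding coset_def K_group_def using normal.r_coset_hom_Mod[OF K_relations_normal] .

lemma kc_coset: "kc M = coset (frag_of (ic M))"
  by (simp add: K_class_def coset_def)

lemma coset_group_hom: "group_hom FG KG coset"
  by (simp add: group_hom_def group_hom_axioms_def coset_hom FG.is_group KG.is_group)

sublocale CS: group_hom FG KG coset by (rule coset_group_hom)

lemma coset_eq_iff: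
  assumes "x \<in> carrier FG" "y \<in> carrier FG" shows "coset x = coset y \<longleftrightarrow> x - y \<in> K_relations \<C>"
proof -
  interpret R: subgroup "K_relations \<C>" FG by (rule K_relations_subgroup)
  have "x \<in> coset y \<longleftrightarrow> x - y \<in> K_relations \<C>"
    using R.rcos_module[OF FG.is_group assms(2,1)] assms by (simp add: coset_def)
  moreover have "coset x = coset y \<longleftrightarrow> x \<in> coset y"
    unfolding coset_def using FG.repr_independence[OF _ assms(2) K_relations_subgroup]
      FG.rcos_self[OF assms(1) K_relations_subgroup] by blast
  ultimately show ?thesis by simp
qed

lemma kc_closed [simp]: "M \<in> Obj \<C> \<Longrightarrow> kc M \<in> carrier KG"
  unfolding kc_coset by (rule CS.hom_closed[OF frag_in])

lemma kc_sum:
  assumes "direct_sum \<C> N [S, T]" shows "kc N = kc S \<otimes>\<^bsub>KG\<^esub> kc T"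
proof -
  have o: "N \<in> Obj \<C>" "S \<in> Obj \<C>" "T \<in> Obj \<C>" using direct_sum_obj[OF assms(1)] by auto
  have "frag_of (ic N) - (frag_of (ic S) + frag_of (ic T)) \<in> K_relations \<C>"
    unfolding K_relations_eq by (rule generate.incl) (use assms in \<open>auto simp: K_gens_def diff_diff_eq\<close>)
  moreover have "frag_of (ic S) + frag_of (ic T) \<in> carrier FG"
    using FG.m_closed[OF frag_in[OF o(2)] frag_in[OF o(3)]] by simp
  ultimately have "kc N = coset (frag_of (ic S) + frag_of (ic T))"
    unfolding kc_coset using coset_eq_iff[OF frag_in[OF o(1)]] by blast
  also have "\<dots> = kc S \<otimes>\<^bsub>KG\<^esub> kc T" using CS.hom_mult[OF frag_in[OF o(2)] frag_in[OF o(3)]] by (simp add: kc_coset)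
  finally show ?thesis .
qed

lemma kc_Proj: assumes "P \<in> Proj \<C>" shows "kc P = \<one>\<^bsub>KG\<^esub>"
proof -
  have "frag_of (ic P) - 0 \<in> K_relations \<C>"
    unfolding K_relations_eq using assms by (auto intro!: generate.incl simp: K_gens_def)
  then have "kc P = coset 0" unfolding kc_coset using coset_eq_iff[OF frag_in[OF Proj_obj[OF assms]], of 0] by simp
  also have "\<dots> = \<one>\<^bsub>KG\<^esub>" using CS.hom_one by simp
  finally show ?thesis .
qed

lemma kc_stable_iso: assumes "stable.isomorphic X Y" shows "kc X = kc Y"
proof -
  obtain T P Q where T: "P \<in> Proj \<C>" "Q \<in> Proj \<C>" "direct_sum \<C> T [X, P]" "direct_sum \<C> T [Y, Q]"
    using stable_iso_imp_iso_up_to_Proj[OF assms] by blast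
  have "X \<in> Obj \<C>" "Y \<in> Obj \<C>" using stable.iso_obj[OF assms] by auto
  then show ?thesis using kc_sum[OF T(3)] kc_sum[OF T(4)] kc_Proj T(1,2) by simp
qed

lemma kc_stable_sum:
  assumes "direct_sum \<S> N [S, T]" shows "kc N = kc S \<otimes>\<^bsub>KG\<^esub> kc T"
proof -
  have o: "S \<in> Obj \<C>" "T \<in> Obj \<C>" using stable.direct_sum_obj(2)[OF assms(1)] by auto
  obtain N' where N': "direct_sum \<C> N' [S, T]" using ex_biproduct o by blast
  have "stable.isomorphic N N'"
    using stable.direct_sum_iso[OF assms stable_direct_sum[OF N']] stable.iso_refl o by simp
  then show ?thesis using kc_stable_iso kc_sum[OF N'] by simp
qed

definition frag_sum :: "'o list \<Rightarrow> 'o set \<Rightarrow>\<^sub>0 int" where "frag_sum xs = (\<Sum>x\<leftarrow>xs. frag_of (ic x))"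

lemma frag_sum_simps [simp]: "frag_sum [] = 0" "frag_sum (x # xs) = frag_of (ic x) + frag_sum xs"
  "frag_sum (xs @ ys) = frag_sum xs + frag_sum ys"
  by (simp_all add: frag_sum_def)

text \<open>The coefficient of a class in \<open>frag_sum xs\<close> is its multiplicity; this is where freeness of the group on
  isomorphism classes is used.\<close>

lemma frag_sum_mset: "frag_sum xs = frag_sum ys \<Longrightarrow> image_mset (isoclass \<C>) (mset xs) = image_mset (isoclass \<C>) (mset ys)"
proof -
  have l: "Poly_Mapping.lookup (frag_sum xs) c = int (count (image_mset (isoclass \<C>) (mset xs)) c)" for c xs
    by (induction xs) (auto simp: lookup_add)
  assume "frag_sum xs = frag_sum ys"
  then show ?thesis using l by (metis multiset_eqI of_nat_eq_iff)
qed

text \<open>Differences of formal sums whose two sides have stably isomorphic direct sums.  This subgroup contains the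
  defining relations of the K-group.\<close>

definition stable_balanced where
  "stable_balanced = {frag_sum xs - frag_sum ys | xs ys S T. stable.list_sum xs S \<and> stable.list_sum ys T \<and> stable.isomorphic S T}"

lemma frag_sum_closed: "set xs \<subseteq> Obj \<C> \<Longrightarrow> frag_sum xs \<in> carrier FG"
proof (induction xs)
  case (Cons x xs)
  then show ?case using FG.m_closed[of "frag_of (ic x)" "frag_sum xs"] by (simp add: ic_in)
qed simp

lemma list_sum_sing:
  assumes "X \<in> Obj \<C>" shows "stable.list_sum [X] X"
proof -
  obtain Z where "zero_object \<S> Z" using stable.ex_zero by blast
  then show ?thesis using stable.direct_sum_zero[of X Z] assms by (auto intro: stable.list_sum.intros)
qed

lemma stable_balanced_subgroup: "subgroup stable_balanced FG"
proof (rule FG.subgroupI)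
  show sub: "stable_balanced \<subseteq> carrier FG"
  proof
    fix x assume "x \<in> stable_balanced"
    then obtain xs ys S T where x: "x = frag_sum xs - frag_sum ys" "stable.list_sum xs S" "stable.list_sum ys T"
      unfolding stable_balanced_def by blast
    have "set xs \<subseteq> Obj \<C>" "set ys \<subseteq> Obj \<C>" using stable.list_sum_obj(2)[OF x(2)] stable.list_sum_obj(2)[OF x(3)] by auto
    then show "x \<in> carrier FG" unfolding x(1) by (intro FG_minus frag_sum_closed)
  qed
  obtain Z where Z: "zero_object \<S> Z" using stable.ex_zero by blast
  then have "frag_sum [] - frag_sum [] \<in> stable_balanced"
    unfolding stable_balanced_def using stable.list_sum.Nil[OF Z] stable.iso_refl[of Z] stable.zero_object_iff[of Z] by blast
  then show "stable_balanced \<noteq> {}" by blast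
  fix a assume a: "a \<in> stable_balanced"
  then obtain xs ys S T where x: "a = frag_sum xs - frag_sum ys" "stable.list_sum xs S" "stable.list_sum ys T" "stable.isomorphic S T"
    unfolding stable_balanced_def by blast
  have "- a = frag_sum ys - frag_sum xs" using x by simp
  moreover have "inv\<^bsub>FG\<^esub> a = - a" using sub a by auto
  ultimately have "inv\<^bsub>FG\<^esub> a = frag_sum ys - frag_sum xs" by simp
  then show "inv\<^bsub>FG\<^esub> a \<in> stable_balanced"
    unfolding stable_balanced_def using x(2,3) stable.iso_sym[OF x(4)] by blast
  fix b assume "b \<in> stable_balanced"
  then obtain xs' ys' S' T' where x': "b = frag_sum xs' - frag_sum ys'" "stable.list_sum xs' S'" "stable.list_sum ys' T'" "stable.isomorphic S' T'"
    unfolding stable_balanced_def by blast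
  obtain U where U: "direct_sum \<S> U [S, S']" using stable.ex_biproduct stable.list_sum_obj(1)[OF x(2)] stable.list_sum_obj(1)[OF x'(2)] by blast
  obtain V where V: "direct_sum \<S> V [T, T']" using stable.ex_biproduct stable.list_sum_obj(1)[OF x(3)] stable.list_sum_obj(1)[OF x'(3)] by blast
  have "stable.list_sum (xs @ xs') U" "stable.list_sum (ys @ ys') V" "stable.isomorphic U V"
    using stable.list_sum_append[OF x(2) x'(2) U] stable.list_sum_append[OF x(3) x'(3) V] stable.direct_sum_iso[OF U V x(4) x'(4)] by auto
  moreover have "a \<otimes>\<^bsub>FG\<^esub> b = frag_sum (xs @ xs') - frag_sum (ys @ ys')" using x(1) x'(1) by simp
  ultimately show "a \<otimes>\<^bsub>FG\<^esub> b \<in> stable_balanced" unfolding stable_balanced_def by blast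
qed

lemma K_relations_balanced: "K_relations \<C> \<subseteq> stable_balanced"
  unfolding K_relations_eq
proof (rule FG.generate_subgroup_incl[OF _ stable_balanced_subgroup], rule subsetI)
  fix x assume "x \<in> K_gens"
  then consider N S T where "direct_sum \<C> N [S, T]" "x = frag_of (ic N) - frag_of (ic S) - frag_of (ic T)"
    | P where "P \<in> Proj \<C>" "x = frag_of (ic P)" unfolding K_gens_def by blast
  then show "x \<in> stable_balanced"
  proof cases
    case 1
    have o: "N \<in> Obj \<C>" "S \<in> Obj \<C>" "T \<in> Obj \<C>" using direct_sum_obj[OF 1(1)] by auto
    have "stable.list_sum [S, T] N"
      by (rule stable.list_sum.Cons[OF list_sum_sing[OF o(3)] stable_direct_sum[OF 1(1)]])
    moreover have "x = frag_sum [N] - frag_sum [S, T]" using 1(2) by simp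
    ultimately show ?thesis unfolding stable_balanced_def using list_sum_sing[OF o(1)] stable.iso_refl[of N] o(1) stable_sel(1) by blast
  next
    case 2
    obtain Z where Z: "zero_object \<S> Z" using stable.ex_zero by blast
    have "stable.isomorphic P Z" using stable.zero_iso Z 2(1) stable_zero_iff by blast
    moreover have "x = frag_sum [P] - frag_sum []" using 2(2) by simp
    ultimately show ?thesis unfolding stable_balanced_def using list_sum_sing[OF Proj_obj[OF 2(1)]] stable.list_sum.Nil[OF Z] by blast
  qed
qed

text \<open>If \<open>[X] - [Y]\<close> is a relation, it equals \<open>\<Sum> xs - \<Sum> ys\<close> for lists with stably isomorphic sums.  Comparing
  coefficients of \<open>[X] + \<Sum> ys = [Y] + \<Sum> xs\<close> gives \<open>X \<oplus> T \<cong> Y \<oplus> S\<close> stably with \<open>S \<cong> T\<close>, and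
  \<open>T\<close> cancels.\<close>

lemma K_class_eq_iff:
  assumes X: "X \<in> Obj \<C>" and Y: "Y \<in> Obj \<C>" shows "kc X = kc Y \<longleftrightarrow> stable.isomorphic X Y"
proof
  assume "kc X = kc Y"
  then have "frag_of (ic X) - frag_of (ic Y) \<in> stable_balanced"
    using coset_eq_iff[OF frag_in[OF X] frag_in[OF Y]] K_relations_balanced by (auto simp: kc_coset)
  then obtain xs ys S T where x: "frag_of (ic X) - frag_of (ic Y) = frag_sum xs - frag_sum ys" "stable.list_sum xs S" "stable.list_sum ys T" "stable.isomorphic S T"
    unfolding stable_balanced_def by blast
  \<comment> \<open>moving the negative terms across leaves an equation between sums with nonnegative coefficients\<close>
  have eq: "frag_sum (X # ys) = frag_sum (Y # xs)" using x(1) by (simp add: algebra_simps)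
  obtain A where A: "direct_sum \<S> A [X, T]" using stable.ex_biproduct stable.list_sum_obj(1)[OF x(3)] X by auto
  obtain B where B: "direct_sum \<S> B [Y, S]" using stable.ex_biproduct stable.list_sum_obj(1)[OF x(2)] Y by auto
  have o: "set (X # ys) \<subseteq> Obj \<C>" "set (Y # xs) \<subseteq> Obj \<C>"
    using stable.list_sum_obj(2)[OF x(2)] stable.list_sum_obj(2)[OF x(3)] X Y by auto
  have "stable.isomorphic A B"
  proof (rule stable.list_sum_unique[OF stable.list_sum.Cons[OF x(3) A] stable.list_sum.Cons[OF x(2) B] frag_sum_mset[OF eq]])
    fix a b assume ab: "a \<in> set (X # ys)" "b \<in> set (Y # xs)" "ic a = ic b"
    then have "isomorphic a b" using ic_eq_iff o by blast
    then show "stable.isomorphic a b" by (rule iso_stable_iso)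
  qed
  then have "direct_sum \<S> A [Y, T]"
    using stable.direct_sum_transport[OF B stable.iso_sym] stable.iso_refl[of Y] x(4) Y by simp
  then show "stable.isomorphic X Y" by (rule stable_cancel[OF A])
qed (rule kc_stable_iso)

definition class_differences where "class_differences W = {kc X \<otimes>\<^bsub>KG\<^esub> inv\<^bsub>KG\<^esub> kc Y | X Y. X \<in> W \<and> Y \<in> W}"

text \<open>Since classes add along direct sums, every element of such a span is a difference of just two classes.\<close>

lemma class_differences_subgroup:
  assumes W: "W \<subseteq> Obj \<C>" "W \<noteq> {}" and sum: "\<And>X Y S. X \<in> W \<Longrightarrow> Y \<in> W \<Longrightarrow> direct_sum \<C> S [X, Y] \<Longrightarrow> S \<in> W"
  shows "subgroup (class_differences W) KG"
proof (rule KG.subgroupI)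
  have c: "kc X \<in> carrier KG" if "X \<in> W" for X using that W by auto
  show "class_differences W \<subseteq> carrier KG" unfolding class_differences_def using c by auto
  show "class_differences W \<noteq> {}" unfolding class_differences_def using W(2) by blast
  fix a assume "a \<in> class_differences W"
  then obtain X Y where a: "a = kc X \<otimes>\<^bsub>KG\<^esub> inv\<^bsub>KG\<^esub> kc Y" "X \<in> W" "Y \<in> W" unfolding class_differences_def by blast
  have "inv\<^bsub>KG\<^esub> a = kc Y \<otimes>\<^bsub>KG\<^esub> inv\<^bsub>KG\<^esub> kc X"
    using c[OF a(2)] c[OF a(3)] by (simp add: a(1) KG.inv_mult KG.m_comm)
  then show "inv\<^bsub>KG\<^esub> a \<in> class_differences W" unfolding class_differences_def using a by blast
  fix b assume "b \<in> class_differences W"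
  then obtain X' Y' where b: "b = kc X' \<otimes>\<^bsub>KG\<^esub> inv\<^bsub>KG\<^esub> kc Y'" "X' \<in> W" "Y' \<in> W" unfolding class_differences_def by blast
  obtain U where U: "direct_sum \<C> U [X, X']" using ex_biproduct a b W by blast
  obtain V where V: "direct_sum \<C> V [Y, Y']" using ex_biproduct a b W by blast
  have "a \<otimes>\<^bsub>KG\<^esub> b = kc U \<otimes>\<^bsub>KG\<^esub> inv\<^bsub>KG\<^esub> kc V"
    using c[OF a(2)] c[OF a(3)] c[OF b(2)] c[OF b(3)] by (simp add: a(1) b(1) kc_sum[OF U] kc_sum[OF V] KG.inv_mult KG.m_ac)
  moreover have "U \<in> W" "V \<in> W" using sum[OF a(2) b(2) U] sum[OF a(3) b(3) V] .
  ultimately show "a \<otimes>\<^bsub>KG\<^esub> b \<in> class_differences W" unfolding class_differences_def by blast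
qed

lemma KG_carrier: "carrier KG = class_differences (Obj \<C>)"
proof
  obtain Z where Z: "zero_object \<C> Z" using ex_zero by blast
  have Zo: "Z \<in> Obj \<C>" using Z by (simp add: zero_object_iff)
  have sub: "subgroup (class_differences (Obj \<C>)) KG"
    by (rule class_differences_subgroup) (use Zo direct_sum_obj in auto)
  interpret D: subgroup "class_differences (Obj \<C>)" KG by (rule sub)
  have one: "kc Z = \<one>\<^bsub>KG\<^esub>" by (rule kc_Proj[OF Proj_zero[OF Z]])
  have dc: "coset x \<in> class_differences (Obj \<C>)" if "x \<in> carrier FG" for x
  proof -
    have "Poly_Mapping.keys x \<subseteq> Obj \<C> // iso_rel \<C>" using that by simp
    then show ?thesis
    proof (rule free_Abelian_group_induct)
      show "coset 0 \<in> class_differences (Obj \<C>)" using CS.hom_one D.one_closed by simp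
    next
      fix x y assume 2: "Poly_Mapping.keys x \<subseteq> Obj \<C> // iso_rel \<C>" "Poly_Mapping.keys y \<subseteq> Obj \<C> // iso_rel \<C>"
        "coset x \<in> class_differences (Obj \<C>)" "coset y \<in> class_differences (Obj \<C>)"
      have c: "x \<in> carrier FG" "y \<in> carrier FG" using 2 by auto
      have d: "x - y = x \<otimes>\<^bsub>FG\<^esub> inv\<^bsub>FG\<^esub> y" using 2 by simp
      have "coset (x - y) = coset x \<otimes>\<^bsub>KG\<^esub> inv\<^bsub>KG\<^esub> coset y"
        unfolding d CS.hom_mult[OF c(1) FG.inv_closed[OF c(2)]] CS.hom_inv[OF c(2)] ..
      then show "coset (x - y) \<in> class_differences (Obj \<C>)" using 2 D.m_closed D.m_inv_closed by simp
    next
      fix a assume "a \<in> Obj \<C> // iso_rel \<C>"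
      then obtain M where M: "M \<in> Obj \<C>" "a = ic M" unfolding quotient_def isoclass_def by blast
      have "coset (frag_of a) = kc M \<otimes>\<^bsub>KG\<^esub> inv\<^bsub>KG\<^esub> kc Z"
        using M by (simp add: kc_coset[symmetric] one)
      then show "coset (frag_of a) \<in> class_differences (Obj \<C>)" unfolding class_differences_def using M Zo by blast
    qed
  qed
  have im: "carrier KG = coset ` carrier FG"
    unfolding K_group_def coset_def by (rule carrier_FactGroup)
  show "carrier KG \<subseteq> class_differences (Obj \<C>)"
    unfolding im by (rule image_subsetI) (rule dc)
  show "class_differences (Obj \<C>) \<subseteq> carrier KG" by (rule D.subset)
qed

section \<open>The syzygy endomorphism of the K-group\<close>

lemma syzygy_kc_unique: "stable.isomorphic M M' \<Longrightarrow> syzygy \<C> M K \<Longrightarrow> syzygy \<C> M' K' \<Longrightarrow> kc K = kc K'"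
  using kc_stable_iso syzygy_stable_iso by blast

definition K_Omega_spec where
  "K_Omega_spec h \<longleftrightarrow> h \<in> hom KG KG \<and> h \<in> extensional (carrier KG) \<and> (\<forall>M K. syzygy \<C> M K \<longrightarrow> h (kc M) = kc K)"

lemma K_Omega_spec_unique:
  assumes "K_Omega_spec h" "K_Omega_spec h'" shows "h = h'"
proof
  fix x
  have h: "h \<in> hom KG KG" "h' \<in> hom KG KG" using assms by (auto simp: K_Omega_spec_def)
  interpret h: group_hom KG KG h using h by (simp add: group_hom_def group_hom_axioms_def)
  interpret h': group_hom KG KG h' using h by (simp add: group_hom_def group_hom_axioms_def)
  show "h x = h' x"
  proof (cases "x \<in> carrier KG")
    case True
    then obtain X Y where x: "x = kc X \<otimes>\<^bsub>KG\<^esub> inv\<^bsub>KG\<^esub> kc Y" "X \<in> Obj \<C>" "Y \<in> Obj \<C>"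
      unfolding KG_carrier class_differences_def by blast
    obtain X' Y' where "syzygy \<C> X X'" "syzygy \<C> Y Y'" using syzygy_ex x by blast
    then have "h (kc X) = h' (kc X)" "h (kc Y) = h' (kc Y)" using assms unfolding K_Omega_spec_def by auto
    then show ?thesis using x by simp
  next
    case False
    then show ?thesis using assms unfolding K_Omega_spec_def extensional_def by auto
  qed
qed

text \<open>On the free group, send an isomorphism class to the class of any syzygy of any of its members.  This kills
  the relations because syzygies preserve stable direct sums and projectives.\<close>

lemma K_Omega_spec_ex: "\<exists>h. K_Omega_spec h"
proof -
  define f where "f c = kc (SOME K. \<exists>M \<in> c. syzygy \<C> M K)" for c
  have f: "f (ic M) = kc K" if MK: "syzygy \<C> M K" for M K
  proof -
    have M: "M \<in> Obj \<C>" using syzygy_obj[OF MK] by blast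
    have "M \<in> ic M" using iso_refl[OF M] by (simp add: isoclass_def iso_rel_iff)
    then have "\<exists>K. \<exists>M' \<in> ic M. syzygy \<C> M' K" using MK by blast
    then have "\<exists>M' \<in> ic M. syzygy \<C> M' (SOME K. \<exists>M' \<in> ic M. syzygy \<C> M' K)" by (rule someI_ex)
    then obtain M' where M': "M' \<in> ic M" "syzygy \<C> M' (SOME K. \<exists>M' \<in> ic M. syzygy \<C> M' K)" by blast
    have "isomorphic M M'" using M'(1) by (simp add: isoclass_def iso_rel_iff)
    then show ?thesis unfolding f_def using syzygy_kc_unique[OF iso_stable_iso MK M'(2)] by simp
  qed
  have fS: "f ` (Obj \<C> // iso_rel \<C>) \<subseteq> carrier KG"
  proof
    fix y assume "y \<in> f ` (Obj \<C> // iso_rel \<C>)"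
    then obtain M where M: "M \<in> Obj \<C>" "y = f (ic M)" unfolding quotient_def isoclass_def by blast
    obtain K where "syzygy \<C> M K" using syzygy_ex M by blast
    then show "y \<in> carrier KG" using f M syzygy_obj by simp
  qed
  obtain h where h: "h \<in> hom (free_Abelian_group (Obj \<C> // iso_rel \<C>)) KG" "\<And>x. x \<in> Obj \<C> // iso_rel \<C> \<Longrightarrow> h (frag_of x) = f x"
    by (rule KG.free_Abelian_group_universal[OF fS]) (rule that, assumption, simp)
  have hF: "h \<in> hom FG KG" using h(1) by (simp add: iso_free_group_def)
  interpret h: group_hom FG KG h using hF by (simp add: group_hom_def group_hom_axioms_def)
  have hM: "h (frag_of (ic M)) = kc K" if "syzygy \<C> M K" for M K
    using h(2)[OF ic_in] f[OF that] syzygy_obj[OF that] by simp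
  have "K_gens \<subseteq> kernel FG KG h"
  proof
    fix x assume xg: "x \<in> K_gens"
    then have xc: "x \<in> carrier FG" using K_gens_subset by blast
    from xg consider N S T where "direct_sum \<C> N [S, T]" "x = frag_of (ic N) - frag_of (ic S) - frag_of (ic T)"
      | P where "P \<in> Proj \<C>" "x = frag_of (ic P)" unfolding K_gens_def by blast
    then have "h x = \<one>\<^bsub>KG\<^esub>"
    proof cases
      case 1
      have o: "N \<in> Obj \<C>" "S \<in> Obj \<C>" "T \<in> Obj \<C>" using direct_sum_obj[OF 1(1)] by auto
      obtain N' S' T' where s: "syzygy \<C> N N'" "syzygy \<C> S S'" "syzygy \<C> T T'" using syzygy_ex o by meson
      have "kc N' = kc S' \<otimes>\<^bsub>KG\<^esub> kc T'"
        by (rule kc_stable_sum[OF syzygy_direct_sum[OF stable_direct_sum[OF 1(1)] s]])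
      \<comment> \<open>additivity of \<open>h\<close> on \<open>[N] = x + ([S] + [T])\<close> gives \<open>h x = 0\<close>\<close>
      moreover have "frag_of (ic N) = x \<otimes>\<^bsub>FG\<^esub> (frag_of (ic S) \<otimes>\<^bsub>FG\<^esub> frag_of (ic T))" using 1(2) by simp
      then have "kc N' = h x \<otimes>\<^bsub>KG\<^esub> (kc S' \<otimes>\<^bsub>KG\<^esub> kc T')"
        using h.hom_mult[OF xc FG.m_closed[OF frag_in[OF o(2)] frag_in[OF o(3)]]] h.hom_mult[OF frag_in[OF o(2)] frag_in[OF o(3)]]
          hM[OF s(1)] hM[OF s(2)] hM[OF s(3)] by simp
      ultimately show ?thesis
        using h.hom_closed[OF xc] syzygy_obj(2)[OF s(2)] syzygy_obj(2)[OF s(3)]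
          KG.r_cancel_one[of "kc S' \<otimes>\<^bsub>KG\<^esub> kc T'" "h x"] by simp
    next
      case 2
      obtain K where K: "syzygy \<C> P K" using syzygy_ex Proj_obj[OF 2(1)] by blast
      then show ?thesis using hM[OF K] kc_Proj syzygy_Proj[OF K 2(1)] 2(2) by simp
    qed
    then show "x \<in> kernel FG KG h" using xc by (simp add: kernel_def)
  qed
  then have "K_relations \<C> \<subseteq> kernel FG KG h"
    unfolding K_relations_eq by (rule FG.generate_subgroup_incl[OF _ h.subgroup_kernel])
  then obtain g where g: "g \<in> hom (FG Mod K_relations \<C>) KG" "\<And>x. x \<in> carrier FG \<Longrightarrow> g (K_relations \<C> #>\<^bsub>FG\<^esub> x) = h x"
    using h.FactGroup_universal_kernel[OF K_relations_normal] by blast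
  have gK: "g \<in> hom KG KG" using g(1) by (simp add: K_group_def)
  have "K_Omega_spec (restrict g (carrier KG))"
    unfolding K_Omega_spec_def
  proof (intro conjI allI impI)
    show "restrict g (carrier KG) \<in> hom KG KG"
      using gK KG.m_closed unfolding hom_def by auto
    show "restrict g (carrier KG) \<in> extensional (carrier KG)" by simp
    fix M K assume MK: "syzygy \<C> M K"
    have M: "M \<in> Obj \<C>" using syzygy_obj[OF MK] by blast
    have "g (kc M) = kc K" using g(2)[OF frag_in[OF M]] hM[OF MK] by (simp add: K_class_def)
    then show "restrict g (carrier KG) (kc M) = kc K" using M by simp
  qed
  then show ?thesis by blast
qed

abbreviation "Om \<equiv> K_Omega \<C>"

lemma K_Omega_satisfies_spec: "K_Omega_spec Om"
proof -
  have "K_Omega_spec (THE h. K_Omega_spec h)"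
    using K_Omega_spec_ex K_Omega_spec_unique by (metis theI')
  then show ?thesis unfolding K_Omega_def K_Omega_spec_def .
qed

lemma K_Omega_hom: "Om \<in> hom KG KG" and K_Omega_syzygy: "syzygy \<C> M K \<Longrightarrow> Om (kc M) = kc K"
  using K_Omega_satisfies_spec unfolding K_Omega_spec_def by auto

lemma funpow_hom: "(Om ^^ m) \<in> hom KG KG"
proof (induction m)
  case (Suc m)
  then show ?case using K_Omega_hom hom_compose[of "Om ^^ m" KG KG Om KG] by (simp add: o_def compose_def)
qed (simp add: hom_def)

lemma funpow_Omega: "nth_syzygy \<C> m M K \<Longrightarrow> (Om ^^ m) (kc M) = kc K"
proof (induction m arbitrary: K)
  case (Suc m)
  then obtain L where "nth_syzygy \<C> m M L" "syzygy \<C> L K" by auto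
  then show ?case using Suc.IH K_Omega_syzygy by simp
qed simp

lemma span_gens_subset: "{kc N | N. indecomposable \<S> N \<and> direct_summand \<S> N M} \<subseteq> carrier KG"
  by (auto simp: indecomposable_def)

lemma span_subgroup: "subgroup (K_span \<C> M) KG"
  unfolding K_span_def by (rule KG.generate_is_subgroup[OF span_gens_subset])

lemma span_image_subgroup: "subgroup ((Om ^^ m) ` K_span \<C> M) KG"
proof -
  interpret h: group_hom KG KG "Om ^^ m" using funpow_hom by (simp add: group_hom_def group_hom_axioms_def)
  show ?thesis by (rule h.subgroup_img_is_subgroup[OF span_subgroup])
qed

text \<open>In a decomposition of \<open>M\<close> into objects with local endomorphism rings, the projective summands contribute
  nothing to the class of \<open>M\<close> and the others are indecomposable in the stable category.\<close>

lemma kc_in_span: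
  assumes M: "M \<in> Obj \<C>" shows "kc M \<in> K_span \<C> M"
proof -
  interpret sp: subgroup "K_span \<C> M" KG by (rule span_subgroup)
  obtain Bs where Bs: "direct_sum \<C> M Bs" "\<forall>B \<in> set Bs. local_ring (End_ring \<C> B)"
    using ks M unfolding krull_schmidt_def by blast
  have B: "kc B \<in> K_span \<C> M" if "B \<in> set Bs" for B
  proof (cases "B \<in> Proj \<C>")
    case True
    then show ?thesis using kc_Proj sp.one_closed by simp
  next
    case False
    obtain a b where ab: "\<forall>k < length Bs. a k \<in> Hom \<C> (Bs ! k) M \<and> b k \<in> Hom \<C> M (Bs ! k)"
      "\<forall>k < length Bs. \<forall>l < length Bs. b l \<cdot> a k = (if k = l then Id (Bs ! k) else Zr (Bs ! k) (Bs ! l))"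
      using Bs(1) unfolding direct_sum_def by blast
    obtain k where k: "k < length Bs" "Bs ! k = B" using \<open>B \<in> set Bs\<close> by (auto simp: in_set_conv_nth)
    have "direct_summand \<S> B M"
      by (rule retract_direct_summand[of "a k" B M "b k"]) (use ab k in auto)
    moreover have "indecomposable \<S> B"
      using local_indecomposable_stable False Bs(2) direct_sum_obj(2)[OF Bs(1)] that by blast
    ultimately show ?thesis unfolding K_span_def by (intro generate.incl) blast
  qed
  have "kc S \<in> K_span \<C> M" if "list_sum xs S" "set xs \<subseteq> set Bs" for xs S
    using that
  proof (induction rule: list_sum.induct)
    case (Nil Z)
    then show ?case using kc_Proj[OF Proj_zero] sp.one_closed by simp
  next
    case (Cons xs T S x)
    then show ?case using B kc_sum[OF Cons.hyps(2)] sp.m_closed by simp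
  qed
  then show ?thesis using direct_sum_list_sum[OF Bs(1)] by blast
qed

text \<open>The endomorphism maps the \<open>m\<close>-th image of the span onto the next one by construction.\<close>

lemma Omega_iso_iff:
  "Om \<in> Group.iso (K_Omega_span \<C> m M) (K_Omega_span \<C> (Suc m) M) \<longleftrightarrow> inj_on Om ((Om ^^ m) ` K_span \<C> M)"
proof -
  have im: "Om ` (Om ^^ m) ` K_span \<C> M = (Om ^^ Suc m) ` K_span \<C> M" by (simp add: image_image)
  have sub: "(Om ^^ m) ` K_span \<C> M \<subseteq> carrier KG" using subgroup.subset[OF span_image_subgroup] .
  have "Om \<in> hom (K_Omega_span \<C> m M) (K_Omega_span \<C> (Suc m) M)"
  proof (rule homI)
    fix x y assume x: "x \<in> carrier (K_Omega_span \<C> m M)"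
    then show "Om x \<in> carrier (K_Omega_span \<C> (Suc m) M)" by (auto simp: K_Omega_span_def)
    assume y: "y \<in> carrier (K_Omega_span \<C> m M)"
    have "x \<in> carrier KG" "y \<in> carrier KG" using x y sub by (auto simp: K_Omega_span_def)
    then show "Om (x \<otimes>\<^bsub>K_Omega_span \<C> m M\<^esub> y) = Om x \<otimes>\<^bsub>K_Omega_span \<C> (Suc m) M\<^esub> Om y"
      using hom_mult[OF K_Omega_hom] by (simp add: K_Omega_span_def)
  qed
  then show ?thesis using im by (simp add: Group.iso_def K_Omega_span_def bij_betw_def)
qed

section \<open>Bounds for the Igusa-Todorov functions\<close>

lemma direct_sum_in_class:
  assumes "direct_sum \<C> S xs" "set xs \<subseteq> W" "\<And>Z. zero_object \<C> Z \<Longrightarrow> Z \<in> W"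
    "\<And>S A B. stable_retract S A B \<Longrightarrow> A \<in> W \<Longrightarrow> B \<in> W \<Longrightarrow> S \<in> W"
  shows "S \<in> W"
  using direct_sum_list_sum[OF assms(1)] assms(2)
proof (induction rule: list_sum.induct)
  case (Cons xs T S x)
  then show ?case using assms(4)[OF stable_retract_direct_sum[OF stable_direct_sum[OF Cons.hyps(2)]]] by simp
qed (rule assms(3))

text \<open>The condition under which both Igusa-Todorov functions are bounded by \<open>m\<close>.  Like \<open>perp\<close>, it passes to
  finite direct sums and summands, so it spreads from \<open>M\<close> to the generators of its span.\<close>

definition eventually_perp where
  "eventually_perp m = {X \<in> Obj \<C>. \<forall>K. nth_syzygy \<C> m X K \<longrightarrow> perp K}"

lemma eventually_perp_stable_retract:
  assumes "stable_retract S A B" "A \<in> eventually_perp m" "B \<in> eventually_perp m" shows "S \<in> eventually_perp m"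
  unfolding eventually_perp_def
proof (intro CollectI conjI allI impI)
  show "S \<in> Obj \<C>" using stable_retract_obj[OF assms(1)] by simp
  fix K assume K: "nth_syzygy \<C> m S K"
  obtain A' B' where AB: "nth_syzygy \<C> m A A'" "nth_syzygy \<C> m B B'"
    using nth_syzygy_ex stable_retract_obj[OF assms(1)] by blast
  then have "perp A'" "perp B'" using assms(2,3) unfolding eventually_perp_def by auto
  then show "perp K" by (rule perp_stable_retract[OF nth_syzygy_stable_retract[OF assms(1) K AB]])
qed

lemma eventually_perp_zero: "zero_object \<C> Z \<Longrightarrow> Z \<in> eventually_perp m"
  unfolding eventually_perp_def using Proj_zero nth_syzygy_Proj perp_Proj zero_object_iff by blast

lemma eventually_perp_mono:
  assumes "X \<in> eventually_perp m" "m \<le> n" shows "X \<in> eventually_perp n"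
  unfolding eventually_perp_def
proof (intro CollectI conjI allI impI)
  show "X \<in> Obj \<C>" using assms by (simp add: eventually_perp_def)
  fix K assume "nth_syzygy \<C> n X K"
  then obtain L where "nth_syzygy \<C> m X L" "nth_syzygy \<C> (n - m) L K"
    using nth_syzygy_add[of m "n - m"] assms(2) by auto
  then show "perp K" using assms(1) perp_nth_syzygy unfolding eventually_perp_def by blast
qed

lemma span_subset_class_differences:
  assumes M: "M \<in> eventually_perp m" shows "K_span \<C> M \<subseteq> class_differences (eventually_perp m)"
  unfolding K_span_def
proof (rule KG.generate_subgroup_incl)
  obtain Z where Z: "zero_object \<C> Z" using ex_zero by blast
  show "subgroup (class_differences (eventually_perp m)) KG"
  proof (rule class_differences_subgroup)
    show "eventually_perp m \<subseteq> Obj \<C>" by (auto simp: eventually_perp_def)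
    show "eventually_perp m \<noteq> {}" using M by blast
    show "S \<in> eventually_perp m" if "X \<in> eventually_perp m" "Y \<in> eventually_perp m" "direct_sum \<C> S [X, Y]" for X Y S
      using eventually_perp_stable_retract[OF stable_retract_direct_sum[OF stable_direct_sum]] that by blast
  qed
  show "{kc N | N. indecomposable \<S> N \<and> direct_summand \<S> N M} \<subseteq> class_differences (eventually_perp m)"
  proof
    fix x assume "x \<in> {kc N | N. indecomposable \<S> N \<and> direct_summand \<S> N M}"
    then obtain N where N: "x = kc N" "direct_summand \<S> N M" by blast
    have Np: "N \<in> eventually_perp m" using eventually_perp_stable_retract[OF stable_retract_summand[OF N(2)]] M by blast
    then have "x = kc N \<otimes>\<^bsub>KG\<^esub> inv\<^bsub>KG\<^esub> kc Z"
      using N kc_Proj[OF Proj_zero[OF Z]] by (simp add: eventually_perp_def)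
    then show "x \<in> class_differences (eventually_perp m)" unfolding class_differences_def using Np eventually_perp_zero[OF Z] by blast
  qed
qed

text \<open>An element of the \<open>m\<close>-th image has the form \<open>[\<Omega>\<^sup>m X] - [\<Omega>\<^sup>m Y]\<close> with both objects in
  \<open>perp\<close>.  If \<open>\<Omega>\<close> kills it, then \<open>\<Omega>\<^sup>m\<^sup>+\<^sup>1 X\<close> and \<open>\<Omega>\<^sup>m\<^sup>+\<^sup>1 Y\<close> are stably isomorphic, hence so are \<open>\<Omega>\<^sup>m X\<close>
  and \<open>\<Omega>\<^sup>m Y\<close>.\<close>

lemma Omega_inj_if_eventually_perp:
  assumes M: "M \<in> eventually_perp m"
  shows "inj_on Om ((Om ^^ m) ` K_span \<C> M)"
proof -
  interpret h: group_hom KG KG Om using K_Omega_hom by (simp add: group_hom_def group_hom_axioms_def)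
  interpret hm: group_hom KG KG "Om ^^ m" using funpow_hom by (simp add: group_hom_def group_hom_axioms_def)
  interpret I: subgroup "(Om ^^ m) ` K_span \<C> M" KG by (rule span_image_subgroup)
  have "y = \<one>\<^bsub>KG\<^esub>" if y: "y \<in> (Om ^^ m) ` K_span \<C> M" "Om y = \<one>\<^bsub>KG\<^esub>" for y
  proof -
    obtain X Y where XY: "y = (Om ^^ m) (kc X \<otimes>\<^bsub>KG\<^esub> inv\<^bsub>KG\<^esub> kc Y)" "X \<in> eventually_perp m" "Y \<in> eventually_perp m"
      using y(1) span_subset_class_differences[OF M] unfolding class_differences_def by blast
    have o: "X \<in> Obj \<C>" "Y \<in> Obj \<C>" using XY by (auto simp: eventually_perp_def)
    obtain X' Y' where X': "nth_syzygy \<C> m X X'" "nth_syzygy \<C> m Y Y'" using nth_syzygy_ex o by blast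
    have o': "X' \<in> Obj \<C>" "Y' \<in> Obj \<C>" using nth_syzygy_obj X' by auto
    obtain X'' Y'' where X'': "syzygy \<C> X' X''" "syzygy \<C> Y' Y''" using syzygy_ex o' by blast
    have o'': "X'' \<in> Obj \<C>" "Y'' \<in> Obj \<C>" using syzygy_obj X'' by auto
    have y': "y = kc X' \<otimes>\<^bsub>KG\<^esub> inv\<^bsub>KG\<^esub> kc Y'"
      using XY(1) o funpow_Omega[OF X'(1)] funpow_Omega[OF X'(2)] by simp
    have "Om y = kc X'' \<otimes>\<^bsub>KG\<^esub> inv\<^bsub>KG\<^esub> kc Y''"
      using y' o' K_Omega_syzygy[OF X''(1)] K_Omega_syzygy[OF X''(2)] by simp
    then have "kc X'' = kc Y''" using y(2) o'' KG.inv_equality[of "kc X''" "inv\<^bsub>KG\<^esub> kc Y''"] by simp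
    then have "stable.isomorphic X'' Y''" using K_class_eq_iff o'' by blast
    moreover have "perp X'" "perp Y'" using XY X' unfolding eventually_perp_def by auto
    ultimately have "stable.isomorphic X' Y'" using syzygy_reflects_iso[OF X''] perp_ext1 by blast
    then have "kc X' = kc Y'" by (rule kc_stable_iso)
    then show ?thesis using y' o' by simp
  qed
  then have "kernel (KG\<lparr>carrier := (Om ^^ m) ` K_span \<C> M\<rparr>) KG Om = {\<one>\<^bsub>KG\<^esub>}"
    unfolding kernel_def using I.one_closed h.hom_one by auto
  then show ?thesis using h.inj_on_subgroup_iff_trivial_ker[OF span_image_subgroup] by blast
qed

lemma Phi_le:
  assumes "M \<in> eventually_perp n" shows "IT_Phi \<C> M \<le> n"
  unfolding IT_Phi_def
  by (rule Least_le) (auto simp: Omega_iso_iff intro: Omega_inj_if_eventually_perp eventually_perp_mono[OF assms])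

text \<open>For \<open>N\<close> in \<open>add (\<Omega>\<^sup>k M)\<close> the object \<open>\<Omega>\<^sup>n\<^sup>-\<^sup>k N\<close> is a stable summand of copies of \<open>\<Omega>\<^sup>n M\<close>, hence in
  \<open>perp\<close>; it is projective once \<open>N\<close> has finite projective dimension.\<close>

lemma Psi_le:
  assumes M: "M \<in> eventually_perp n" shows "IT_Psi \<C> M \<le> enat n"
proof -
  define k where "k = IT_Phi \<C> M"
  define K where "K = Omega_obj \<C> k M"
  have k: "k \<le> n" unfolding k_def by (rule Phi_le[OF M])
  have Mo: "M \<in> Obj \<C>" using M by (simp add: eventually_perp_def)
  have K: "nth_syzygy \<C> k M K" unfolding K_def Omega_obj_def by (rule someI_ex[OF nth_syzygy_ex[OF Mo]])
  have Kp: "K \<in> eventually_perp (n - k)"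
    unfolding eventually_perp_def
  proof (intro CollectI conjI allI impI)
    show "K \<in> Obj \<C>" using nth_syzygy_obj[OF K] by blast
    fix L assume "nth_syzygy \<C> (n - k) K L"
    then have "nth_syzygy \<C> n M L" using nth_syzygy_add[of k "n - k" M L] K k by auto
    then show "perp L" using M unfolding eventually_perp_def by blast
  qed
  have "proj_dim \<C> N \<le> enat (n - k)" if N: "N \<in> add_class \<C> K" and fin: "proj_dim \<C> N < \<infinity>" for N
  proof -
    obtain r S where S: "direct_sum \<C> S (replicate r K)" "direct_summand \<C> N S" using N unfolding add_class_def by blast
    have "S \<in> eventually_perp (n - k)"
      by (rule direct_sum_in_class[OF S(1)]) (use Kp eventually_perp_zero eventually_perp_stable_retract in auto)
    moreover have "direct_summand \<S> N S" using S(2) stable_direct_sum unfolding direct_summand_def by blast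
    ultimately have Np: "N \<in> eventually_perp (n - k)" using eventually_perp_stable_retract[OF stable_retract_summand] by blast
    then have No: "N \<in> Obj \<C>" by (simp add: eventually_perp_def)
    obtain L where L: "nth_syzygy \<C> (n - k) N L" using nth_syzygy_ex[OF No] by blast
    obtain d where d: "proj_dim \<C> N = enat d" using fin by (cases "proj_dim \<C> N") auto
    obtain D where D: "nth_syzygy \<C> d N D" using nth_syzygy_ex[OF No] by blast
    have DP: "D \<in> Proj \<C>" using proj_dim_le_iff[OF No D] d by simp
    obtain E where E: "nth_syzygy \<C> d L E" using nth_syzygy_ex nth_syzygy_obj[OF L] by blast
    have "nth_syzygy \<C> (n - k + d) N E" using nth_syzygy_add L E by blast
    then have "E \<in> Proj \<C>" by (rule nth_syzygy_Proj_mono[OF D DP le_add2])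
    moreover have "perp L" using Np L unfolding eventually_perp_def by blast
    ultimately have "L \<in> Proj \<C>" using perp_Proj_if_nth_syzygy_Proj E by blast
    then show ?thesis using proj_dim_le_iff[OF No L] by simp
  qed
  then have "fin_proj_dim \<C> (add_class \<C> K) \<le> enat (n - k)"
    unfolding fin_proj_dim_def by (intro SUP_least) auto
  then have "enat k + fin_proj_dim \<C> (add_class \<C> K) \<le> enat k + enat (n - k)" by (rule add_left_mono)
  then show ?thesis using k by (simp add: IT_Psi_def k_def[symmetric] K_def[symmetric])
qed

text \<open>A syzygy of \<open>M\<close> of order \<open>d = pd M\<close> is projective, so the images of the span vanish from \<open>d\<close> on.  This
  makes the set of which \<open>IT_Phi\<close> takes the least element nonempty.  From \<open>\<Phi>(M)\<close> on the maps between the images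
  are injective, so the images vanish already there.\<close>

lemma proj_dim_le_Phi:
  assumes M: "M \<in> Obj \<C>" and fin: "proj_dim \<C> M < \<infinity>"
  shows "proj_dim \<C> M \<le> enat (IT_Phi \<C> M)"
proof -
  obtain d where d: "proj_dim \<C> M = enat d" using fin by (cases "proj_dim \<C> M") auto
  obtain D where D: "nth_syzygy \<C> d M D" using nth_syzygy_ex[OF M] by blast
  have DP: "D \<in> Proj \<C>" using proj_dim_le_iff[OF M D] d by simp
  define G where "G m = (Om ^^ m) ` K_span \<C> M" for m
  have one: "\<one>\<^bsub>KG\<^esub> \<in> G m" for m unfolding G_def using subgroup.one_closed[OF span_image_subgroup] .
  \<comment> \<open>every generator of the span is the class of a stable retract of \<open>M\<close>, whose \<open>m\<close>-th syzygy is projective\<close>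
  have triv: "G m = {\<one>\<^bsub>KG\<^esub>}" if "d \<le> m" for m
  proof -
    interpret hm: group_hom KG KG "Om ^^ m" using funpow_hom by (simp add: group_hom_def group_hom_axioms_def)
    have "K_span \<C> M \<subseteq> kernel KG KG (Om ^^ m)"
      unfolding K_span_def
    proof (rule KG.generate_subgroup_incl[OF _ hm.subgroup_kernel], rule subsetI)
      fix x assume "x \<in> {kc N | N. indecomposable \<S> N \<and> direct_summand \<S> N M}"
      then obtain N where N: "x = kc N" "direct_summand \<S> N M" by blast
      have w: "stable_retract N M M" by (rule stable_retract_summand[OF N(2)])
      have No: "N \<in> Obj \<C>" using stable_retract_obj[OF w] by blast
      obtain L where L: "nth_syzygy \<C> m N L" using nth_syzygy_ex[OF No] by blast
      obtain E where E: "nth_syzygy \<C> m M E" using nth_syzygy_ex[OF M] by blast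
      have "E \<in> Proj \<C>" by (rule nth_syzygy_Proj_mono[OF D DP that E])
      then have "L \<in> Proj \<C>" using stable_retract_Proj[OF nth_syzygy_stable_retract[OF w L E E]] by blast
      then have "(Om ^^ m) (kc N) = \<one>\<^bsub>KG\<^esub>" using funpow_Omega[OF L] kc_Proj by simp
      then show "x \<in> kernel KG KG (Om ^^ m)" using N No by (simp add: kernel_def)
    qed
    then have "G m \<subseteq> {\<one>\<^bsub>KG\<^esub>}" unfolding G_def kernel_def by auto
    then show ?thesis using one[of m] by blast
  qed
  let ?P = "\<lambda>k. \<forall>m \<ge> k. Om \<in> Group.iso (K_Omega_span \<C> m M) (K_Omega_span \<C> (Suc m) M)"
  have iff: "?P k \<longleftrightarrow> (\<forall>m \<ge> k. inj_on Om (G m))" for k by (simp add: Omega_iso_iff G_def)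
  have "?P d" unfolding iff using triv by simp
  then have "?P (IT_Phi \<C> M)" unfolding IT_Phi_def by (rule LeastI)
  then have inj: "inj_on Om (G m)" if "IT_Phi \<C> M \<le> m" for m using iff that by blast
  \<comment> \<open>injectivity propagates the vanishing from one image back to the one before it\<close>
  have down: "G m = {\<one>\<^bsub>KG\<^esub>}" if m: "IT_Phi \<C> M \<le> m" and Sm: "G (Suc m) = {\<one>\<^bsub>KG\<^esub>}" for m
  proof -
    have "Om ` G m = G (Suc m)" by (simp add: G_def image_image)
    then have "Om x = \<one>\<^bsub>KG\<^esub>" if "x \<in> G m" for x using that Sm by blast
    then have "x = \<one>\<^bsub>KG\<^esub>" if "x \<in> G m" for x using inj_onD[OF inj[OF m]] that one by metis
    then show ?thesis using one[of m] by blast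
  qed
  define k where "k = IT_Phi \<C> M"
  have Gk: "G k = {\<one>\<^bsub>KG\<^esub>}"
  proof (cases "d \<le> k")
    case True
    then show ?thesis using triv by blast
  next
    case False
    then have "k \<le> d" by simp
    then show ?thesis
    proof (induction rule: inc_induct)
      case base
      then show ?case using triv by simp
    next
      case (step n)
      then show ?case using down[of n] k_def by simp
    qed
  qed
  obtain K where K: "nth_syzygy \<C> k M K" using nth_syzygy_ex[OF M] by blast
  have "(Om ^^ k) (kc M) \<in> G k" unfolding G_def using kc_in_span[OF M] by blast
  then have "kc K = \<one>\<^bsub>KG\<^esub>" using Gk funpow_Omega[OF K] by simp
  moreover obtain Z where Z: "zero_object \<C> Z" using ex_zero by blast
  ultimately have "kc K = kc Z" using kc_Proj[OF Proj_zero[OF Z]] by simp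
  then have "stable.isomorphic K Z" using K_class_eq_iff nth_syzygy_obj[OF K] Z zero_object_iff by blast
  then have "K \<in> Proj \<C>" using stable_retract_Proj[OF stable_retract_isomorphic] Proj_zero[OF Z] by blast
  then show ?thesis using proj_dim_le_iff[OF M K] k_def by simp
qed

end

theorem theorem4p3:
  fixes \<C> :: "('o, 'm) exact_cat"
  assumes "exact_IT_context \<C>"
    and "weakly_idempotent_complete \<C>"
  shows "(\<forall>n. inj_dim_class \<C> (Proj \<C>) = enat n \<longrightarrow>
            Phi_dim \<C> (Omega_class \<C> n) = 0 \<and> Psi_dim \<C> (Omega_class \<C> n) = 0) \<and>
         (fin_proj_dim \<C> (Obj \<C>) \<le> Phi_dim \<C> (Obj \<C>) \<and>
          Phi_dim \<C> (Obj \<C>) \<le> Psi_dim \<C> (Obj \<C>) \<and>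
          Psi_dim \<C> (Obj \<C>) \<le> inj_dim_class \<C> (Proj \<C>))"
proof -
  interpret E: exact_category \<C> using assms(1) by (simp add: exact_IT_context_def)
  interpret IT_context \<C>
    by unfold_locales (use assms in \<open>auto simp: exact_IT_context_def\<close>)
  have Phi_Psi: "Phi_dim \<C> \<Y> \<le> Psi_dim \<C> \<Y>" for \<Y>
    unfolding Phi_dim_def Psi_dim_def IT_Psi_def by (rule SUP_mono) (meson le_iff_add)
  show ?thesis
  proof (intro conjI allI impI)
    fix n assume n: "inj_dim_class \<C> (Proj \<C>) = enat n"
    have "IT_Psi \<C> K \<le> 0" if KO: "K \<in> Omega_class \<C> n" for K
    proof -
      obtain M where "nth_syzygy \<C> n M K" using KO unfolding Omega_class_def by blast
      then have "perp K" using perp_Omega_class[of n M K] n by simp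
      then have "K \<in> eventually_perp 0" by (auto simp: eventually_perp_def perp_def)
      then show ?thesis using Psi_le[of K 0] by (simp add: zero_enat_def)
    qed
    then have "Psi_dim \<C> (Omega_class \<C> n) \<le> 0" unfolding Psi_dim_def by (intro SUP_least) auto
    then show "Psi_dim \<C> (Omega_class \<C> n) = 0" "Phi_dim \<C> (Omega_class \<C> n) = 0"
      using Phi_Psi[of "Omega_class \<C> n"] by auto
  next
    show "fin_proj_dim \<C> (Obj \<C>) \<le> Phi_dim \<C> (Obj \<C>)"
      unfolding fin_proj_dim_def Phi_dim_def by (rule SUP_mono) (use proj_dim_le_Phi in blast)
    show "Phi_dim \<C> (Obj \<C>) \<le> Psi_dim \<C> (Obj \<C>)" by (rule Phi_Psi)
    show "Psi_dim \<C> (Obj \<C>) \<le> inj_dim_class \<C> (Proj \<C>)"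
    proof (cases "inj_dim_class \<C> (Proj \<C>)")
      case (enat n)
      have "IT_Psi \<C> M \<le> enat n" if "M \<in> Obj \<C>" for M
        using that perp_Omega_class[of n M] enat by (intro Psi_le) (simp add: eventually_perp_def)
      then show ?thesis unfolding Psi_dim_def enat by (intro SUP_least) auto
    qed simp
  qed
qed

end
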